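(* Let $d,t\in\mathbb{N}$. Let $C_{1,d},C_{2,d}>0$ be constants depending only on $d$ with the following property: for every $s\in\mathbb{N}$ and every $N\in\mathbb{N}$ with $N\ge C_{1,d}s^d$ there is a continuous mapping $F:\mathcal{P}_s\to(\mathbb{S}^d)^N$, $F(P)=(x_1(P),\dots,x_N(P))$, such that $\sum_{i=1}^N P(x_i(P))>N C_{2,d}s^{-1}$ for all $P\in\mathcal{P}_s$ with $\int_{\mathbb{S}^d}|\nabla P|\,d\mu_d=1$. Put $C_{3,d}:=\sqrt{\frac{d+1}{d}}$. Let $\mathcal{Y}_M=\{y_1,\dots,y_M\}\subset\mathbb{S}^d$ be given. (i) For every $$N\ge\max\Bigl(C_{1,d}t^d,\ C_{2,d}^{-1}C_{3,d}\,M\,t\,\sqrt{D(t+1,d+1)\,D_t}\Bigr)$$ there exists $\mathcal{X}_N=\{x_1,\dots,x_N\}\subset\mathbb{S}^d$ such that $\mathcal{X}_N\cup\mathcal{Y}_M$ is a spherical $t$-design. (ii) Moreover, if $\mathcal{Y}_M$ is a spherical $t_1$-design with $t_1<t$, then the same conclusion holds for every $$N\ge\max\Bigl(C_{1,d}t^d,\ C_{2,d}^{-1}C_{3,d}\,M\,t\,\sqrt{D_t-D_{t_1}}\,\sqrt{D(t+1,d+1)}\Bigr).$$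
   Context: $\mathbb{S}^d=\{x\in\mathbb{R}^{d+1}:|x|=1\}$, and $\mu_d$ is the normalized Lebesgue (surface) measure with $\mu_d(\mathbb{S}^d)=1$. Point sets are finite multisets (points may coincide) and unions are multiset unions. For $s\in\mathbb{N}$, a multiset $\{z_1,\dots,z_K\}\subset\mathbb{S}^d$ is a spherical $s$-design if $\int_{\mathbb{S}^d}P\,d\mu_d=\frac1K\sum_{i=1}^K P(z_i)$ for all real polynomials $P$ in $d+1$ variables of degree at most $s$. $\mathcal{P}_s$ is the finite-dimensional real space (with its usual topology) of restrictions to $\mathbb{S}^d$ of real polynomials of degree at most $s$ with $\int_{\mathbb{S}^d}P\,d\mu_d=0$. The spherical gradient $\nabla Q(x)$ at $x\in\mathbb{S}^d$ is the Euclidean gradient in $\mathbb{R}^{d+1}$ of $x\mapsto Q(x/|x|)$. For $\ell\ge1$, $D(\ell,d):=\frac{2\ell+d-1}{\ell+d-1}\binom{\ell+d-1}{\ell}$, and $D(0,d):=1$; $D_s:=\dim\mathcal{P}_s=\sum_{i=1}^s D(i,d)=D(s,d+1)-1$. Constants $C_{1,d},C_{2,d}$ with the stated property exist for each $d$. *)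

theory Defs
  imports "HOL-Analysis.Analysis" "HOL-Library.Function_Algebras" "HOL-Library.Multiset"
begin

instantiation "fun" :: (type, real_vector) real_vector
begin

definition scaleR_fun :: "real \<Rightarrow> ('a \<Rightarrow> 'b) \<Rightarrow> 'a \<Rightarrow> 'b"
  where "scaleR_fun c f = (\<lambda>x. c *\<^sub>R f x)"

instance
  by standard (auto simp: scaleR_fun_def fun_eq_iff scaleR_add_right scaleR_add_left)

end

text \<open>
  The normalized surface measure, as the cone measure: the measure of a Borel set \<open>A\<close> of unit
  vectors is the proportion of the unit ball lying over \<open>A\<close>. Lemma \<open>sphere_measure_rotation\<close> below
  shows that it is the rotation invariant probability measure on the sphere (for well-ordered
  index types, to which the library restricts the change of variables it relies on). The origin, where
  \<open>sgn x = x / norm x\<close> is \<open>0\<close>, is a null set.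
\<close>

definition sphere_measure :: "(real ^ 'n) measure"
  where "sphere_measure =
    restrict_space (distr (uniform_measure lborel (ball 0 1)) borel sgn) (sphere 0 1)"

definition polys_upto :: "nat \<Rightarrow> (real ^ 'n \<Rightarrow> real) set"
  where "polys_upto s =
    span {\<lambda>x. \<Prod>i\<in>UNIV. (x $ i) ^ \<alpha> i |\<alpha> :: 'n \<Rightarrow> nat. (\<Sum>i\<in>UNIV. \<alpha> i) \<le> s}"

definition spherical_design :: "nat \<Rightarrow> (real ^ 'n) multiset \<Rightarrow> bool"
  where "spherical_design s Z \<longleftrightarrow>
    Z \<noteq> {#} \<and> set_mset Z \<subseteq> sphere 0 1 \<and>
    (\<forall>P \<in> polys_upto s. (LINT x|sphere_measure. P x) = 1 / real (size Z) * (\<Sum>z\<in>#Z. P z))"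

text \<open>
  A function on the sphere is encoded by its extension by zero to the ambient space, so that
  polynomials agreeing on the sphere are identified. The function type carries the topology of
  pointwise convergence; on the finite-dimensional space \<open>mean_zero_polys s\<close> this is a Hausdorff
  vector space topology, hence the usual one.
\<close>

definition restrict_sphere :: "(real ^ 'n \<Rightarrow> real) \<Rightarrow> real ^ 'n \<Rightarrow> real"
  where "restrict_sphere P = (\<lambda>x. if x \<in> sphere 0 1 then P x else 0)"

definition mean_zero_polys :: "nat \<Rightarrow> (real ^ 'n \<Rightarrow> real) set"
  where "mean_zero_polys s =
    {restrict_sphere P |P. P \<in> polys_upto s \<and> (LINT x|sphere_measure. P x) = 0}"

definition spherical_gradient :: "(real ^ 'n \<Rightarrow> real) \<Rightarrow> real ^ 'n \<Rightarrow> real ^ 'n"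
  where "spherical_gradient Q x = (THE g. GDERIV (\<lambda>y. Q (y /\<^sub>R norm y)) x :> g)"

text \<open>Truncated subtraction is harmless here, since it only occurs for \<open>l \<ge> 1\<close>.\<close>

definition harmonic_dim :: "nat \<Rightarrow> nat \<Rightarrow> real"
  where "harmonic_dim l d =
    (if l = 0 then 1
     else real (2 * l + d - 1) / real (l + d - 1) * real ((l + d - 1) choose l))"

lemma space_sphere_measure [simp]: "space sphere_measure = sphere 0 1"
  by (simp add: sphere_measure_def space_restrict_space)

lemma borel_measurable_sgn_vec: "(sgn :: real ^ 'n \<Rightarrow> real ^ 'n) \<in> borel_measurable borel"
  unfolding sgn_div_norm by measurable

lemma emeasure_sphere_measure:
  fixes A :: "(real ^ 'n) set"
  assumes "A \<in> sets borel" "A \<subseteq> sphere 0 1"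
  shows "emeasure sphere_measure A =
    emeasure lborel {x \<in> ball 0 1. sgn x \<in> A} / emeasure lborel (ball 0 1 :: (real ^ 'n) set)"
proof -
  have m: "sgn \<in> measurable (uniform_measure lborel (ball 0 1)) (borel :: (real ^ 'n) measure)"
    using borel_measurable_sgn_vec by (simp add: measurable_def)
  have v: "sgn -` A \<in> sets (borel :: (real ^ 'n) measure)"
    using measurable_sets[OF borel_measurable_sgn_vec assms(1)] by simp
  have eq: "ball 0 1 \<inter> sgn -` A = {x \<in> ball 0 1. sgn x \<in> A}" by auto
  have "emeasure sphere_measure A =
      emeasure (distr (uniform_measure lborel (ball 0 1)) borel sgn) A"
    unfolding sphere_measure_def using assms by (intro emeasure_restrict_space) auto
  also have "\<dots> = emeasure (uniform_measure lborel (ball 0 1)) (sgn -` A)"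
    using assms(1) m by (simp add: emeasure_distr)
  also have "\<dots> = emeasure lborel {x \<in> ball 0 1. sgn x \<in> A} /
      emeasure lborel (ball 0 1 :: (real ^ 'n) set)"
    using v eq by simp
  finally show ?thesis .
qed

lemma emeasure_unit_ball_pos_finite:
  "emeasure lborel (ball 0 1 :: (real ^ 'n) set) \<noteq> 0"
  "emeasure lborel (ball 0 1 :: (real ^ 'n) set) \<noteq> \<infinity>"
  using emeasure_lborel_ball_finite[of "0 :: real ^ 'n" 1]
  by (simp_all add: emeasure_ball less_top unit_ball_vol_pos[THEN less_imp_neq, symmetric])

lemma emeasure_sphere_measure_space:
  "emeasure (sphere_measure :: (real ^ 'n) measure) (sphere 0 1) = 1"
proof -
  have "{x :: real ^ 'n. x \<in> ball 0 1 \<and> sgn x \<in> sphere 0 1} = ball 0 1 - {0}"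
    by (auto simp: norm_sgn)
  moreover have "emeasure lborel (ball 0 1 - {0 :: real ^ 'n}) = emeasure lborel (ball 0 1 :: (real ^ 'n) set)"
    by (intro emeasure_Diff_null_set) auto
  ultimately show ?thesis
    using emeasure_unit_ball_pos_finite[where 'n = 'n]
    by (simp add: emeasure_sphere_measure ennreal_divide_self less_top zero_less_iff_neq_zero)
qed

lemma sphere_measure_rotation:
  fixes f :: "real ^ 'n::{finite,wellorder} \<Rightarrow> real ^ 'n::{finite,wellorder}"
  assumes f: "orthogonal_transformation f" and A: "A \<in> sets borel" "A \<subseteq> sphere 0 1"
  shows "emeasure sphere_measure (f ` A) = emeasure sphere_measure A"
proof -
  interpret linear f using f by (rule orthogonal_transformation_linear)
  have nf: "norm (f x) = norm x" for x
    using f by (rule orthogonal_transformation_norm)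
  have sf: "sgn (f x) = f (sgn x)" for x by (simp add: sgn_div_norm scaleR nf)
  have inj: "inj f" and surj: "surj f"
    using f by (auto simp: orthogonal_transformation_inj orthogonal_transformation_surj)
  have inv: "orthogonal_transformation (inv f)" using f by (rule orthogonal_transformation_inv)
  have fA: "f ` A = inv f -` A"
    using inj surj by (metis bij_def bij_imp_bij_inv bij_vimage_eq_inv_image inv_inv_eq)
  have "inv f \<in> borel_measurable borel"
    using orthogonal_transformation_linear[OF inv]
    by (intro borel_measurable_continuous_onI linear_continuous_on)
       (simp add: linear_conv_bounded_linear)
  then have mfA: "f ` A \<in> sets borel"
    unfolding fA using A(1) measurable_sets[of "inv f" borel borel A] by simp
  have sub: "f ` A \<subseteq> sphere 0 1" using A(2) by (auto simp: nf)
  have m: "{x \<in> ball 0 1. sgn x \<in> B} \<in> sets lborel" if "B \<in> sets borel" for B :: "(real ^ 'n::{finite,wellorder}) set"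
  proof -
    have "{x \<in> ball 0 1. sgn x \<in> B} = ball 0 1 \<inter> (sgn -` B \<inter> space borel)" by auto
    then show ?thesis using measurable_sets[OF borel_measurable_sgn_vec that] by auto
  qed
  have img: "{x \<in> ball 0 1. sgn x \<in> f ` A} = f ` {x \<in> ball 0 1. sgn x \<in> A}"
  proof (intro equalityI subsetI)
    fix x assume "x \<in> {x \<in> ball 0 1. sgn x \<in> f ` A}"
    moreover obtain y where "x = f y" using surj by (metis surjD)
    ultimately show "x \<in> f ` {x \<in> ball 0 1. sgn x \<in> A}"
      using inj by (auto simp: nf sf inj_image_mem_iff)
  qed (auto simp: nf sf)
  have fin: "{x \<in> ball 0 1. sgn x \<in> B} \<in> lmeasurable" if "B \<in> sets borel" for B :: "(real ^ 'n::{finite,wellorder}) set"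
    using m[OF that] by (intro bounded_set_imp_lmeasurable bounded_subset[OF bounded_ball[of 0 1]]) auto
  have "emeasure lborel (f ` {x \<in> ball 0 1. sgn x \<in> A}) =
      emeasure lebesgue (f ` {x \<in> ball 0 1. sgn x \<in> A})"
    using m[OF mfA] img by (simp add: emeasure_completion)
  also have "\<dots> = emeasure lebesgue {x \<in> ball 0 1. sgn x \<in> A}"
    using measure_orthogonal_image[OF f fin[OF A(1)]] fin[OF mfA] fin[OF A(1)] img
    by (simp add: emeasure_eq_measure2 fmeasurableD2)
  also have "\<dots> = emeasure lborel {x \<in> ball 0 1. sgn x \<in> A}"
    using m[OF A(1)] by simp
  finally show ?thesis
    using emeasure_sphere_measure[OF mfA sub] emeasure_sphere_measure[OF A] img by simp
qed

end

theory Submission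
  imports Defs
begin

text \<open>
  Let \<open>V\<close> be the space of mean zero polynomials of degree at most \<open>t\<close> on the sphere. A nonempty
  multiset of points is a \<open>t\<close>-design exactly when every \<open>f \<in> V\<close> sums to zero over it
  (\<open>spherical_design_iff\<close>). For \<open>Q \<in> V\<close> let \<open>T Q\<close> be the linear functional
  \<open>f \<mapsto> (\<Sum>j. f (x\<^sub>j Q)) + (\<Sum>y\<in>#Y. f y)\<close> on \<open>V\<close>; the task is to find \<open>Q\<close> with \<open>T Q = 0\<close>. In the
  coordinates of an orthonormal basis of \<open>V\<close>, the map \<open>T\<close> is a continuous vector field on a Euclidean
  space, and a field that points outward along the boundary of a cube vanishes somewhere inside
  (\<open>outward_field_has_zero\<close>). Composing with the radial retraction of \<open>V\<close> onto the unit ball of the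
  norm \<open>q Q = \<integral> |\<nabla>Q|\<close> reduces the outward condition to \<open>T Q Q > 0\<close> for \<open>q Q = 1\<close>
  (\<open>design_extension\<close>). The dimension of \<open>V\<close> grows with \<open>t\<close>, so the cubes live in the space of real
  sequences, and their fixed point theory is derived from Kuhn's combinatorial lemma.
  
  The assumption on \<open>x\<^sub>j\<close> makes the first sum of \<open>T Q Q\<close> larger than \<open>N C\<^sub>2 / t\<close>. It remains to bound
  the sum of \<open>Q\<close> over the \<open>M\<close> points of \<open>Y\<close>, in two steps.
  
  First, \<open>|\<Sum>y\<in>#Y. Q y| \<le> M \<parallel>Q\<parallel> sqrt (D\<^sub>t - D\<^sub>s)\<close> with the \<open>L\<^sup>2\<close> norm of \<open>Q\<close>, if all mean zero
  polynomials of degree at most \<open>s\<close> sum to zero over \<open>Y\<close> (\<open>point_sum_le\<close>). The part of \<open>Q\<close> in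
  the smaller space drops out, and for the rest one uses the addition theorem: the squares of an
  orthonormal basis of a rotation invariant space add up to the dimension of the space at every point.
  Part (ii) takes \<open>s = t\<^sub>1\<close>; part (i) takes \<open>s = 0\<close>, where the space is trivial.
  
  Second, \<open>d \<parallel>Q\<parallel>\<^sup>2 \<le> D(t+1,d+1) (q Q)\<^sup>2\<close> (\<open>norm_le_gradient\<close>). By the Poincare inequality the left
  side is at most \<open>\<integral> |\<nabla>Q|\<^sup>2\<close>, hence at most \<open>q Q\<close> times the maximum of \<open>|\<nabla>Q|\<close>. The components of
  \<open>\<nabla>Q\<close> are polynomials of degree \<open>t + 1\<close>, and the reproducing kernel of these polynomials is bounded
  by their dimension, which is at most \<open>D(t+1,d+1)\<close>; so the maximum is at most \<open>D(t+1,d+1) q Q\<close>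
  (\<open>nikolskii_vector\<close>). The Poincare inequality itself rests on the action of the Laplacian on
  polynomials, which is triangular for the degree with diagonal entries \<open>s (s + d - 1)\<close>
  (\<open>casimir_leading\<close>).
\<close>

section \<open>Zeros of vector fields on cubes\<close>

lemma tendsto_fun_componentwise:
  fixes f :: "'b \<Rightarrow> 'i \<Rightarrow> 'a::topological_space"
  assumes "\<And>i. ((\<lambda>n. f n i) \<longlongrightarrow> l i) F"
  shows "(f \<longlongrightarrow> l) F"
proof -
  have "limitin (product_topology (\<lambda>_. euclidean) UNIV) f l F"
    using assms by (simp add: limitin_componentwise)
  then show ?thesis by (simp add: euclidean_product_topology)
qed

text \<open>
  A copy of \<open>[-R,R]^n\<close> in a type that does not depend on \<open>n\<close>: the coordinates from \<open>n\<close> on vanish.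
\<close>

definition cube :: "nat \<Rightarrow> real \<Rightarrow> (nat \<Rightarrow> real) set"
  where "cube n R = {x. (\<forall>i<n. \<bar>x i\<bar> \<le> R) \<and> (\<forall>i\<ge>n. x i = 0)}"

lemma compact_cube: "compact (cube n R)"
proof -
  have "cube n R = PiE UNIV (\<lambda>i. if i < n then {-R..R} else {0})"
  proof (rule set_eqI)
    fix x :: "nat \<Rightarrow> real"
    have "(\<bar>x i\<bar> \<le> R) = (x i \<in> {-R..R})" for i by (auto simp: abs_le_iff)
    then show "x \<in> cube n R \<longleftrightarrow> x \<in> PiE UNIV (\<lambda>i. if i < n then {-R..R} else {0})"
      unfolding cube_def PiE_UNIV_domain Pi_def by (auto simp: not_less)
  qed
  moreover have "compactin (product_topology (\<lambda>_. euclidean) UNIV)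
      (PiE UNIV (\<lambda>i. if i < n then {-R..R::real} else {0}))"
    by (subst compactin_PiE) auto
  ultimately show ?thesis
    by (simp add: euclidean_product_topology)
qed

text \<open>
  Kuhn's lemma for the signs of the \<open>h i\<close> as labels gives, in a grid of mesh \<open>2 R / (m + 1)\<close>, a cell
  on which every \<open>h i\<close> takes values of both signs. By compactness these cells accumulate at a point
  as \<open>m\<close> grows, and by continuity this point is a common zero.
\<close>

lemma poincare_miranda:
  fixes h :: "(nat \<Rightarrow> real) \<Rightarrow> nat \<Rightarrow> real"
  assumes R: "R > 0"
    and cont: "\<And>i. i < n \<Longrightarrow> continuous_on (cube n R) (\<lambda>x. h x i)"
    and lower: "\<And>x i. x \<in> cube n R \<Longrightarrow> i < n \<Longrightarrow> x i = -R \<Longrightarrow> h x i \<le> 0"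
    and upper: "\<And>x i. x \<in> cube n R \<Longrightarrow> i < n \<Longrightarrow> x i = R \<Longrightarrow> h x i \<ge> 0"
  obtains x where "x \<in> cube n R" "\<And>i. i < n \<Longrightarrow> h x i = 0"
proof -
  define pt where "pt p r = (\<lambda>i. if i < n then -R + 2 * R * real (r i) / real p else 0)" for p :: nat and r :: "nat \<Rightarrow> nat"
  have pt: "pt p r \<in> cube n R" if "p > 0" "\<forall>i<n. r i \<le> p" for p r
  proof -
    have "\<bar>- R + 2 * R * real (r i) / real p\<bar> \<le> R" if "i < n" for i
    proof -
      have "real (r i) / real p \<le> 1" "0 \<le> real (r i) / real p" using that \<open>\<forall>i<n. r i \<le> p\<close> \<open>p > 0\<close> by auto
      then have "R * (real (r i) / real p) \<le> R" "0 \<le> R * (real (r i) / real p)"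
        using R by (simp_all add: mult_left_le del: times_divide_eq_right)
      then show ?thesis by (simp add: abs_le_iff)
    qed
    then show ?thesis by (auto simp: cube_def pt_def)
  qed
  \<comment> \<open>Near \<open>a\<close>, at the scale of the grid, the \<open>i\<close>-th component changes sign from \<open>r\<close> to \<open>s\<close>.\<close>
  define straddle where "straddle m a i r s \<longleftrightarrow> r \<in> cube n R \<and> s \<in> cube n R \<and>
      (\<forall>j. \<bar>r j - a j\<bar> \<le> 2 * R / real (Suc m)) \<and> (\<forall>j. \<bar>s j - a j\<bar> \<le> 2 * R / real (Suc m)) \<and>
      h r i \<le> 0 \<and> 0 \<le> h s i"
    for m :: nat and a :: "nat \<Rightarrow> real" and i r s
  have step: "\<exists>a\<in>cube n R. \<forall>i. \<exists>r s. i < n \<longrightarrow> straddle m a i r s" for m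
  proof -
    define p where "p = Suc m"
    \<comment> \<open>On the upper face the label must be 1 and on the lower face 0, also where the component vanishes.\<close>
    define label where "label r i = (if r i = p then 1 else if r i = 0 \<or> h (pt p r) i \<le> 0 then 0 else (1::nat))" for r i
    have p: "p > 0" by (simp add: p_def)
    obtain q where q: "\<forall>i<n. q i < p"
      and rs: "\<forall>i<n. \<exists>r s. (\<forall>j<n. q j \<le> r j \<and> r j \<le> q j + 1) \<and> (\<forall>j<n. q j \<le> s j \<and> s j \<le> q j + 1) \<and> label r i \<noteq> label s i"
      by (rule kuhn_lemma[OF p, of n label]) (use p in \<open>auto simp: label_def\<close>)
    have lab0: "h (pt p r) i \<le> 0" if "label r i = 0" "\<forall>j<n. r j \<le> p" "i < n" for r i
    proof (cases "r i = 0")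
      case True
      then show ?thesis using lower[OF pt[OF p that(2)] that(3)] that(3) by (simp add: pt_def)
    qed (use that in \<open>auto simp: label_def split: if_splits\<close>)
    have lab1: "h (pt p r) i \<ge> 0" if "label r i \<noteq> 0" "\<forall>j<n. r j \<le> p" "i < n" for r i
    proof (cases "r i = p")
      case True
      then show ?thesis using upper[OF pt[OF p that(2)] that(3)] that(3) p by (simp add: pt_def)
    qed (use that in \<open>auto simp: label_def split: if_splits\<close>)
    have near: "\<bar>pt p r j - pt p q j\<bar> \<le> 2 * R / real (Suc m)" if "\<forall>j<n. q j \<le> r j \<and> r j \<le> q j + 1" for r j
    proof (cases "j < n")
      case True
      then have "real (r j) - real (q j) \<le> 1" "0 \<le> real (r j) - real (q j)" using that by force+
      moreover have "pt p r j - pt p q j = 2 * R / real p * (real (r j) - real (q j))"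
        using True p by (simp add: pt_def field_simps)
      ultimately show ?thesis using R p
        by (simp add: abs_mult p_def) (intro divide_right_mono, simp_all add: mult_left_le)
    next
      case False
      then show ?thesis using R by (simp add: pt_def)
    qed
    have "\<exists>r s. i < n \<longrightarrow> straddle m (pt p q) i r s" for i
    proof (cases "i < n")
      case True
      then obtain r s where r: "\<forall>j<n. q j \<le> r j \<and> r j \<le> q j + 1" and s: "\<forall>j<n. q j \<le> s j \<and> s j \<le> q j + 1"
        and ne: "label r i \<noteq> label s i" using rs by blast
      have rp: "\<forall>j<n. r j \<le> p" "\<forall>j<n. s j \<le> p" using r s q by force+
      show ?thesis
      proof (cases "label r i = 0")
        case T: True
        then have "label s i \<noteq> 0" using ne by simp
        then show ?thesis
          using pt[OF p rp(1)] pt[OF p rp(2)] near[OF r] near[OF s] lab0[OF T rp(1) True] lab1[OF \<open>label s i \<noteq> 0\<close> rp(2) True]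
          unfolding straddle_def by blast
      next
        case F: False
        then have "label s i = 0" using ne by (auto simp: label_def split: if_splits)
        then show ?thesis
          using pt[OF p rp(1)] pt[OF p rp(2)] near[OF r] near[OF s] lab1[OF F rp(1) True] lab0[OF \<open>label s i = 0\<close> rp(2) True]
          unfolding straddle_def by blast
      qed
    qed auto
    moreover have "pt p q \<in> cube n R" using pt[OF p] q by (simp add: less_imp_le)
    ultimately show ?thesis by blast
  qed
  then obtain a where a: "\<And>m. a m \<in> cube n R" and "\<forall>m i. \<exists>r s. i < n \<longrightarrow> straddle m (a m) i r s"
    by metis
  then obtain r s where "\<And>m i. i < n \<Longrightarrow> straddle m (a m) i (r m i) (s m i)"
    by metis
  note rs = this[unfolded straddle_def]
  obtain x \<sigma> where x: "x \<in> cube n R" and \<sigma>: "strict_mono \<sigma>" and lim: "(a \<circ> \<sigma>) \<longlonglongrightarrow> x"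
    using compact_cube[of n R] a unfolding compact_eq_seq_compact_metric seq_compact_def by meson
  have "(\<lambda>m. 2 * R * inverse (real (Suc m))) \<longlonglongrightarrow> 0"
    by (rule tendsto_mult_right_zero[OF LIMSEQ_inverse_real_of_nat])
  from LIMSEQ_subseq_LIMSEQ[OF this \<sigma>]
  have 0: "(\<lambda>m. 2 * R / real (Suc (\<sigma> m))) \<longlonglongrightarrow> 0"
    by (simp add: o_def divide_inverse)
  have conv: "(\<lambda>m. g (\<sigma> m)) \<longlonglongrightarrow> x"
    if "\<And>m j. \<bar>g m j - a m j\<bar> \<le> 2 * R / real (Suc m)" for g :: "nat \<Rightarrow> nat \<Rightarrow> real"
  proof (rule tendsto_fun_componentwise)
    fix j
    have "continuous_on UNIV (\<lambda>x :: nat \<Rightarrow> real. x j)" by simp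
    from continuous_on_tendsto_compose[OF this lim]
    have aj: "(\<lambda>m. a (\<sigma> m) j) \<longlonglongrightarrow> x j" by (simp add: o_def)
    have "(\<lambda>m. g (\<sigma> m) j - a (\<sigma> m) j) \<longlonglongrightarrow> 0"
      by (rule Lim_null_comparison[OF _ 0]) (use that in simp)
    from tendsto_add[OF this aj] show "(\<lambda>m. g (\<sigma> m) j) \<longlonglongrightarrow> x j" by simp
  qed
  have "h x i = 0" if i: "i < n" for i
  proof (rule antisym)
    have "(\<lambda>m. h (r (\<sigma> m) i) i) \<longlonglongrightarrow> h x i"
      using continuous_on_tendsto_compose[OF cont[OF i] conv[of "\<lambda>m. r m i"] x] rs i by simp
    then show "h x i \<le> 0" by (rule LIMSEQ_le_const2) (use rs i in blast)
    have "(\<lambda>m. h (s (\<sigma> m) i) i) \<longlonglongrightarrow> h x i"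
      using continuous_on_tendsto_compose[OF cont[OF i] conv[of "\<lambda>m. s m i"] x] rs i by simp
    then show "h x i \<ge> 0" by (rule LIMSEQ_le_const) (use rs i in blast)
  qed
  with x show ?thesis by (rule that)
qed

text \<open>
  A solution of \<open>x = clip (x - h x)\<close>, with each coordinate clipped to \<open>[-R,R]\<close>, exists by the theorem of
  Poincare and Miranda. Wherever \<open>h x i\<close> is nonzero there, the clipping was effective: \<open>x i\<close> is \<open>R\<close> or \<open>-R\<close>
  and \<open>h x i\<close> has the opposite sign. So if \<open>h\<close> did not vanish at \<open>x\<close>, it would point inward.
\<close>

lemma outward_field_has_zero:
  fixes h :: "(nat \<Rightarrow> real) \<Rightarrow> nat \<Rightarrow> real"
  assumes R: "R > 0"
    and cont: "\<And>i. i < n \<Longrightarrow> continuous_on (cube n R) (\<lambda>x. h x i)"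
    and out: "\<And>x i. x \<in> cube n R \<Longrightarrow> i < n \<Longrightarrow> \<bar>x i\<bar> = R \<Longrightarrow> (\<Sum>i<n. x i * h x i) > 0"
  obtains x where "x \<in> cube n R" "\<And>i. i < n \<Longrightarrow> h x i = 0"
proof -
  define k where "k x i = x i - max (-R) (min R (x i - h x i))" for x i
  obtain x where x: "x \<in> cube n R" and k: "\<And>i. i < n \<Longrightarrow> k x i = 0"
  proof (rule poincare_miranda[OF R, of n k])
    fix i assume i: "i < n"
    show "continuous_on (cube n R) (\<lambda>x. k x i)"
      unfolding k_def by (intro continuous_intros continuous_on_product_coordinates cont[OF i]
          continuous_on_subset[OF continuous_on_product_coordinates]) auto
  qed (use R in \<open>auto simp: k_def\<close>)
  have neg: "x i * h x i < 0 \<and> \<bar>x i\<bar> = R" if "i < n" "h x i \<noteq> 0" for i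
  proof -
    have "x i = max (-R) (min R (x i - h x i))" using k[OF that(1)] by (simp add: k_def)
    then have "x i = R \<and> h x i < 0 \<or> x i = -R \<and> h x i > 0"
      using that(2) R by (auto simp: max_def min_def split: if_splits)
    then show ?thesis using R by (auto simp: mult_less_0_iff)
  qed
  have "h x i = 0" if i: "i < n" for i
  proof (rule ccontr)
    assume "h x i \<noteq> 0"
    then have "(\<Sum>i<n. x i * h x i) > 0" using out[OF x i] neg[OF i] by blast
    moreover have "(\<Sum>i<n. x i * h x i) \<le> 0"
      by (rule sum_nonpos) (use neg in force)
    ultimately show False by simp
  qed
  with x show ?thesis by (rule that)
qed

section \<open>Rotation invariance of the surface measure\<close>

text \<open>
  A well-ordered copy of a finite index type, ordered by an injection into the natural numbers. It gives
  access to \<open>measure_orthogonal_image\<close>, which is about well-ordered index types, for all finite ones.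
\<close>

typedef 'a indexed = "UNIV :: 'a set" ..

instantiation indexed :: (finite) wellorder
begin

definition less_eq_indexed :: "'a indexed \<Rightarrow> 'a indexed \<Rightarrow> bool"
  where "x \<le> y \<longleftrightarrow> to_nat (Rep_indexed x) \<le> to_nat (Rep_indexed y)"

definition less_indexed :: "'a indexed \<Rightarrow> 'a indexed \<Rightarrow> bool"
  where "x < y \<longleftrightarrow> to_nat (Rep_indexed x) < to_nat (Rep_indexed y)"

instance
proof
  fix x y :: "'a indexed"
  show "x \<le> y \<Longrightarrow> y \<le> x \<Longrightarrow> x = y"
    by (simp add: less_eq_indexed_def Rep_indexed_inject)
next
  fix P :: "'a indexed \<Rightarrow> bool" and a :: "'a indexed"
  assume step: "\<And>x. (\<And>y. y < x \<Longrightarrow> P y) \<Longrightarrow> P x"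
  have "\<forall>x. to_nat (Rep_indexed x) = m \<longrightarrow> P x" for m
  proof (induction m rule: less_induct)
    case (less m)
    then show ?case using step unfolding less_indexed_def by blast
  qed
  then show "P a" by blast
qed (auto simp: less_eq_indexed_def less_indexed_def)

end

instance indexed :: (finite) finite
proof
  have eq: "(UNIV :: 'a indexed set) = Abs_indexed ` UNIV"
    by (metis Rep_indexed_inverse surjI)
  show "finite (UNIV :: 'a indexed set)"
    unfolding eq by (rule finite_imageI) (rule finite)
qed

lemma prod_Basis_cart:
  fixes g :: "real ^ 'n \<Rightarrow> 'b::comm_monoid_mult"
  shows "(\<Prod>b\<in>Basis. g b) = (\<Prod>i\<in>UNIV. g (axis i 1))"
proof -
  have eq: "(Basis :: (real ^ 'n) set) = range (\<lambda>i. axis i 1)"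
    by (auto simp: Basis_vec_def)
  have "inj (\<lambda>i. axis i 1 :: real ^ 'n)"
    by (auto simp: inj_def axis_eq_axis)
  then show ?thesis unfolding eq by (simp add: prod.reindex)
qed

lemma lborel_reindex:
  fixes \<sigma> :: "'m::finite \<Rightarrow> 'n::finite"
  assumes "bij \<sigma>"
  shows "distr lborel borel (\<lambda>x :: real ^ 'n. (\<chi> i. x $ \<sigma> i) :: real ^ 'm) = lborel"
proof (rule lborel_eqI[symmetric])
  fix l u :: "real ^ 'm"
  assume le: "\<And>b. b \<in> Basis \<Longrightarrow> l \<bullet> b \<le> u \<bullet> b"
  have le': "l $ i \<le> u $ i" for i
    using le[of "axis i 1"] by (auto simp: inner_axis Basis_vec_def)
  define k where "k = (\<lambda>y :: real ^ 'm. (\<chi> j. y $ inv \<sigma> j) :: real ^ 'n)"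
  have s: "\<sigma> (inv \<sigma> j) = j" "inv \<sigma> (\<sigma> i) = i" for i j
    using assms by (simp_all add: bij_is_inj bij_is_surj surj_f_inv_f)
  have vi: "(\<lambda>x :: real ^ 'n. (\<chi> i. x $ \<sigma> i) :: real ^ 'm) -` box l u = box (k l) (k u)"
    by (auto simp: mem_box_cart k_def) (metis s)+
  have m: "(\<lambda>x :: real ^ 'n. (\<chi> i. x $ \<sigma> i) :: real ^ 'm) \<in> borel_measurable borel"
    by (intro borel_measurable_continuous_onI continuous_intros)
  have "emeasure (distr lborel borel (\<lambda>x :: real ^ 'n. (\<chi> i. x $ \<sigma> i) :: real ^ 'm)) (box l u) =
      emeasure lborel (box (k l) (k u))"
    using m by (subst emeasure_distr) (auto simp: vi)
  also have "\<dots> = (\<Prod>b\<in>Basis. (k u - k l) \<bullet> b)"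
    by (subst emeasure_lborel_box) (auto simp: Basis_vec_def inner_axis k_def le')
  also have "(\<Prod>b\<in>Basis. (k u - k l) \<bullet> b) = (\<Prod>j\<in>UNIV. u $ inv \<sigma> j - l $ inv \<sigma> j)"
    by (simp add: prod_Basis_cart inner_axis k_def)
  also have "\<dots> = (\<Prod>i\<in>UNIV. u $ i - l $ i)"
    by (rule prod.reindex_bij_betw[OF bij_imp_bij_inv[OF assms]])
  also have "\<dots> = (\<Prod>b\<in>Basis. (u - l) \<bullet> b)"
    by (simp add: prod_Basis_cart inner_axis)
  finally show "emeasure (distr lborel borel (\<lambda>x :: real ^ 'n. (\<chi> i. x $ \<sigma> i) :: real ^ 'm)) (box l u) =
      (\<Prod>b\<in>Basis. (u - l) \<bullet> b)" .
qed simp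

lemma orthogonal_transformation_borel:
  fixes f :: "real ^ 'n \<Rightarrow> real ^ 'n"
  assumes "orthogonal_transformation f"
  shows "f \<in> borel_measurable borel"
  using orthogonal_transformation_linear[OF assms]
  by (intro borel_measurable_continuous_onI linear_continuous_on)
    (simp add: linear_conv_bounded_linear)

lemma lborel_orthogonal_wellorder:
  fixes f :: "real ^ 'n::{finite,wellorder} \<Rightarrow> real ^ 'n::{finite,wellorder}"
  assumes f: "orthogonal_transformation f"
  shows "distr lborel borel f = lborel"
proof (rule lborel_eqI[symmetric])
  fix l u :: "real ^ 'n::{finite,wellorder}"
  assume le: "\<And>b. b \<in> Basis \<Longrightarrow> l \<bullet> b \<le> u \<bullet> b"
  have inv: "orthogonal_transformation (inv f)" using f by (rule orthogonal_transformation_inv)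
  have "bij f" using f by (rule orthogonal_transformation_bij)
  then have vi: "f -` box l u = inv f ` box l u" by (rule bij_vimage_eq_inv_image)
  have m: "f \<in> borel_measurable borel" using f by (rule orthogonal_transformation_borel)
  have v: "f -` box l u \<in> sets borel" using measurable_sets[OF m, of "box l u"] by simp
  have lm: "inv f ` box l u \<in> lmeasurable" by (rule measurable_orthogonal_image[OF inv]) simp
  have "emeasure (distr lborel borel f) (box l u) = emeasure lborel (f -` box l u)"
    using m by (subst emeasure_distr) auto
  also have "\<dots> = emeasure lebesgue (inv f ` box l u)"
    using v by (simp add: vi)
  also have "\<dots> = emeasure lebesgue (box l u)"
    using measure_orthogonal_image[OF inv lmeasurable_box[of l u]] lm
    by (simp add: emeasure_eq_measure2 fmeasurableD2)
  also have "\<dots> = (\<Prod>b\<in>Basis. (u - l) \<bullet> b)"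
    using le by simp
  finally show "emeasure (distr lborel borel f) (box l u) = (\<Prod>b\<in>Basis. (u - l) \<bullet> b)" .
qed simp

text \<open>
  Reindexing coordinates by a bijection preserves Lebesgue measure and norms. So \<open>f\<close> may be conjugated
  with it to an orthogonal map for the well-ordered copy of the index type.
\<close>

lemma lborel_orthogonal:
  fixes f :: "real ^ 'n \<Rightarrow> real ^ 'n"
  assumes f: "orthogonal_transformation f"
  shows "distr lborel borel f = lborel"
proof -
  define h where "h = (\<lambda>x :: real ^ 'n. (\<chi> i. x $ Rep_indexed i) :: real ^ 'n indexed)"
  define k where "k = (\<lambda>y :: real ^ 'n indexed. (\<chi> j. y $ Abs_indexed j) :: real ^ 'n)"
  have bR: "bij (Rep_indexed :: 'n indexed \<Rightarrow> 'n)" and bA: "bij (Abs_indexed :: 'n \<Rightarrow> 'n indexed)"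
    by (auto intro!: bij_betw_byWitness[where f' = Abs_indexed] bij_betw_byWitness[where f' = Rep_indexed]
        simp: Abs_indexed_inverse Rep_indexed_inverse)
  have dh: "distr lborel borel h = lborel" and dk: "distr lborel borel k = lborel"
    unfolding h_def k_def by (rule lborel_reindex[OF bR] lborel_reindex[OF bA])+
  have kh: "k (h x) = x" for x
    by (simp add: h_def k_def Abs_indexed_inverse vec_eq_iff)
  define g where "g = h \<circ> f \<circ> k"
  have lin: "linear h" "linear k"
    by (auto simp: h_def k_def linear_iff vec_eq_iff)
  have nh: "norm (h x) = norm x" for x
    unfolding norm_vec_def L2_set_def h_def
    using sum.reindex_bij_betw[OF bR, of "\<lambda>i. (norm (x $ i))\<^sup>2"] by simp
  have nk: "norm (k x) = norm x" for x
    unfolding norm_vec_def L2_set_def k_def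
    using sum.reindex_bij_betw[OF bA, of "\<lambda>i. (norm (x $ i))\<^sup>2"] by simp
  have g: "orthogonal_transformation g"
    using f lin unfolding g_def orthogonal_transformation
    by (auto intro!: linear_compose simp: nh nk)
  have mh: "h \<in> borel_measurable borel" and mk: "k \<in> borel_measurable borel"
    using lin by (auto intro!: borel_measurable_continuous_onI linear_continuous_on
        simp: linear_conv_bounded_linear)
  have mg: "g \<in> borel_measurable borel" using g by (rule orthogonal_transformation_borel)
  have "f = k \<circ> (g \<circ> h)" by (simp add: g_def fun_eq_iff kh)
  then have "distr lborel borel f = distr lborel borel (k \<circ> (g \<circ> h))" by simp
  also have "\<dots> = distr (distr (distr lborel borel h) borel g) borel k"
    using mh mk mg by (simp add: distr_distr o_assoc)
  also have "\<dots> = lborel"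
    by (simp add: dh dk lborel_orthogonal_wellorder[OF g])
  finally show ?thesis .
qed

lemma sets_sphere_measure: "sets sphere_measure = sets (restrict_space borel (sphere 0 1))"
  unfolding sphere_measure_def by (rule sets_restrict_space_cong) simp

lemma sets_sphere_measure_iff:
  "A \<in> sets (sphere_measure :: (real ^ 'n) measure) \<longleftrightarrow> A \<in> sets borel \<and> A \<subseteq> sphere 0 1"
proof -
  have "sphere 0 1 \<inter> space borel \<in> sets (borel :: (real ^ 'n) measure)"
    by (simp only: space_borel Int_UNIV_right) (rule borel_closed[OF closed_sphere])
  then have "A \<in> sets (restrict_space borel (sphere 0 1)) \<longleftrightarrow> A \<subseteq> sphere 0 1 \<and> A \<in> sets borel"
    by (rule sets_restrict_space_iff)
  then show ?thesis
    by (simp only: sets_sphere_measure conj_commute)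
qed

lemma sphere_measure_orthogonal:
  fixes f :: "real ^ 'n \<Rightarrow> real ^ 'n"
  assumes f: "orthogonal_transformation f"
  shows "distr sphere_measure sphere_measure f = sphere_measure"
proof (rule measure_eqI)
  fix A assume "A \<in> sets (distr sphere_measure sphere_measure f)"
  then have A: "A \<in> sets borel" "A \<subseteq> sphere 0 1"
    by (simp_all add: sets_sphere_measure_iff)
  have m: "f \<in> borel_measurable borel" using f by (rule orthogonal_transformation_borel)
  have nf: "norm (f x) = norm x" for x
    using f by (rule orthogonal_transformation_norm)
  have sf: "sgn (f x) = f (sgn x)" for x
    using orthogonal_transformation_linear[OF f] by (simp add: sgn_div_norm linear_cmul nf)
  have "f -` A \<subseteq> sphere 0 1"
  proof
    fix x assume "x \<in> f -` A"
    then have "norm (f x) = 1" using A(2) by auto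
    then show "x \<in> sphere 0 1" by (simp add: nf)
  qed
  moreover have "f -` A \<in> sets borel"
    using measurable_sets[OF m A(1)] by simp
  ultimately have vA: "f -` A \<in> sets borel" "f -` A \<subseteq> sphere 0 1" by blast+
  have mf: "f \<in> measurable sphere_measure sphere_measure"
    unfolding sphere_measure_def using m
    by (intro measurable_restrict_space3) (auto simp: nf measurable_def)
  have B: "{x \<in> ball 0 1. sgn x \<in> A} \<in> sets borel"
  proof -
    have "{x \<in> ball 0 1. sgn x \<in> A} = ball 0 1 \<inter> (sgn -` A \<inter> space borel)" by auto
    then show ?thesis using measurable_sets[OF borel_measurable_sgn_vec A(1)] by auto
  qed
  have "emeasure (distr sphere_measure sphere_measure f) A = emeasure sphere_measure (f -` A)"
    using mf A vA by (subst emeasure_distr) (auto simp: sets_sphere_measure_iff Int_absorb2)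
  also have "\<dots> = emeasure lborel {x \<in> ball 0 1. sgn x \<in> f -` A} / emeasure lborel (ball 0 1 :: (real ^ 'n) set)"
    by (rule emeasure_sphere_measure[OF vA])
  also have "{x \<in> ball 0 1. sgn x \<in> f -` A} = f -` {x \<in> ball 0 1. sgn x \<in> A}"
    by (auto simp: nf sf)
  also have "emeasure lborel (f -` {x \<in> ball 0 1. sgn x \<in> A}) =
      emeasure (distr lborel borel f) {x \<in> ball 0 1. sgn x \<in> A}"
    using m B by (subst emeasure_distr) auto
  also have "\<dots> = emeasure lborel {x \<in> ball 0 1. sgn x \<in> A}"
    by (simp add: lborel_orthogonal[OF f])
  finally show "emeasure (distr sphere_measure sphere_measure f) A = emeasure sphere_measure A"
    by (simp add: emeasure_sphere_measure[OF A])
qed simp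

lemma sphere_measurable:
  fixes f :: "real ^ 'n \<Rightarrow> 'b::real_normed_vector"
  assumes "continuous_on (sphere 0 1) f"
  shows "f \<in> borel_measurable sphere_measure"
  using borel_measurable_continuous_on_restrict[OF assms]
  by (simp add: measurable_cong_sets[OF sets_sphere_measure refl])

interpretation sphere_measure: finite_measure "sphere_measure :: (real ^ 'n) measure"
  by (rule finite_measureI) (simp add: emeasure_sphere_measure_space)

lemma sphere_integral_const: "(LINT x|(sphere_measure :: (real ^ 'n) measure). c) = (c :: real)"
  by (simp add: measure_def emeasure_sphere_measure_space)

lemma sphere_integrable:
  fixes f :: "real ^ 'n \<Rightarrow> 'b::euclidean_space"
  assumes "continuous_on (sphere 0 1) f"
  shows "integrable sphere_measure f"
proof -
  have "bounded (f ` sphere 0 1)"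
    by (intro compact_imp_bounded compact_continuous_image assms) simp
  then obtain B where "\<And>x. x \<in> sphere 0 1 \<Longrightarrow> norm (f x) \<le> B"
    unfolding bounded_iff by blast
  then show ?thesis
    by (intro sphere_measure.integrable_const_bound[of _ B] sphere_measurable assms AE_I2) simp
qed

lemma sphere_integral_orthogonal:
  fixes f :: "real ^ 'n \<Rightarrow> real ^ 'n" and g :: "real ^ 'n \<Rightarrow> real"
  assumes f: "orthogonal_transformation f" and g: "continuous_on (sphere 0 1) g"
  shows "(LINT x|sphere_measure. g (f x)) = (LINT x|sphere_measure. g x)"
proof -
  have mf: "f \<in> measurable sphere_measure sphere_measure"
    unfolding sphere_measure_def using orthogonal_transformation_borel[OF f]
    by (intro measurable_restrict_space3)
      (auto simp: orthogonal_transformation_norm[OF f] measurable_def)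
  show ?thesis
    using integral_distr[OF mf sphere_measurable[OF g]] by (simp add: sphere_measure_orthogonal[OF f])
qed

text \<open>
  The measure has full support: the cone over a nonempty relatively open subset of the sphere contains
  a nonempty open set.
\<close>

lemma sphere_integral_nonneg_eq_0:
  fixes f :: "real ^ 'n \<Rightarrow> real"
  assumes f: "continuous_on (sphere 0 1) f" "\<And>x. x \<in> sphere 0 1 \<Longrightarrow> f x \<ge> 0"
    and 0: "(LINT x|sphere_measure. f x) = 0" and x: "x \<in> sphere 0 1"
  shows "f x = 0"
proof (rule ccontr)
  assume "f x \<noteq> 0"
  have "AE y in sphere_measure. f y = 0"
    using integral_nonneg_eq_0_iff_AE[OF sphere_integrable[OF f(1)] AE_I2] f(2) 0 by simp
  moreover have meas: "{y \<in> sphere 0 1. f y \<noteq> 0} \<in> sets sphere_measure"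
  proof -
    have "{y \<in> sphere 0 1. f y \<noteq> 0} = f -` (- {0}) \<inter> space sphere_measure" by auto
    then show ?thesis using measurable_sets[OF sphere_measurable[OF f(1)], of "- {0}"] by simp
  qed
  ultimately have e0: "emeasure sphere_measure {y \<in> sphere 0 1. f y \<noteq> 0} = 0"
    using AE_iff_measurable[OF meas, of "\<lambda>y. f y = 0"] by simp
  define S where "S = {z \<in> ball 0 1. sgn z \<in> {y \<in> sphere 0 1. f y \<noteq> 0}}"
  have bm: "{y \<in> sphere 0 1. f y \<noteq> 0} \<in> sets borel"
    using meas by (simp add: sets_sphere_measure_iff)
  have "emeasure lborel S = 0"
    using e0 emeasure_unit_ball_pos_finite[where 'n = 'n] unfolding S_def
    by (subst (asm) emeasure_sphere_measure[OF bm]) (auto simp: ennreal_divide_eq_0_iff)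
  moreover have "S = (ball 0 1 - {0}) \<inter> (\<lambda>z. f (sgn z)) -` (- {0})"
    by (auto simp: S_def norm_sgn)
  moreover have "open ((ball 0 1 - {0}) \<inter> (\<lambda>z :: real ^ 'n. f (sgn z)) -` (- {0}))"
  proof (rule continuous_open_preimage)
    show "continuous_on (ball 0 1 - {0}) (\<lambda>z :: real ^ 'n. f (sgn z))"
      by (rule continuous_on_compose2[OF f(1)]) (auto intro!: continuous_on_sgn continuous_intros simp: norm_sgn split: if_splits)
  qed auto
  ultimately have "open S" "emeasure lborel S = 0" by auto
  moreover have "S \<noteq> {}"
  proof -
    have "x /\<^sub>R 2 \<in> S" using x \<open>f x \<noteq> 0\<close> by (auto simp: S_def sgn_div_norm)
    then show ?thesis by blast
  qed
  ultimately show False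
    using open_not_negligible[of S]
    by (auto simp: negligible_iff_null_sets null_sets_def null_sets_completionI)
qed

section \<open>Polynomials and their partial derivatives\<close>

lemma polys_add: "f \<in> polys_upto s \<Longrightarrow> g \<in> polys_upto s \<Longrightarrow> (\<lambda>x. f x + g x) \<in> polys_upto s"
  using span_add[of f _ g] by (simp add: polys_upto_def plus_fun_def)

lemma polys_cmul: "f \<in> polys_upto s \<Longrightarrow> (\<lambda>x. c * f x) \<in> polys_upto s"
  using span_scale[of f _ c] by (simp add: polys_upto_def scaleR_fun_def)

lemma polys_mono: "s \<le> t \<Longrightarrow> polys_upto s \<subseteq> polys_upto t"
  unfolding polys_upto_def by (rule span_mono) auto

lemma polys_monomial: "(\<Sum>i\<in>UNIV. \<alpha> i) \<le> s \<Longrightarrow> (\<lambda>x. \<Prod>i\<in>UNIV. (x $ i) ^ \<alpha> i) \<in> polys_upto s"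
  unfolding polys_upto_def by (rule span_base) blast

lemma polys_const: "(\<lambda>x. c) \<in> polys_upto s"
  using polys_cmul[OF polys_monomial[of "\<lambda>_. 0" s], of c] by simp

lemma polys_sum: "(\<And>i. i \<in> I \<Longrightarrow> f i \<in> polys_upto s) \<Longrightarrow> (\<lambda>x. \<Sum>i\<in>I. f i x) \<in> polys_upto s"
  by (induction I rule: infinite_finite_induct) (auto intro: polys_add polys_const)

lemma polys_diff: "f \<in> polys_upto s \<Longrightarrow> g \<in> polys_upto s \<Longrightarrow> (\<lambda>x. f x - g x) \<in> polys_upto s"
  using polys_add[OF _ polys_cmul[of g s "-1"]] by simp

text \<open>
  A monomial of positive degree is a coordinate times a monomial whose degree is smaller by one.
\<close>

lemma polys_induct [consumes 1, case_names const add scale coord]: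
  fixes f :: "real ^ 'n \<Rightarrow> real"
  assumes f: "f \<in> polys_upto s"
    and const: "\<And>c s. H s (\<lambda>x. c)"
    and add: "\<And>f g s. f \<in> polys_upto s \<Longrightarrow> g \<in> polys_upto s \<Longrightarrow> H s f \<Longrightarrow> H s g \<Longrightarrow> H s (\<lambda>x. f x + g x)"
    and scale: "\<And>f c s. f \<in> polys_upto s \<Longrightarrow> H s f \<Longrightarrow> H s (\<lambda>x. c * f x)"
    and coord: "\<And>f i s. f \<in> polys_upto s \<Longrightarrow> H s f \<Longrightarrow> H (Suc s) (\<lambda>x. x $ i * f x)"
  shows "H s f"
proof -
  have mon: "H s (\<lambda>x. \<Prod>i\<in>UNIV. (x $ i) ^ \<alpha> i)" if "(\<Sum>i\<in>UNIV. \<alpha> i) \<le> s" for \<alpha> :: "'n \<Rightarrow> nat" and s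
    using that
  proof (induction s arbitrary: \<alpha>)
    case 0
    then show ?case using const[of 0 1] by simp
  next
    case (Suc s)
    show ?case
    proof (cases "\<forall>i. \<alpha> i = 0")
      case True
      then show ?thesis using const[of "Suc s" 1] by simp
    next
      case False
      then obtain i where i: "\<alpha> i > 0" by auto
      define \<beta> where "\<beta> = \<alpha>(i := \<alpha> i - 1)"
      have "(\<Sum>j\<in>UNIV. \<alpha> j) = \<alpha> i + (\<Sum>j\<in>UNIV - {i}. \<alpha> j)" by (simp add: sum.remove)
      moreover have "(\<Sum>j\<in>UNIV. \<beta> j) = (\<alpha> i - 1) + (\<Sum>j\<in>UNIV - {i}. \<alpha> j)"
        by (simp add: sum.remove[of UNIV i] \<beta>_def)
      ultimately have "(\<Sum>j\<in>UNIV. \<beta> j) \<le> s" using i Suc.prems by simp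
      then have "H s (\<lambda>x. \<Prod>i\<in>UNIV. (x $ i) ^ \<beta> i)" "(\<lambda>x. \<Prod>i\<in>UNIV. (x $ i) ^ \<beta> i) \<in> polys_upto s"
        by (rule Suc.IH polys_monomial)+
      then have "H (Suc s) (\<lambda>x. x $ i * (\<Prod>i\<in>UNIV. (x $ i) ^ \<beta> i))" by (intro coord)
      moreover have "x $ i * (\<Prod>i\<in>UNIV. (x $ i) ^ \<beta> i) = (\<Prod>i\<in>UNIV. (x $ i) ^ \<alpha> i)" for x :: "real ^ 'n"
        using i by (simp add: prod.remove[of UNIV i] \<beta>_def mult.assoc[symmetric] power_eq_if[of _ "\<alpha> i"])
      ultimately show ?thesis by simp
    qed
  qed
  have "f \<in> polys_upto s \<and> H s f"
    using f unfolding polys_upto_def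
  proof (induction rule: span_induct)
    case base
    show ?case
      unfolding polys_upto_def[symmetric] subspace_def mem_Collect_eq
      using polys_const[of 0 s] const[of s 0] add[of _ s] scale[of _ s] polys_add[of _ s] polys_cmul[of _ s]
      by (auto simp: zero_fun_def plus_fun_def scaleR_fun_def)
  next
    case (step g)
    then show ?case using mon polys_monomial unfolding polys_upto_def[symmetric] by auto
  qed
  then show ?thesis by blast
qed

text \<open>
  The polynomials of degree less than \<open>s\<close>, where lower order terms live. That only the zero polynomial
  remains for \<open>s = 0\<close> lets degree arguments start without a case distinction.
\<close>

definition polys_below :: "nat \<Rightarrow> (real ^ 'n \<Rightarrow> real) set"
  where "polys_below s = (if s = 0 then {\<lambda>x. 0} else polys_upto (s - 1))"

lemma polys_below_Suc [simp]: "polys_below (Suc s) = polys_upto s"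
  by (simp add: polys_below_def)

lemma polys_below_zero: "(\<lambda>x. 0) \<in> polys_below s"
  by (simp add: polys_below_def polys_const)

lemma polys_below_subset: "polys_below s \<subseteq> polys_upto s"
  using polys_mono[of "s - 1" s] by (auto simp: polys_below_def polys_const)

lemma polys_below_add: "f \<in> polys_below s \<Longrightarrow> g \<in> polys_below s \<Longrightarrow> (\<lambda>x. f x + g x) \<in> polys_below s"
  by (auto simp: polys_below_def polys_add split: if_splits)

lemma polys_below_cmul: "f \<in> polys_below s \<Longrightarrow> (\<lambda>x. c * f x) \<in> polys_below s"
  by (auto simp: polys_below_def polys_cmul split: if_splits)

lemma polys_coord_mult: "f \<in> polys_upto s \<Longrightarrow> (\<lambda>x. x $ i * f x) \<in> polys_upto (Suc s)"
proof (unfold polys_upto_def, induction rule: span_induct)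
  case base
  show ?case
    unfolding polys_upto_def[symmetric] subspace_def mem_Collect_eq
    using polys_const[of 0 "Suc s"] polys_add[of _ "Suc s"] polys_cmul[of _ "Suc s"]
    by (auto simp: zero_fun_def plus_fun_def scaleR_fun_def algebra_simps)
next
  case (step g)
  then obtain \<alpha> where g: "g = (\<lambda>x. \<Prod>i\<in>UNIV. (x $ i) ^ \<alpha> i)" and \<alpha>: "(\<Sum>i\<in>UNIV. \<alpha> i) \<le> s" by auto
  define \<beta> where "\<beta> = \<alpha>(i := Suc (\<alpha> i))"
  have "(\<Sum>j\<in>UNIV. \<beta> j) = Suc (\<Sum>j\<in>UNIV. \<alpha> j)"
    by (simp add: sum.remove[of UNIV i] \<beta>_def)
  then have "(\<lambda>x. \<Prod>i\<in>UNIV. (x $ i) ^ \<beta> i) \<in> polys_upto (Suc s)"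
    using \<alpha> by (intro polys_monomial) simp
  moreover have "x $ i * g x = (\<Prod>i\<in>UNIV. (x $ i) ^ \<beta> i)" for x
    by (simp add: g prod.remove[of UNIV i] \<beta>_def)
  ultimately show ?case unfolding polys_upto_def by simp
qed

lemma polys_below_coord_mult: "f \<in> polys_below s \<Longrightarrow> (\<lambda>x. x $ i * f x) \<in> polys_upto s"
  by (cases s) (auto simp: polys_below_def polys_coord_mult polys_const)

lemma polys_mult: "f \<in> polys_upto s \<Longrightarrow> g \<in> polys_upto t \<Longrightarrow> (\<lambda>x. f x * g x) \<in> polys_upto (s + t)"
proof (induction rule: polys_induct)
  case (const c s)
  then show ?case using polys_cmul[of g t c] polys_mono[of t "s + t"] by auto
next
  case (add f g s)
  then show ?case by (simp add: polys_add algebra_simps)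
next
  case (scale f c s)
  then show ?case using polys_cmul by (simp add: mult.assoc)
next
  case (coord f i s)
  then show ?case using polys_coord_mult by (simp add: mult.assoc)
qed

definition partial_deriv :: "'n \<Rightarrow> (real ^ 'n \<Rightarrow> real) \<Rightarrow> real ^ 'n \<Rightarrow> real"
  where "partial_deriv i f x = frechet_derivative f (at x) (axis i 1)"

lemma partial_deriv_eqI:
  assumes "(f has_derivative (\<lambda>h. \<Sum>i\<in>UNIV. a i * h $ i)) (at x)"
  shows "partial_deriv i f x = a i"
proof -
  have "frechet_derivative f (at x) = (\<lambda>h. \<Sum>i\<in>UNIV. a i * h $ i)"
    using frechet_derivative_at[OF assms] by simp
  then have "partial_deriv i f x = (\<Sum>j\<in>UNIV. a j * axis i 1 $ j)"
    by (simp add: partial_deriv_def)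
  also have "\<dots> = (\<Sum>j\<in>UNIV. if j = i then a i else 0)"
    by (rule sum.cong) (auto simp: axis_def)
  finally show ?thesis by simp
qed

lemma polys_has_derivative_ex:
  "f \<in> polys_upto s \<Longrightarrow> \<exists>f'. (\<forall>i. f' i \<in> polys_below s) \<and>
    (\<forall>x. (f has_derivative (\<lambda>h. \<Sum>i\<in>UNIV. f' i x * h $ i)) (at x))"
proof (induction rule: polys_induct)
  case (const c s)
  show ?case by (rule exI[of _ "\<lambda>_ _. 0"]) (simp add: polys_below_zero)
next
  case (add f g s)
  then obtain f' g' where "\<forall>i. f' i \<in> polys_below s" "\<forall>i. g' i \<in> polys_below s"
    "\<And>x. (f has_derivative (\<lambda>h. \<Sum>i\<in>UNIV. f' i x * h $ i)) (at x)"
    "\<And>x. (g has_derivative (\<lambda>h. \<Sum>i\<in>UNIV. g' i x * h $ i)) (at x)" by blast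
  then show ?case
    by (intro exI[of _ "\<lambda>i x. f' i x + g' i x"])
      (auto intro!: polys_below_add has_derivative_eq_rhs[OF has_derivative_add]
        simp: fun_eq_iff sum.distrib algebra_simps)
next
  case (scale f c s)
  then obtain f' where "\<forall>i. f' i \<in> polys_below s"
    "\<And>x. (f has_derivative (\<lambda>h. \<Sum>i\<in>UNIV. f' i x * h $ i)) (at x)" by blast
  then show ?case
    by (intro exI[of _ "\<lambda>i x. c * f' i x"])
      (auto intro!: polys_below_cmul has_derivative_eq_rhs[OF has_derivative_mult_right]
        simp: fun_eq_iff sum_distrib_left mult.assoc)
next
  case (coord f k s)
  then obtain f' where f': "\<forall>i. f' i \<in> polys_below s"
    and der: "\<And>x. (f has_derivative (\<lambda>h. \<Sum>i\<in>UNIV. f' i x * h $ i)) (at x)" by blast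
  have "((\<lambda>x. x $ k * f x) has_derivative (\<lambda>h. \<Sum>i\<in>UNIV. (x $ k * f' i x + (if i = k then 1 else 0) * f x) * h $ i)) (at x)" for x
  proof (rule has_derivative_eq_rhs[OF has_derivative_mult[OF _ der]])
    show "((\<lambda>x. x $ k) has_derivative (\<lambda>h. h $ k)) (at x)"
      by (rule bounded_linear_imp_has_derivative[OF bounded_linear_vec_nth])
    have "(\<Sum>i\<in>UNIV. (x $ k * f' i x + (if i = k then 1 else 0) * f x) * h $ i)
        = x $ k * (\<Sum>i\<in>UNIV. f' i x * h $ i) + (\<Sum>i\<in>UNIV. if i = k then h $ k * f x else 0)" for h
      unfolding sum_distrib_left sum.distrib[symmetric]
      by (rule sum.cong) (auto simp: algebra_simps)
    then show "(\<lambda>h. x $ k * (\<Sum>i\<in>UNIV. f' i x * h $ i) + h $ k * f x) =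
        (\<lambda>h. \<Sum>i\<in>UNIV. (x $ k * f' i x + (if i = k then 1 else 0) * f x) * h $ i)"
      by simp
  qed
  moreover have "(\<lambda>x. x $ k * f' i x + (if i = k then 1 else 0) * f x) \<in> polys_upto s" for i
    using f' coord.hyps by (intro polys_add polys_cmul polys_below_coord_mult) auto
  ultimately show ?case
    by (intro exI[of _ "\<lambda>i x. x $ k * f' i x + (if i = k then 1 else 0) * f x"]) auto
qed

lemma
  assumes "f \<in> polys_upto s"
  shows polys_has_derivative: "(f has_derivative (\<lambda>h. \<Sum>i\<in>UNIV. partial_deriv i f x * h $ i)) (at x)"
    and polys_partial_deriv: "partial_deriv i f \<in> polys_below s"
proof -
  obtain f' where f': "\<And>i. f' i \<in> polys_below s"
    and der: "\<And>x. (f has_derivative (\<lambda>h. \<Sum>i\<in>UNIV. f' i x * h $ i)) (at x)"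
    using polys_has_derivative_ex[OF assms] by blast
  have "partial_deriv i f = f' i" for i
    using partial_deriv_eqI[OF der] by (simp add: fun_eq_iff)
  then show "(f has_derivative (\<lambda>h. \<Sum>i\<in>UNIV. partial_deriv i f x * h $ i)) (at x)"
    "partial_deriv i f \<in> polys_below s" using der f' by simp_all
qed

lemma polys_continuous:
  assumes "f \<in> polys_upto s"
  shows "continuous_on S f"
  by (intro continuous_at_imp_continuous_on ballI has_derivative_continuous[OF polys_has_derivative[OF assms]])

lemma partial_deriv_mult:
  assumes "f \<in> polys_upto s" "g \<in> polys_upto t"
  shows "partial_deriv i (\<lambda>x. f x * g x) x = f x * partial_deriv i g x + g x * partial_deriv i f x"
proof (rule partial_deriv_eqI)
  show "((\<lambda>x. f x * g x) has_derivative
      (\<lambda>h. \<Sum>i\<in>UNIV. (f x * partial_deriv i g x + g x * partial_deriv i f x) * h $ i)) (at x)"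
    by (rule has_derivative_eq_rhs[OF has_derivative_mult[OF polys_has_derivative[OF assms(1)] polys_has_derivative[OF assms(2)]]])
      (simp add: fun_eq_iff sum.distrib sum_distrib_left sum_distrib_right algebra_simps)
qed

lemma partial_deriv_add:
  assumes "f \<in> polys_upto s" "g \<in> polys_upto t"
  shows "partial_deriv i (\<lambda>x. f x + g x) x = partial_deriv i f x + partial_deriv i g x"
proof (rule partial_deriv_eqI)
  show "((\<lambda>x. f x + g x) has_derivative
      (\<lambda>h. \<Sum>i\<in>UNIV. (partial_deriv i f x + partial_deriv i g x) * h $ i)) (at x)"
    by (rule has_derivative_eq_rhs[OF has_derivative_add[OF polys_has_derivative[OF assms(1)] polys_has_derivative[OF assms(2)]]])
      (simp add: fun_eq_iff sum.distrib algebra_simps)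
qed

lemma partial_deriv_const: "partial_deriv i (\<lambda>x. c) x = 0"
  by (rule partial_deriv_eqI[where a = "\<lambda>_. 0"]) simp

lemma partial_deriv_cmul:
  assumes "f \<in> polys_upto s"
  shows "partial_deriv i (\<lambda>x. c * f x) x = c * partial_deriv i f x"
  using partial_deriv_mult[OF polys_const assms, of i c x] by (simp add: partial_deriv_const)

lemma polys_coord: "(\<lambda>x. x $ k) \<in> polys_upto (Suc 0)"
  using polys_coord_mult[OF polys_const[of 1], of k 0] by simp

lemma partial_deriv_coord: "partial_deriv i (\<lambda>x. x $ k) x = (if i = k then 1 else 0)"
proof (rule partial_deriv_eqI)
  have "(\<Sum>i\<in>UNIV. (if i = k then 1 else 0) * h $ i) = h $ k" for h :: "real ^ 'a"
    using sum.delta[of UNIV k "\<lambda>i. h $ i"] by (simp add: if_distrib[of "\<lambda>c. c * _"] cong: if_cong)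
  then show "((\<lambda>x. x $ k) has_derivative (\<lambda>h. \<Sum>i\<in>UNIV. (if i = k then 1 else 0) * h $ i)) (at x)"
    using bounded_linear_imp_has_derivative[OF bounded_linear_vec_nth[of k]] by simp
qed

section \<open>The Laplace operator of the sphere\<close>

text \<open>
  The derivative along the rotations in the plane of the axes \<open>i\<close> and \<open>j\<close>. It is tangential to the sphere
  and does not raise the degree of a polynomial.
\<close>

definition rot_deriv :: "'n \<Rightarrow> 'n \<Rightarrow> (real ^ 'n \<Rightarrow> real) \<Rightarrow> real ^ 'n \<Rightarrow> real"
  where "rot_deriv i j f x = x $ i * partial_deriv j f x - x $ j * partial_deriv i f x"

text \<open>
  The radial derivative, which multiplies homogeneous polynomials by their degree.
\<close>

definition euler :: "(real ^ 'n \<Rightarrow> real) \<Rightarrow> real ^ 'n \<Rightarrow> real"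
  where "euler f x = (\<Sum>i\<in>UNIV. x $ i * partial_deriv i f x)"

text \<open>
  Minus the Laplace-Beltrami operator of the sphere, as the Casimir element of the rotation group; the
  factor 1/2 compensates for counting every plane twice.
\<close>

definition casimir :: "(real ^ 'n \<Rightarrow> real) \<Rightarrow> real ^ 'n \<Rightarrow> real"
  where "casimir f x = - (\<Sum>i\<in>UNIV. \<Sum>j\<in>UNIV. rot_deriv i j (rot_deriv i j f) x) / 2"

lemma rot_deriv_polys: "f \<in> polys_upto s \<Longrightarrow> rot_deriv i j f \<in> polys_upto s"
  unfolding rot_deriv_def[abs_def]
  by (intro polys_diff polys_below_coord_mult polys_partial_deriv)

lemma euler_polys: "f \<in> polys_upto s \<Longrightarrow> euler f \<in> polys_upto s"
  unfolding euler_def[abs_def]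
  by (intro polys_sum polys_below_coord_mult polys_partial_deriv)

lemma casimir_polys:
  assumes "f \<in> polys_upto s"
  shows "casimir f \<in> polys_upto s"
proof -
  have "(\<lambda>x. (- 1 / 2) * (\<Sum>i\<in>UNIV. \<Sum>j\<in>UNIV. rot_deriv i j (rot_deriv i j f) x)) \<in> polys_upto s"
    by (intro polys_cmul polys_sum rot_deriv_polys assms)
  then show ?thesis by (simp add: casimir_def[abs_def])
qed

lemma rot_deriv_mult:
  assumes "f \<in> polys_upto s" "g \<in> polys_upto t"
  shows "rot_deriv i j (\<lambda>x. f x * g x) x = f x * rot_deriv i j g x + g x * rot_deriv i j f x"
  by (simp add: rot_deriv_def partial_deriv_mult[OF assms] algebra_simps)

lemma rot_deriv_add:
  assumes "f \<in> polys_upto s" "g \<in> polys_upto t"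
  shows "rot_deriv i j (\<lambda>x. f x + g x) x = rot_deriv i j f x + rot_deriv i j g x"
  by (simp add: rot_deriv_def partial_deriv_add[OF assms] algebra_simps)

lemma rot_deriv_const: "rot_deriv i j (\<lambda>x. c) x = 0"
  by (simp add: rot_deriv_def partial_deriv_const)

lemma rot_deriv_cmul:
  assumes "f \<in> polys_upto s"
  shows "rot_deriv i j (\<lambda>x. c * f x) x = c * rot_deriv i j f x"
  by (simp add: rot_deriv_def partial_deriv_cmul[OF assms] algebra_simps)

lemma rot_deriv_coord:
  "rot_deriv i j (\<lambda>x. x $ k) x = (if j = k then x $ i else 0) - (if i = k then x $ j else 0)"
  by (simp add: rot_deriv_def partial_deriv_coord)

definition rotation :: "'n \<Rightarrow> 'n \<Rightarrow> real \<Rightarrow> real ^ 'n \<Rightarrow> real ^ 'n"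
  where "rotation i j \<theta> x = (\<chi> k. if k = i then cos \<theta> * x $ i - sin \<theta> * x $ j
     else if k = j then sin \<theta> * x $ i + cos \<theta> * x $ j else x $ k)"

lemma orthogonal_rotation:
  assumes "i \<noteq> j"
  shows "orthogonal_transformation (rotation i j \<theta>)"
  unfolding orthogonal_transformation
proof (intro conjI allI)
  show "linear (rotation i j \<theta>)"
    by (auto simp: linear_iff rotation_def vec_eq_iff algebra_simps)
  fix x :: "real ^ 'a"
  have split: "(\<Sum>k\<in>UNIV. (y $ k)\<^sup>2) = (y $ i)\<^sup>2 + (y $ j)\<^sup>2 + (\<Sum>k\<in>UNIV - {i} - {j}. (y $ k)\<^sup>2)" for y :: "real ^ 'a"
    using assms by (simp add: sum.remove[of UNIV i] sum.remove[of "UNIV - {i}" j])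
  have "(cos \<theta> * x $ i - sin \<theta> * x $ j)\<^sup>2 + (sin \<theta> * x $ i + cos \<theta> * x $ j)\<^sup>2
      = ((cos \<theta>)\<^sup>2 + (sin \<theta>)\<^sup>2) * ((x $ i)\<^sup>2 + (x $ j)\<^sup>2)"
    by algebra
  then have "(\<Sum>k\<in>UNIV. (rotation i j \<theta> x $ k)\<^sup>2) = (\<Sum>k\<in>UNIV. (x $ k)\<^sup>2)"
    unfolding split using assms by (simp add: rotation_def)
  then show "norm (rotation i j \<theta> x) = norm x"
    by (simp add: norm_vec_def L2_set_def)
qed

lemma has_derivative_along_rotation:
  assumes f: "f \<in> polys_upto s" and "i \<noteq> j"
  shows "((\<lambda>\<theta>. f (rotation i j \<theta> x)) has_real_derivative rot_deriv i j f (rotation i j \<theta> x)) (at \<theta>)"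
proof -
  define r' where "r' = (\<chi> k. if k = i then - sin \<theta> * x $ i - cos \<theta> * x $ j
     else if k = j then cos \<theta> * x $ i - sin \<theta> * x $ j else 0)"
  have "((\<lambda>\<theta>. rotation i j \<theta> x $ k) has_derivative (\<lambda>h. h * r' $ k)) (at \<theta>)" for k
  proof -
    have "((\<lambda>\<theta>. rotation i j \<theta> x $ k) has_real_derivative r' $ k) (at \<theta>)"
      by (auto simp: rotation_def r'_def intro!: derivative_eq_intros)
    then show ?thesis
      by (simp add: has_field_derivative_def mult.commute[of _ "r' $ k"])
  qed
  then have "((\<lambda>\<theta>. rotation i j \<theta> x) has_derivative (\<lambda>h. h *\<^sub>R r')) (at \<theta>)"
    by (subst has_derivative_componentwise_within) (auto simp: Basis_vec_def inner_axis)
  from has_derivative_compose[OF this polys_has_derivative[OF f]]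
  have "((\<lambda>\<theta>. f (rotation i j \<theta> x)) has_derivative
      (\<lambda>h. \<Sum>k\<in>UNIV. partial_deriv k f (rotation i j \<theta> x) * (h * r' $ k))) (at \<theta>)" by simp
  moreover have "(\<Sum>k\<in>UNIV. partial_deriv k f (rotation i j \<theta> x) * (h * r' $ k)) =
      rot_deriv i j f (rotation i j \<theta> x) * h" for h
  proof -
    have "(\<Sum>k\<in>UNIV. partial_deriv k f (rotation i j \<theta> x) * (h * r' $ k)) =
      (\<Sum>k\<in>{i,j}. partial_deriv k f (rotation i j \<theta> x) * (h * r' $ k))"
      by (rule sum.mono_neutral_right) (auto simp: r'_def)
    also have "\<dots> = rot_deriv i j f (rotation i j \<theta> x) * h"
      using \<open>i \<noteq> j\<close> by (simp add: r'_def rot_deriv_def rotation_def algebra_simps)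
    finally show ?thesis .
  qed
  ultimately show ?thesis by (simp add: has_field_derivative_def)
qed

text \<open>
  The integral of \<open>f \<circ> R\<^sub>\<theta>\<close> is the same for all rotations \<open>R\<^sub>\<theta>\<close>. Its derivative at \<open>\<theta> = 0\<close> is the
  integral of \<open>rot_deriv i j f\<close>; the derivative passes under the integral because, by the mean value
  theorem, the difference quotients are bounded by the maximum of \<open>rot_deriv i j f\<close> on the sphere.
\<close>

lemma sphere_integral_rot_deriv:
  assumes f: "f \<in> polys_upto s"
  shows "(LINT x|sphere_measure. rot_deriv i j f x) = 0"
proof (cases "i = j")
  case True
  then show ?thesis by (simp add: rot_deriv_def)
next
  case False
  note cf = polys_continuous[OF f] and cL = polys_continuous[OF rot_deriv_polys[OF f]]
  have nr: "norm (rotation i j \<theta> x) = norm x" for \<theta> x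
    using orthogonal_transformation_norm[OF orthogonal_rotation[OF False]] .
  have "bounded (rot_deriv i j f ` sphere 0 1)"
    by (intro compact_imp_bounded compact_continuous_image cL) simp
  then obtain B where "\<forall>y\<in>rot_deriv i j f ` sphere 0 1. norm y \<le> B"
    unfolding bounded_iff by blast
  then have B: "\<And>x. norm x = 1 \<Longrightarrow> \<bar>rot_deriv i j f x\<bar> \<le> B" by simp
  define u where "u m x = (f (rotation i j (inverse (real (Suc m))) x) - f x) * real (Suc m)" for m x
  have cr: "continuous_on S (\<lambda>x. f (rotation i j \<theta> x))" for S \<theta>
    using orthogonal_transformation_linear[OF orthogonal_rotation[OF False]]
    by (intro continuous_on_compose2[OF polys_continuous[OF f, of UNIV] linear_continuous_on])
      (auto simp: linear_conv_bounded_linear)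
  have "(\<lambda>m. LINT x|sphere_measure. u m x) \<longlonglongrightarrow> (LINT x|sphere_measure. rot_deriv i j f x)"
  proof (rule integral_dominated_convergence[where w = "\<lambda>_. B"])
    show "rot_deriv i j f \<in> borel_measurable sphere_measure" by (rule sphere_measurable[OF cL])
    show "u m \<in> borel_measurable sphere_measure" for m
      unfolding u_def by (intro sphere_measurable continuous_intros cr cf)
    show "integrable sphere_measure (\<lambda>_. B)" by simp
    show "AE x in sphere_measure. (\<lambda>m. u m x) \<longlonglongrightarrow> rot_deriv i j f x"
    proof (rule AE_I2)
      fix x
      have r0: "rotation i j 0 x = x" by (simp add: rotation_def vec_eq_iff)
      have "(\<lambda>h. (f (rotation i j h x) - f x) / h) \<midarrow>0\<rightarrow> rot_deriv i j f x"
        using has_derivative_along_rotation[OF f False, of x 0] by (simp add: DERIV_def r0)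
      then have "((\<lambda>m. (f (rotation i j (inverse (real (Suc m))) x) - f x) / inverse (real (Suc m))) \<longlonglongrightarrow> rot_deriv i j f x)"
        using LIMSEQ_inverse_real_of_nat by (auto simp: tendsto_at_iff_sequentially o_def)
      then show "(\<lambda>m. u m x) \<longlonglongrightarrow> rot_deriv i j f x"
        by (simp add: u_def divide_inverse)
    qed
    show "AE x in sphere_measure. norm (u m x) \<le> B" for m
    proof (rule AE_I2)
      fix x :: "real ^ 'a" assume "x \<in> space sphere_measure"
      then have x: "norm x = 1" by simp
      define e where "e = inverse (real (Suc m))"
      have "e > 0" by (simp add: e_def)
      obtain z where "f (rotation i j e x) - f (rotation i j 0 x) = (e - 0) * rot_deriv i j f (rotation i j z x)"
        using MVT2[OF \<open>e > 0\<close> has_derivative_along_rotation[OF f False]] by blast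
      moreover have "rotation i j 0 x = x" by (simp add: rotation_def vec_eq_iff)
      ultimately have "u m x = rot_deriv i j f (rotation i j z x)"
        by (simp add: u_def e_def[symmetric]) (simp add: e_def)
      then show "norm (u m x) \<le> B" using B[of "rotation i j z x"] x nr by simp
    qed
  qed
  moreover have "(LINT x|sphere_measure. u m x) = 0" for m
  proof -
    have "(LINT x|sphere_measure. f (rotation i j \<theta> x)) = (LINT x|sphere_measure. f x)" for \<theta>
      by (rule sphere_integral_orthogonal[OF orthogonal_rotation[OF False] cf])
    then show ?thesis
      unfolding u_def by (simp add: sphere_integrable cr cf)
  qed
  ultimately show ?thesis by (simp add: LIMSEQ_const_iff)
qed

definition sphere_inner :: "(real ^ 'n \<Rightarrow> real) \<Rightarrow> (real ^ 'n \<Rightarrow> real) \<Rightarrow> real"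
  where "sphere_inner f g = (LINT x|sphere_measure. f x * g x)"

lemma sphere_inner_commute: "sphere_inner f g = sphere_inner g f"
  by (simp add: sphere_inner_def mult.commute)

lemma sphere_inner_add_right:
  assumes "continuous_on (sphere 0 1) f" "continuous_on (sphere 0 1) g" "continuous_on (sphere 0 1) h"
  shows "sphere_inner f (\<lambda>x. g x + h x) = sphere_inner f g + sphere_inner f h"
  unfolding sphere_inner_def distrib_left
  by (intro Bochner_Integration.integral_add sphere_integrable continuous_intros assms)

lemma sphere_inner_cmul_right: "sphere_inner f (\<lambda>x. c * g x) = c * sphere_inner f g"
  by (simp add: sphere_inner_def mult.left_commute)

lemma sphere_inner_sum_right:
  assumes "continuous_on (sphere 0 1) f" "\<And>i. i \<in> I \<Longrightarrow> continuous_on (sphere 0 1) (g i)"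
  shows "sphere_inner f (\<lambda>x. \<Sum>i\<in>I. g i x) = (\<Sum>i\<in>I. sphere_inner f (g i))"
  unfolding sphere_inner_def sum_distrib_left
  by (intro Bochner_Integration.integral_sum sphere_integrable continuous_intros assms)

text \<open>
  Integration by parts: the derivative of the product \<open>f g\<close> has integral zero.
\<close>

lemma sphere_inner_rot_deriv:
  assumes f: "f \<in> polys_upto s" and g: "g \<in> polys_upto t"
  shows "sphere_inner f (rot_deriv i j g) = - sphere_inner (rot_deriv i j f) g"
proof -
  have "0 = (LINT x|sphere_measure. f x * rot_deriv i j g x + g x * rot_deriv i j f x)"
    using sphere_integral_rot_deriv[OF polys_mult[OF f g], of i j] by (simp add: rot_deriv_mult[OF f g])
  also have "\<dots> = sphere_inner f (rot_deriv i j g) + sphere_inner g (rot_deriv i j f)"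
    unfolding sphere_inner_def
    by (intro Bochner_Integration.integral_add sphere_integrable continuous_intros
        polys_continuous[OF f] polys_continuous[OF g] polys_continuous[OF rot_deriv_polys[OF f]]
        polys_continuous[OF rot_deriv_polys[OF g]])
  finally show ?thesis by (simp add: sphere_inner_commute)
qed

lemma sphere_inner_casimir:
  assumes f: "f \<in> polys_upto s" and g: "g \<in> polys_upto t"
  shows "sphere_inner f (casimir g) =
    (\<Sum>i\<in>UNIV. \<Sum>j\<in>UNIV. sphere_inner (rot_deriv i j f) (rot_deriv i j g)) / 2"
proof -
  have LL: "rot_deriv i j (rot_deriv i j g) \<in> polys_upto t" for i j
    by (intro rot_deriv_polys g)
  note c = polys_continuous[OF f] polys_continuous[OF LL] polys_continuous[OF polys_sum[OF LL]]
  have "casimir g = (\<lambda>x. (- 1 / 2) * (\<Sum>i\<in>UNIV. \<Sum>j\<in>UNIV. rot_deriv i j (rot_deriv i j g) x))"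
    by (simp add: fun_eq_iff casimir_def)
  then have "sphere_inner f (casimir g) = (- 1 / 2) *
      sphere_inner f (\<lambda>x. \<Sum>i\<in>UNIV. \<Sum>j\<in>UNIV. rot_deriv i j (rot_deriv i j g) x)"
    by (simp only: sphere_inner_cmul_right)
  also have "\<dots> = (- 1 / 2) * (\<Sum>i\<in>UNIV. \<Sum>j\<in>UNIV. sphere_inner f (rot_deriv i j (rot_deriv i j g)))"
    by (simp only: sphere_inner_sum_right[OF c(1) c(2)] sphere_inner_sum_right[OF c(1) c(3)])
  also have "\<dots> = (\<Sum>i\<in>UNIV. \<Sum>j\<in>UNIV. sphere_inner (rot_deriv i j f) (rot_deriv i j g)) / 2"
    by (simp only: sphere_inner_rot_deriv[OF f rot_deriv_polys[OF g]] sum_negf)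
  finally show ?thesis .
qed

lemma casimir_symmetric:
  assumes "f \<in> polys_upto s" "g \<in> polys_upto t"
  shows "sphere_inner f (casimir g) = sphere_inner (casimir f) g"
proof -
  have "sphere_inner f (casimir g) = sphere_inner g (casimir f)"
    unfolding sphere_inner_casimir[OF assms] sphere_inner_casimir[OF assms(2,1)]
    by (intro arg_cong2[where f = "(/)"] sum.cong refl sphere_inner_commute)
  then show ?thesis by (subst sphere_inner_commute)
qed

lemma euler_leading:
  "f \<in> polys_upto s \<Longrightarrow> \<exists>r\<in>polys_below s. \<forall>x. euler f x = real s * f x + r x"
proof (induction rule: polys_induct)
  case (const c s)
  have "(\<lambda>x. - real s * c) \<in> polys_below s" by (cases s) (simp_all add: polys_below_def polys_const)
  then show ?case by (rule bexI[rotated]) (simp add: euler_def partial_deriv_const)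
next
  case (add f g s)
  then obtain r r' where r: "r \<in> polys_below s" "r' \<in> polys_below s"
    "\<And>x. euler f x = real s * f x + r x" "\<And>x. euler g x = real s * g x + r' x" by blast
  have "euler (\<lambda>x. f x + g x) x = euler f x + euler g x" for x
    by (simp add: euler_def partial_deriv_add[OF add.hyps] algebra_simps sum.distrib)
  then show ?case using r
    by (intro bexI[OF _ polys_below_add[OF r(1,2)]]) (simp add: algebra_simps)
next
  case (scale f c s)
  then obtain r where r: "r \<in> polys_below s" "\<And>x. euler f x = real s * f x + r x" by blast
  have "euler (\<lambda>x. c * f x) x = c * euler f x" for x
    by (simp add: euler_def partial_deriv_cmul[OF scale.hyps] sum_distrib_left algebra_simps)
  then show ?case using r
    by (intro bexI[OF _ polys_below_cmul[OF r(1), of c]]) (simp add: algebra_simps)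
next
  case (coord f k s)
  then obtain r where r: "r \<in> polys_below s" "\<And>x. euler f x = real s * f x + r x" by blast
  have "euler (\<lambda>x. x $ k * f x) x = x $ k * euler f x + x $ k * f x" for x
  proof -
    have "euler (\<lambda>x. x $ k * f x) x =
        (\<Sum>i\<in>UNIV. x $ k * (x $ i * partial_deriv i f x) + (if i = k then x $ k * f x else 0))"
      unfolding euler_def partial_deriv_mult[OF polys_coord coord.hyps] partial_deriv_coord
      by (rule sum.cong) (auto simp: algebra_simps)
    then show ?thesis by (simp add: sum.distrib euler_def sum_distrib_left)
  qed
  moreover have "(\<lambda>x. x $ k * r x) \<in> polys_below (Suc s)"
    using polys_below_coord_mult[OF r(1)] by simp
  ultimately show ?case using r(2)
    by (intro bexI[of _ "\<lambda>x. x $ k * r x"]) (simp_all add: algebra_simps)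
qed

lemma sum_sum_delta:
  fixes a :: "'n::finite \<Rightarrow> 'n \<Rightarrow> real"
  shows "(\<Sum>i\<in>UNIV. \<Sum>j\<in>UNIV. if j = k then a i j else 0) = (\<Sum>i\<in>UNIV. a i k)"
    and "(\<Sum>i\<in>UNIV. \<Sum>j\<in>UNIV. if i = k then a i j else 0) = (\<Sum>j\<in>UNIV. a k j)"
proof -
  show "(\<Sum>i\<in>UNIV. \<Sum>j\<in>UNIV. if j = k then a i j else 0) = (\<Sum>i\<in>UNIV. a i k)" by simp
  show "(\<Sum>i\<in>UNIV. \<Sum>j\<in>UNIV. if i = k then a i j else 0) = (\<Sum>j\<in>UNIV. a k j)"
    by (subst sum.swap) simp
qed

text \<open>
  By the Leibniz rule, the first term comes from differentiating \<open>f\<close> twice and the second from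
  differentiating the coordinate twice, which is an eigenfunction with eigenvalue \<open>CARD('n) - 1\<close>. The last
  two come from the mixed products, whose sum over all planes is \<open>2 (|x|\<^sup>2 \<partial>\<^sub>k f - x\<^sub>k (x \<bullet> \<nabla>f))\<close>.
\<close>

lemma casimir_coord_mult:
  fixes f :: "real ^ 'n \<Rightarrow> real"
  assumes f: "f \<in> polys_upto s" and x: "norm x = 1"
  shows "casimir (\<lambda>x. x $ k * f x) x =
    x $ k * casimir f x + (real CARD('n) - 1) * x $ k * f x - 2 * partial_deriv k f x + 2 * x $ k * euler f x"
proof -
  have x2: "(\<Sum>i\<in>UNIV. x $ i * x $ i) = 1"
    using x by (simp add: norm_eq_1 inner_vec_def)
  define X where "X i j x = (if j = k then x $ i else 0) - (if i = k then x $ j else 0)" for i j and x :: "real ^ 'n"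
  have Xp: "X i j \<in> polys_upto (Suc 0)" for i j
    unfolding X_def[abs_def] by (cases "j = k"; cases "i = k")
      (auto intro!: polys_diff simp: polys_coord polys_const polys_diff[OF polys_const[of 0] polys_coord, simplified])
  have LX: "rot_deriv i j (\<lambda>x. x $ k) = X i j" for i j
    by (auto simp: fun_eq_iff rot_deriv_coord X_def)
  have L1: "rot_deriv i j (\<lambda>x. x $ k * f x) = (\<lambda>x. x $ k * rot_deriv i j f x + f x * X i j x)" for i j
    by (simp add: fun_eq_iff rot_deriv_mult[OF polys_coord f] LX)
  have L2: "rot_deriv i j (rot_deriv i j (\<lambda>x. x $ k * f x)) x =
      x $ k * rot_deriv i j (rot_deriv i j f) x + 2 * (X i j x * rot_deriv i j f x) + f x * rot_deriv i j (X i j) x" for i j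
    unfolding L1
    by (subst rot_deriv_add[OF polys_mult[OF polys_coord rot_deriv_polys[OF f]] polys_mult[OF f Xp]])
      (simp add: rot_deriv_mult[OF polys_coord rot_deriv_polys[OF f]] rot_deriv_mult[OF f Xp] LX)
  have LXX: "rot_deriv i j (X i j) x = (if i = j then 0 else - x $ k * ((if j = k then 1 else 0) + (if i = k then 1 else 0)))" for i j
  proof (cases "i = j")
    case True then show ?thesis by (simp add: rot_deriv_def)
  next
    case False
    have "partial_deriv m (X i j) x = (if j = k then if m = i then 1 else 0 else 0) - (if i = k then if m = j then 1 else 0 else 0)" for m
      using False by (auto simp: X_def[abs_def] partial_deriv_coord partial_deriv_const
          partial_deriv_cmul[OF polys_coord, of _ "-1", simplified])
    then show ?thesis using False by (auto simp: rot_deriv_def)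
  qed
  have S1: "(\<Sum>i\<in>UNIV. \<Sum>j\<in>UNIV. X i j x * rot_deriv i j f x) = 2 * (partial_deriv k f x - x $ k * euler f x)"
  proof -
    have "(\<Sum>i\<in>UNIV. \<Sum>j\<in>UNIV. X i j x * rot_deriv i j f x) =
        (\<Sum>i\<in>UNIV. \<Sum>j\<in>UNIV. if j = k then x $ i * rot_deriv i j f x else 0) -
        (\<Sum>i\<in>UNIV. \<Sum>j\<in>UNIV. if i = k then x $ j * rot_deriv i j f x else 0)"
      unfolding sum_subtractf[symmetric] by (intro sum.cong refl) (auto simp: X_def algebra_simps)
    also have "\<dots> = (\<Sum>i\<in>UNIV. x $ i * rot_deriv i k f x) - (\<Sum>j\<in>UNIV. x $ j * rot_deriv k j f x)"
      unfolding sum_sum_delta ..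
    also have "(\<Sum>j\<in>UNIV. x $ j * rot_deriv k j f x) = - (\<Sum>j\<in>UNIV. x $ j * rot_deriv j k f x)"
      by (simp add: rot_deriv_def sum_negf[symmetric] algebra_simps)
    also have "(\<Sum>i\<in>UNIV. x $ i * rot_deriv i k f x) =
        (\<Sum>i\<in>UNIV. x $ i * x $ i) * partial_deriv k f x - x $ k * euler f x"
      by (simp add: rot_deriv_def euler_def sum_distrib_left sum_distrib_right sum_subtractf algebra_simps)
    finally show ?thesis by (simp add: x2)
  qed
  have S2: "(\<Sum>i\<in>UNIV. \<Sum>j\<in>UNIV. rot_deriv i j (X i j) x) = - 2 * (real CARD('n) - 1) * x $ k"
  proof -
    have "(\<Sum>i\<in>UNIV. \<Sum>j\<in>UNIV. rot_deriv i j (X i j) x) =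
        (\<Sum>i\<in>(UNIV :: 'n set). \<Sum>j\<in>UNIV. if j = k then - x $ k else 0) +
        (\<Sum>i\<in>UNIV. \<Sum>j\<in>(UNIV :: 'n set). if i = k then - x $ k else 0) +
        (\<Sum>i\<in>UNIV. \<Sum>j\<in>UNIV. if j = k then if i = k then 2 * x $ k else 0 else 0)"
      unfolding sum.distrib[symmetric] LXX by (intro sum.cong refl) auto
    also have "\<dots> = (\<Sum>i\<in>(UNIV :: 'n set). - x $ k) + (\<Sum>i\<in>(UNIV :: 'n set). - x $ k) + 2 * x $ k"
      unfolding sum_sum_delta by simp
    finally show ?thesis by (simp add: algebra_simps)
  qed
  have "(\<Sum>i\<in>UNIV. \<Sum>j\<in>UNIV. rot_deriv i j (rot_deriv i j (\<lambda>x. x $ k * f x)) x) =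
      x $ k * (\<Sum>i\<in>UNIV. \<Sum>j\<in>UNIV. rot_deriv i j (rot_deriv i j f) x) +
      2 * (\<Sum>i\<in>UNIV. \<Sum>j\<in>UNIV. X i j x * rot_deriv i j f x) +
      f x * (\<Sum>i\<in>UNIV. \<Sum>j\<in>UNIV. rot_deriv i j (X i j) x)"
    unfolding L2 by (simp add: sum.distrib sum_distrib_left)
  then show ?thesis unfolding S1 S2 casimir_def by (simp add: algebra_simps add_divide_distrib diff_divide_distrib)
qed

text \<open>
  Up to lower order, multiplication with a coordinate raises the factor from \<open>s (s + n - 2)\<close> by
  \<open>(n - 1) + 2 s\<close>, which gives \<open>(s + 1) (s + n - 1)\<close>; here \<open>n = CARD('n)\<close>.
\<close>

lemma casimir_leading:
  fixes f :: "real ^ 'n \<Rightarrow> real"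
  shows "f \<in> polys_upto s \<Longrightarrow> \<exists>r\<in>polys_below s. \<forall>x. norm x = 1 \<longrightarrow>
    casimir f x = real s * (real s + real CARD('n) - 2) * f x + r x"
proof (induction rule: polys_induct)
  case (const c s)
  have "(\<lambda>x. - real s * (real s + real CARD('n) - 2) * c) \<in> polys_below s"
    by (cases s) (simp_all add: polys_below_def polys_const)
  moreover have "rot_deriv i j (\<lambda>x. c) = (\<lambda>x. 0)" for i j :: 'n and c :: real
    by (simp add: fun_eq_iff rot_deriv_const)
  ultimately show ?case by (intro bexI) (auto simp: casimir_def)
next
  case (add f g s)
  then obtain r r' where r: "r \<in> polys_below s" "r' \<in> polys_below s"
    "\<And>x. norm x = 1 \<Longrightarrow> casimir f x = real s * (real s + real CARD('n) - 2) * f x + r x"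
    "\<And>x. norm x = 1 \<Longrightarrow> casimir g x = real s * (real s + real CARD('n) - 2) * g x + r' x" by blast
  have "rot_deriv i j (\<lambda>x. f x + g x) = (\<lambda>x. rot_deriv i j f x + rot_deriv i j g x)" for i j
    by (simp add: fun_eq_iff rot_deriv_add[OF add.hyps])
  then have eq: "casimir (\<lambda>x. f x + g x) x = casimir f x + casimir g x" for x
    by (simp add: casimir_def rot_deriv_add[OF rot_deriv_polys[OF add.hyps(1)] rot_deriv_polys[OF add.hyps(2)]]
        sum.distrib add_divide_distrib)
  show ?case
    by (intro bexI[OF _ polys_below_add[OF r(1,2)]]) (auto simp: eq r(3,4) algebra_simps)
next
  case (scale f c s)
  then obtain r where r: "r \<in> polys_below s"
    "\<And>x. norm x = 1 \<Longrightarrow> casimir f x = real s * (real s + real CARD('n) - 2) * f x + r x" by blast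
  have "rot_deriv i j (\<lambda>x. c * f x) = (\<lambda>x. c * rot_deriv i j f x)" for i j
    by (simp add: fun_eq_iff rot_deriv_cmul[OF scale.hyps])
  then have eq: "casimir (\<lambda>x. c * f x) x = c * casimir f x" for x
    by (simp add: casimir_def rot_deriv_cmul[OF rot_deriv_polys[OF scale.hyps]] sum_distrib_left)
  show ?case
    by (intro bexI[OF _ polys_below_cmul[OF r(1), of c]]) (auto simp: eq r(2) algebra_simps)
next
  case (coord f k s)
  then obtain r where r: "r \<in> polys_below s"
    "\<And>x. norm x = 1 \<Longrightarrow> casimir f x = real s * (real s + real CARD('n) - 2) * f x + r x" by blast
  obtain q where q: "q \<in> polys_below s" "\<And>x. euler f x = real s * f x + q x"
    using euler_leading[OF coord.hyps] by blast
  define R where "R = (\<lambda>x. (x $ k * r x + (- 2) * partial_deriv k f x) + 2 * (x $ k * q x))"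
  have "R \<in> polys_below (Suc s)"
    unfolding polys_below_Suc R_def
    by (intro polys_add polys_cmul polys_below_coord_mult r(1) q(1)
        subsetD[OF polys_below_subset polys_partial_deriv[OF coord.hyps]])
  moreover have "casimir (\<lambda>x. x $ k * f x) x =
      real (Suc s) * (real (Suc s) + real CARD('n) - 2) * (x $ k * f x) + R x" if "norm x = 1" for x
    unfolding casimir_coord_mult[OF coord.hyps that] r(2)[OF that] q(2) R_def by (simp add: algebra_simps)
  ultimately show ?case by (intro bexI[of _ R]) simp_all
qed

section \<open>Orthonormal families and the addition theorem\<close>

text \<open>
  Extension by zero makes equality of these functions the same as equality on the sphere, so that
  \<open>sphere_inner\<close> is definite on them.
\<close>

definition sphere_functions :: "(real ^ 'n \<Rightarrow> real) set"
  where "sphere_functions = {f. continuous_on (sphere 0 1) f \<and> (\<forall>x. x \<notin> sphere 0 1 \<longrightarrow> f x = 0)}"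

lemma sphere_functions_continuous: "f \<in> sphere_functions \<Longrightarrow> continuous_on (sphere 0 1) f"
  by (simp add: sphere_functions_def)

lemma sphere_functions_integrable: "f \<in> sphere_functions \<Longrightarrow> g \<in> sphere_functions \<Longrightarrow>
    integrable sphere_measure (\<lambda>x. f x * g x)"
  by (intro sphere_integrable continuous_intros sphere_functions_continuous)

lemma subspace_sphere_functions: "subspace sphere_functions"
  by (auto simp: subspace_def sphere_functions_def zero_fun_def plus_fun_def scaleR_fun_def
      intro!: continuous_intros)

lemma sum_fun_apply: "(\<Sum>b\<in>B. g b) x = (\<Sum>b\<in>B. g b x)" for g :: "'b \<Rightarrow> 'a \<Rightarrow> real"
  by (induction B rule: infinite_finite_induct) auto

lemma sphere_inner_plus: "f \<in> sphere_functions \<Longrightarrow> g \<in> sphere_functions \<Longrightarrow> h \<in> sphere_functions \<Longrightarrow>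
    sphere_inner (f + g) h = sphere_inner f h + sphere_inner g h"
  by (simp add: sphere_inner_def distrib_right sphere_functions_integrable)

lemma sphere_inner_minus: "f \<in> sphere_functions \<Longrightarrow> g \<in> sphere_functions \<Longrightarrow> h \<in> sphere_functions \<Longrightarrow>
    sphere_inner (f - g) h = sphere_inner f h - sphere_inner g h"
  by (simp add: sphere_inner_def left_diff_distrib sphere_functions_integrable)

lemma sphere_inner_scale: "sphere_inner (c *\<^sub>R f) h = c * sphere_inner f h"
  by (simp add: sphere_inner_def scaleR_fun_def mult.assoc)

lemma sphere_inner_sum:
  assumes "finite B" "\<And>b. b \<in> B \<Longrightarrow> f b \<in> sphere_functions" "h \<in> sphere_functions"
  shows "sphere_inner (\<Sum>b\<in>B. f b) h = (\<Sum>b\<in>B. sphere_inner (f b) h)"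
  using assms
proof (induction rule: finite_induct)
  case empty
  then show ?case by (simp add: sphere_inner_def zero_fun_def)
next
  case (insert b B)
  then have "(\<Sum>b\<in>B. f b) \<in> sphere_functions" "f b \<in> sphere_functions"
    by (auto intro: subspace_sum[OF subspace_sphere_functions])
  then show ?case using insert
    by (simp only: sum.insert[OF insert.hyps] sphere_inner_plus) simp
qed

lemma sphere_inner_self_eq_0:
  assumes f: "f \<in> sphere_functions" and 0: "sphere_inner f f = 0"
  shows "f = 0"
proof
  fix x
  show "f x = 0 x"
  proof (cases "x \<in> sphere 0 1")
    case True
    have "continuous_on (sphere 0 1) (\<lambda>x. f x * f x)"
      by (intro continuous_intros sphere_functions_continuous f)
    then have "f x * f x = 0"
      by (rule sphere_integral_nonneg_eq_0[OF _ _ _ True]) (use 0 in \<open>auto simp: sphere_inner_def\<close>)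
    then show ?thesis by simp
  qed (use f in \<open>simp add: sphere_functions_def\<close>)
qed

lemma sphere_inner_self_nonneg: "sphere_inner f f \<ge> 0"
  by (simp add: sphere_inner_def)

definition orthonormal :: "(real ^ 'n \<Rightarrow> real) set \<Rightarrow> bool"
  where "orthonormal B \<longleftrightarrow> finite B \<and> B \<subseteq> sphere_functions \<and>
    (\<forall>a\<in>B. \<forall>b\<in>B. sphere_inner a b = (if a = b then 1 else 0))"

lemma orthonormal_span_subset: "orthonormal B \<Longrightarrow> span B \<subseteq> sphere_functions"
  by (simp add: orthonormal_def span_minimal subspace_sphere_functions)

lemma sphere_inner_orthonormal_sum:
  assumes B: "orthonormal B" and b: "b \<in> B"
  shows "sphere_inner (\<Sum>a\<in>B. c a *\<^sub>R a) b = c b"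
proof -
  have fin: "finite B" and sub: "B \<subseteq> sphere_functions" using B by (auto simp: orthonormal_def)
  have "sphere_inner (\<Sum>a\<in>B. c a *\<^sub>R a) b = (\<Sum>a\<in>B. sphere_inner (c a *\<^sub>R a) b)"
    using sub b by (intro sphere_inner_sum fin subspace_scale[OF subspace_sphere_functions]) auto
  also have "\<dots> = (\<Sum>a\<in>B. if a = b then c b else 0)"
    using B b by (intro sum.cong) (auto simp: orthonormal_def sphere_inner_scale)
  finally show ?thesis using fin b by simp
qed

lemma orthonormal_expansion:
  assumes B: "orthonormal B" and f: "f \<in> span B"
  shows "f = (\<Sum>b\<in>B. sphere_inner f b *\<^sub>R b)"
proof -
  have "finite B" using B by (simp add: orthonormal_def)
  then obtain u where u: "f = (\<Sum>b\<in>B. u b *\<^sub>R b)"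
    using f by (auto simp: span_finite)
  have "(\<Sum>b\<in>B. u b *\<^sub>R b) = (\<Sum>b\<in>B. sphere_inner f b *\<^sub>R b)"
    by (rule sum.cong) (simp_all add: u sphere_inner_orthonormal_sum[OF B])
  then show ?thesis using u by (rule trans[rotated])
qed

lemma orthonormal_expansion_apply:
  assumes "orthonormal B" "f \<in> span B"
  shows "f x = (\<Sum>b\<in>B. sphere_inner f b * b x)"
proof -
  have "f x = (\<Sum>b\<in>B. sphere_inner f b *\<^sub>R b) x"
    using orthonormal_expansion[OF assms] by (rule arg_cong)
  then show ?thesis by (simp add: sum_fun_apply scaleR_fun_def)
qed

lemma parseval:
  assumes B: "orthonormal B" and f: "f \<in> span B"
  shows "sphere_inner f f = (\<Sum>b\<in>B. (sphere_inner f b)\<^sup>2)"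
proof -
  have fin: "finite B" and sub: "B \<subseteq> sphere_functions" using B by (auto simp: orthonormal_def)
  have fs: "f \<in> sphere_functions" using orthonormal_span_subset[OF B] f by blast
  have "sphere_inner f f = sphere_inner (\<Sum>b\<in>B. sphere_inner f b *\<^sub>R b) f"
    using orthonormal_expansion[OF B f] by (rule arg_cong)
  also have "\<dots> = (\<Sum>b\<in>B. sphere_inner (sphere_inner f b *\<^sub>R b) f)"
    using sub fs by (intro sphere_inner_sum fin subspace_scale[OF subspace_sphere_functions]) auto
  also have "\<dots> = (\<Sum>b\<in>B. (sphere_inner f b)\<^sup>2)"
  proof (rule sum.cong[OF refl])
    fix b
    show "sphere_inner (sphere_inner f b *\<^sub>R b) f = (sphere_inner f b)\<^sup>2"
      unfolding sphere_inner_scale by (subst sphere_inner_commute) (simp add: power2_eq_square)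
  qed
  finally show ?thesis .
qed

lemma orthonormal_dim:
  assumes B: "orthonormal B"
  shows "dim (span B) = card B"
proof -
  have "independent B"
  proof (rule independent_if_scalars_zero)
    show "finite B" using B by (simp add: orthonormal_def)
    fix c b assume 0: "(\<Sum>b\<in>B. c b *\<^sub>R b) = 0" and b: "b \<in> B"
    have "c b = sphere_inner 0 b"
      using sphere_inner_orthonormal_sum[OF B b, of c] 0 by simp
    then show "c b = 0" by (simp add: sphere_inner_def zero_fun_def)
  qed
  then show ?thesis by (rule dim_span_eq_card_independent)
qed

text \<open>
  Gram-Schmidt orthogonalization.
\<close>

lemma orthonormal_extension:
  assumes B: "orthonormal B" and S: "finite S" "S \<subseteq> sphere_functions"
  shows "\<exists>B'. B \<subseteq> B' \<and> orthonormal B' \<and> span B' = span (B \<union> S)"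
  using S
proof (induction rule: finite_induct)
  case empty
  then show ?case using B by auto
next
  case (insert f S)
  then obtain B' where B': "B \<subseteq> B'" "orthonormal B'" "span B' = span (B \<union> S)" by auto
  define p where "p = (\<Sum>b\<in>B'. sphere_inner f b *\<^sub>R b)"
  define g where "g = f - p"
  have p: "p \<in> span B'" unfolding p_def by (intro span_sum span_scale span_base)
  then have pf: "p \<in> sphere_functions" using orthonormal_span_subset[OF B'(2)] by blast
  have ff: "f \<in> sphere_functions" using insert.prems by simp
  have gf: "g \<in> sphere_functions" unfolding g_def by (intro subspace_diff[OF subspace_sphere_functions] pf ff)
  have gb: "sphere_inner g b = 0" if "b \<in> B'" for b
  proof -
    have "b \<in> sphere_functions" using that B'(2) by (auto simp: orthonormal_def)
    moreover have "sphere_inner p b = sphere_inner f b"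
      unfolding p_def by (rule sphere_inner_orthonormal_sum[OF B'(2) that])
    ultimately show ?thesis unfolding g_def by (simp add: sphere_inner_minus[OF ff pf])
  qed
  have span_f: "span (insert f B') = span (B \<union> insert f S)"
    using B'(3) by (simp add: span_insert)
  have sub_f: "span B' \<subseteq> span (insert f B')" by (rule span_mono) auto
  show ?case
  proof (cases "g = 0")
    case True
    then have "f \<in> span B'" using p by (simp add: g_def)
    then have "span B' = span (B \<union> insert f S)" using span_f span_redundant[of f B'] by simp
    then show ?thesis using B' by blast
  next
    case False
    define n where "n = sqrt (sphere_inner g g)"
    have "sphere_inner g g \<noteq> 0"
      using sphere_inner_self_eq_0[OF gf] False by blast
    then have "sphere_inner g g > 0"
      using sphere_inner_self_nonneg[of g] by linarith
    then have n: "n > 0" "sphere_inner g g = n * n" by (simp_all add: n_def)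
    define e where "e = (1 / n) *\<^sub>R g"
    have ef: "e \<in> sphere_functions" unfolding e_def by (intro subspace_scale[OF subspace_sphere_functions] gf)
    have "sphere_inner e e = (1 / n) * ((1 / n) * sphere_inner g g)"
      unfolding e_def sphere_inner_scale by (subst sphere_inner_commute) (simp only: sphere_inner_scale)
    then have ee: "sphere_inner e e = 1" using n by simp
    have eb: "sphere_inner e b = 0" "sphere_inner b e = 0" if "b \<in> B'" for b
      using gb[OF that] by (simp_all add: e_def sphere_inner_scale sphere_inner_commute[of b])
    have on: "orthonormal (insert e B')"
      using B'(2) ef ee eb by (auto simp: orthonormal_def)
    have sub_e: "span B' \<subseteq> span (insert e B')" by (rule span_mono) auto
    have "g \<in> span (insert f B')"
      unfolding g_def using p sub_f by (intro span_diff) (auto intro: span_base)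
    then have 1: "e \<in> span (insert f B')" unfolding e_def by (rule span_scale)
    have "f = n *\<^sub>R e + p" using n by (simp add: e_def g_def)
    moreover have "n *\<^sub>R e + p \<in> span (insert e B')"
      using p sub_e by (intro span_add span_scale) (auto intro: span_base)
    ultimately have 2: "f \<in> span (insert e B')" by simp
    have "span (insert e B') = span (insert f B')"
      unfolding span_eq using 1 2 by (auto intro: span_base)
    then show ?thesis using B' span_f on by blast
  qed
qed

lemma orthonormal_basis_extension:
  assumes B: "orthonormal B" "B \<subseteq> V" and V: "subspace V" "V \<subseteq> sphere_functions" "V \<subseteq> span S" "finite S"
  obtains B' where "B \<subseteq> B'" "orthonormal B'" "span B' = V"
proof -
  obtain A where A: "A \<subseteq> V" "independent A" "V \<subseteq> span A" by (rule maximal_independent_subset)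
  then have "finite A" using independent_span_bound[OF \<open>finite S\<close> A(2)] V(3) by blast
  then obtain B' where B': "B \<subseteq> B'" "orthonormal B'" "span B' = span (B \<union> A)"
    using orthonormal_extension[OF B(1), of A] A(1) V(2) by blast
  have "span (B \<union> A) \<subseteq> V" using A(1) B(2) V(1) by (intro span_minimal) auto
  moreover have "V \<subseteq> span (B \<union> A)" using A(3) span_mono[of A "B \<union> A"] by blast
  ultimately show ?thesis using B' by (intro that[of B']) auto
qed

lemma orthonormal_empty: "orthonormal {}"
  by (simp add: orthonormal_def)

text \<open>
  Let \<open>k x\<close> be the sum on the left, and let \<open>f = (\<Sum>b\<in>B. b x *\<^sub>R b)\<close>. Both the value of \<open>f\<close> at \<open>x\<close> and
  the square of its norm are \<open>k x\<close>. If \<open>U\<close> is orthogonal with \<open>U y = x\<close>, then \<open>f \<circ> U\<close> has the same norm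
  and takes at \<open>y\<close> the value \<open>k x\<close>; by the Cauchy-Schwarz inequality, \<open>(k x)\<^sup>2 \<le> k x * k y\<close>. So \<open>k\<close> is
  constant, and its integral is the number of basis functions.
\<close>

lemma addition_theorem:
  assumes B: "orthonormal B"
    and inv: "\<And>U f. orthogonal_transformation U \<Longrightarrow> f \<in> span B \<Longrightarrow> f \<circ> U \<in> span B"
    and x: "norm x = 1"
  shows "(\<Sum>b\<in>B. (b x)\<^sup>2) = real (card B)"
proof -
  define k where "k x = (\<Sum>b\<in>B. (b x)\<^sup>2)" for x
  have le: "k x \<le> k y" if x: "norm x = 1" and y: "norm y = 1" for x y
  proof -
    obtain U where U: "orthogonal_transformation U" "U y = x"
      using orthogonal_transformation_exists_1[OF y x] by metis
    define f where "f = (\<Sum>b\<in>B. b x *\<^sub>R b)"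
    have f: "f \<in> span B" unfolding f_def by (intro span_sum span_scale span_base)
    have fb: "sphere_inner f b = b x" if "b \<in> B" for b
      unfolding f_def by (rule sphere_inner_orthonormal_sum[OF B that])
    have "f x = (\<Sum>b\<in>B. sphere_inner f b * b x)" by (rule orthonormal_expansion_apply[OF B f])
    also have "\<dots> = k x" unfolding k_def by (intro sum.cong) (simp_all add: fb power2_eq_square)
    finally have fx: "f x = k x" .
    have "sphere_inner f f = (\<Sum>b\<in>B. (sphere_inner f b)\<^sup>2)" by (rule parseval[OF B f])
    also have "\<dots> = k x" unfolding k_def by (intro sum.cong) (simp_all add: fb)
    finally have ff: "sphere_inner f f = k x" .
    define g where "g = f \<circ> U"
    have g: "g \<in> span B" unfolding g_def by (rule inv[OF U(1) f])
    have "continuous_on (sphere 0 1) (\<lambda>x. f x * f x)"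
      using orthonormal_span_subset[OF B] f by (intro continuous_intros sphere_functions_continuous) auto
    then have gg: "sphere_inner g g = k x"
      using sphere_integral_orthogonal[OF U(1), of "\<lambda>x. f x * f x"] ff
      by (simp add: g_def sphere_inner_def)
    have "(k x)\<^sup>2 = (g y)\<^sup>2" by (simp add: g_def U(2) fx)
    also have "g y = (\<Sum>b\<in>B. sphere_inner g b * b y)"
      by (rule orthonormal_expansion_apply[OF B g])
    also have "(\<Sum>b\<in>B. sphere_inner g b * b y)\<^sup>2 \<le> (\<Sum>b\<in>B. (sphere_inner g b)\<^sup>2) * (\<Sum>b\<in>B. (b y)\<^sup>2)"
      by (rule Cauchy_Schwarz_ineq_sum)
    also have "\<dots> = k x * k y" using parseval[OF B g] gg by (simp add: k_def)
    finally have "k x * k x \<le> k x * k y" by (simp add: power2_eq_square)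
    moreover have "k x \<ge> 0" "k y \<ge> 0" by (auto simp: k_def intro: sum_nonneg)
    ultimately show ?thesis by (metis mult_le_cancel_left_pos order_le_less)
  qed
  have "real (card B) = (\<Sum>b\<in>B. sphere_inner b b)" using B by (simp add: orthonormal_def)
  also have "\<dots> = (LINT y|sphere_measure. (\<Sum>b\<in>B. b y * b y))"
    unfolding sphere_inner_def using B
    by (intro Bochner_Integration.integral_sum[symmetric]) (auto simp: orthonormal_def intro!: sphere_functions_integrable)
  also have "\<dots> = (LINT y|(sphere_measure :: (real ^ 'a) measure). k x)"
  proof (rule Bochner_Integration.integral_cong[OF refl])
    fix y :: "real ^ 'a" assume "y \<in> space sphere_measure"
    then have "k y = k x" using le x by (intro antisym) auto
    then show "(\<Sum>b\<in>B. b y * b y) = k x" by (simp add: k_def power2_eq_square)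
  qed
  finally show ?thesis unfolding sphere_integral_const k_def by (rule sym)
qed

section \<open>Spaces of polynomials on the sphere\<close>

definition monomial :: "('n \<Rightarrow> nat) \<Rightarrow> real ^ 'n \<Rightarrow> real"
  where "monomial \<alpha> x = (\<Prod>i\<in>UNIV. (x $ i) ^ \<alpha> i)"

definition sphere_polys :: "nat \<Rightarrow> (real ^ 'n \<Rightarrow> real) set"
  where "sphere_polys s = restrict_sphere ` polys_upto s"

lemma linear_restrict_sphere: "linear restrict_sphere"
  by (rule linearI) (auto simp: restrict_sphere_def fun_eq_iff scaleR_fun_def)

lemma multiindices_subset_count:
  "{\<alpha> :: 'n::finite \<Rightarrow> nat. (\<Sum>i\<in>UNIV. \<alpha> i) = k} \<subseteq> count ` multisets_of_size UNIV k"
proof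
  fix \<alpha> :: "'n \<Rightarrow> nat" assume "\<alpha> \<in> {\<alpha>. (\<Sum>i\<in>UNIV. \<alpha> i) = k}"
  then have k: "(\<Sum>i\<in>UNIV. \<alpha> i) = k" by simp
  define X where "X = (\<Sum>i\<in>UNIV. replicate_mset (\<alpha> i) i)"
  have "count X = \<alpha>"
    by (auto simp: X_def fun_eq_iff count_sum)
  moreover have "size X = k" by (simp add: X_def k size_multiset_sum)
  ultimately show "\<alpha> \<in> count ` multisets_of_size UNIV k"
    by (intro image_eqI[of _ _ X]) (auto simp: multisets_of_size_def)
qed

lemma
  shows finite_multiindices: "finite {\<alpha> :: 'n::finite \<Rightarrow> nat. (\<Sum>i\<in>UNIV. \<alpha> i) = k}"
    and card_multiindices_le: "card {\<alpha> :: 'n::finite \<Rightarrow> nat. (\<Sum>i\<in>UNIV. \<alpha> i) = k} \<le> (CARD('n) + k - 1) choose k"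
proof -
  have fin: "finite (multisets_of_size (UNIV :: 'n set) k)" by (simp add: finite_multisets_of_size)
  then show "finite {\<alpha> :: 'n::finite \<Rightarrow> nat. (\<Sum>i\<in>UNIV. \<alpha> i) = k}"
    using finite_subset[OF multiindices_subset_count] by blast
  have "card {\<alpha> :: 'n::finite \<Rightarrow> nat. (\<Sum>i\<in>UNIV. \<alpha> i) = k} \<le> card (multisets_of_size (UNIV :: 'n set) k)"
    using card_mono[OF finite_imageI[OF fin] multiindices_subset_count] card_image_le[OF fin, of count]
    by linarith
  then show "card {\<alpha> :: 'n::finite \<Rightarrow> nat. (\<Sum>i\<in>UNIV. \<alpha> i) = k} \<le> (CARD('n) + k - 1) choose k"
    by (simp add: card_multisets_of_size)
qed

lemma sphere_polys_eq_span:
  "(sphere_polys s :: (real ^ 'n \<Rightarrow> real) set) = span ((\<lambda>\<alpha>. restrict_sphere (monomial \<alpha>)) ` {\<alpha>. (\<Sum>i\<in>UNIV. \<alpha> i) \<le> s})"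
proof -
  have "(polys_upto s :: (real ^ 'n \<Rightarrow> real) set) = span (monomial ` {\<alpha>. (\<Sum>i\<in>UNIV. \<alpha> i) \<le> s})"
    unfolding polys_upto_def by (intro arg_cong[where f = span]) (auto simp: monomial_def[abs_def])
  then have "(sphere_polys s :: (real ^ 'n \<Rightarrow> real) set) = span (restrict_sphere ` monomial ` {\<alpha>. (\<Sum>i\<in>UNIV. \<alpha> i) \<le> s})"
    unfolding sphere_polys_def by (simp only: linear_span_image[OF linear_restrict_sphere])
  then show ?thesis by (simp only: image_image)
qed

lemma finite_multiindices_le: "finite {\<alpha> :: 'n::finite \<Rightarrow> nat. (\<Sum>i\<in>UNIV. \<alpha> i) \<le> s}"
proof -
  have "{\<alpha> :: 'n::finite \<Rightarrow> nat. (\<Sum>i\<in>UNIV. \<alpha> i) \<le> s} = (\<Union>k\<in>{..s}. {\<alpha>. (\<Sum>i\<in>UNIV. \<alpha> i) = k})" by auto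
  then show ?thesis by (simp only:) (intro finite_UN_I finite_atMost finite_multiindices)
qed

lemma subspace_sphere_polys: "subspace (sphere_polys s)"
  by (simp add: sphere_polys_eq_span)

lemma sphere_polys_subset: "sphere_polys s \<subseteq> sphere_functions"
proof
  fix f :: "real ^ 'n \<Rightarrow> real" assume "f \<in> sphere_polys s"
  then obtain P where P: "P \<in> polys_upto s" "f = restrict_sphere P" by (auto simp: sphere_polys_def)
  have "continuous_on (sphere 0 1) f"
    using polys_continuous[OF P(1)] by (rule continuous_on_eq) (simp add: P restrict_sphere_def)
  then show "f \<in> sphere_functions" by (simp add: sphere_functions_def P restrict_sphere_def)
qed

text \<open>
  On the sphere a monomial equals its product with \<open>|x|\<^sup>2\<close>, a sum of monomials of degree larger by two.
  Repeating this raises all degrees to one of the two largest.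
\<close>

lemma sphere_polys_subset_top_degrees:
  "(sphere_polys (Suc s) :: (real ^ 'n \<Rightarrow> real) set) \<subseteq> span ((\<lambda>\<alpha>. restrict_sphere (monomial \<alpha>)) `
    ({\<alpha>. (\<Sum>i\<in>UNIV. \<alpha> i) = Suc s} \<union> {\<alpha>. (\<Sum>i\<in>UNIV. \<alpha> i) = s}))" (is "_ \<subseteq> span ?S")
proof -
  have "restrict_sphere (monomial \<alpha>) \<in> span ?S" if "(\<Sum>i\<in>UNIV. \<alpha> i) \<le> Suc s" for \<alpha> :: "'n \<Rightarrow> nat"
    using that
  proof (induction "Suc s - (\<Sum>i\<in>UNIV. \<alpha> i)" arbitrary: \<alpha> rule: less_induct)
    case less
    show ?case
    proof (cases "(\<Sum>i\<in>UNIV. \<alpha> i) \<ge> s")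
      case True
      then have "(\<Sum>i\<in>UNIV. \<alpha> i) = s \<or> (\<Sum>i\<in>UNIV. \<alpha> i) = Suc s" using less.prems by linarith
      then show ?thesis by (intro span_base imageI) auto
    next
      case False
      define \<beta> where "\<beta> j = \<alpha>(j := \<alpha> j + 2)" for j
      have sum_\<beta>: "(\<Sum>i\<in>UNIV. \<beta> j i) = (\<Sum>i\<in>UNIV. \<alpha> i) + 2" for j
        by (simp add: sum.remove[of UNIV j] \<beta>_def)
      have "monomial (\<beta> j) x = (x $ j)\<^sup>2 * monomial \<alpha> x" for j x
        by (simp add: monomial_def prod.remove[of UNIV j] \<beta>_def power_add power2_eq_square mult_ac)
      then have "restrict_sphere (monomial \<alpha>) x = (\<Sum>j\<in>UNIV. restrict_sphere (monomial (\<beta> j)) x)" for x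
      proof (cases "norm x = 1")
        case True
        have "(\<Sum>j\<in>UNIV. (x $ j)\<^sup>2) = 1"
          using True by (simp add: norm_eq_1 inner_vec_def power2_eq_square)
        then show ?thesis
          using \<open>\<And>x j. monomial (\<beta> j) x = (x $ j)\<^sup>2 * monomial \<alpha> x\<close> True
          by (simp add: restrict_sphere_def sum_distrib_right[symmetric])
      qed (simp add: restrict_sphere_def)
      then have "restrict_sphere (monomial \<alpha>) = (\<Sum>j\<in>UNIV. restrict_sphere (monomial (\<beta> j)))"
        by (simp add: fun_eq_iff sum_fun_apply)
      moreover have "restrict_sphere (monomial (\<beta> j)) \<in> span ?S" for j
        using False by (intro less.hyps) (simp_all add: sum_\<beta>)
      ultimately show ?thesis by (simp add: span_sum)
    qed
  qed
  then show ?thesis unfolding sphere_polys_eq_span by (intro span_minimal) auto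
qed

text \<open>
  The bound counts the monomials of the degrees \<open>s + 1\<close> and \<open>s\<close>; the two binomial coefficients add up to
  \<open>harmonic_dim\<close>.
\<close>

lemma dim_sphere_polys_le:
  "real (dim (sphere_polys (Suc s) :: (real ^ 'n \<Rightarrow> real) set)) \<le> harmonic_dim (Suc s) CARD('n)"
proof -
  define A B where "A = {\<alpha> :: 'n \<Rightarrow> nat. (\<Sum>i\<in>UNIV. \<alpha> i) = Suc s}" and "B = {\<alpha> :: 'n \<Rightarrow> nat. (\<Sum>i\<in>UNIV. \<alpha> i) = s}"
  have fin: "finite A" "finite B" unfolding A_def B_def by (rule finite_multiindices)+
  obtain n where n: "CARD('n) = Suc n" using gr0_implies_Suc[OF zero_less_card_finite[where 'a = 'n]] by blast
  have "dim (sphere_polys (Suc s) :: (real ^ 'n \<Rightarrow> real) set) \<le> card ((\<lambda>\<alpha>. restrict_sphere (monomial \<alpha>)) ` (A \<union> B))"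
    using fin sphere_polys_subset_top_degrees unfolding A_def B_def by (intro dim_le_card) auto
  also have "\<dots> \<le> card (A \<union> B)" using fin by (intro card_image_le) auto
  also have "\<dots> \<le> card A + card B" by (rule card_Un_le)
  also have "\<dots> \<le> ((CARD('n) + Suc s - 1) choose Suc s) + ((CARD('n) + s - 1) choose s)"
    unfolding A_def B_def by (intro add_mono card_multiindices_le)
  finally have le: "dim (sphere_polys (Suc s) :: (real ^ 'n \<Rightarrow> real) set) \<le> (Suc (n + s) choose Suc s) + ((n + s) choose s)"
    by (simp add: n)
  have "real (Suc s) * real (Suc (n + s) choose Suc s) = real (Suc (n + s)) * real ((n + s) choose s)"
    using Suc_times_binomial_eq[of "n + s" s] by (simp only: of_nat_mult[symmetric] mult.commute)
  then have "real ((n + s) choose s) = real (Suc s) / real (Suc (n + s)) * real (Suc (n + s) choose Suc s)"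
    by (simp add: field_simps)
  then have "harmonic_dim (Suc s) CARD('n) = real (Suc (n + s) choose Suc s) + real ((n + s) choose s)"
    by (simp add: harmonic_dim_def n field_simps del: of_nat_Suc binomial_Suc_Suc) (simp add: algebra_simps del: binomial_Suc_Suc)
  then show ?thesis using le by linarith
qed

lemma polys_compose_linear:
  fixes U :: "real ^ 'n \<Rightarrow> real ^ 'n"
  assumes U: "linear U" and f: "f \<in> polys_upto s"
  shows "(\<lambda>x. f (U x)) \<in> polys_upto s"
  using f
proof (induction rule: polys_induct)
  case (const c s)
  show ?case by (rule polys_const)
next
  case (add f g s)
  then show ?case by (intro polys_add)
next
  case (scale f c s)
  then show ?case by (intro polys_cmul)
next
  case (coord f i s)
  have "U x $ i = (\<Sum>j\<in>UNIV. matrix U $ i $ j * x $ j)" for x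
    using matrix_vector_mul(2)[OF U] by (simp add: matrix_vector_mult_def vec_eq_iff fun_eq_iff)
  then have "(\<lambda>x. U x $ i * f (U x)) = (\<lambda>x. \<Sum>j\<in>UNIV. matrix U $ i $ j * (x $ j * f (U x)))"
    by (simp add: fun_eq_iff sum_distrib_right mult.assoc)
  also have "\<dots> \<in> polys_upto (Suc s)"
    by (intro polys_sum polys_cmul polys_coord_mult coord.IH)
  finally show ?case .
qed

lemma restrict_sphere_orthogonal:
  fixes U :: "real ^ 'n \<Rightarrow> real ^ 'n"
  shows "orthogonal_transformation U \<Longrightarrow> restrict_sphere P \<circ> U = restrict_sphere (\<lambda>x. P (U x))"
  by (auto simp: restrict_sphere_def fun_eq_iff orthogonal_transformation_norm)

lemma sphere_polys_orthogonal:
  fixes U :: "real ^ 'n \<Rightarrow> real ^ 'n"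
  assumes U: "orthogonal_transformation U" and f: "f \<in> sphere_polys s"
  shows "f \<circ> U \<in> sphere_polys s"
proof -
  obtain P where P: "P \<in> polys_upto s" "f = restrict_sphere P" using f by (auto simp: sphere_polys_def)
  have "(\<lambda>x. P (U x)) \<in> polys_upto s"
    by (rule polys_compose_linear[OF orthogonal_transformation_linear[OF U] P(1)])
  then show ?thesis
    unfolding P(2) restrict_sphere_orthogonal[OF U] sphere_polys_def by (rule imageI)
qed

lemma integral_restrict_sphere:
  "(LINT x|sphere_measure. restrict_sphere P x) = (LINT x|sphere_measure. P x)"
  by (rule Bochner_Integration.integral_cong) (simp_all add: restrict_sphere_def)

lemma mean_zero_polys_eq: "mean_zero_polys s = {f \<in> sphere_polys s. (LINT x|sphere_measure. f x) = 0}"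
  by (auto simp: mean_zero_polys_def sphere_polys_def integral_restrict_sphere)

lemma subspace_mean_zero_polys: "subspace (mean_zero_polys s)"
proof -
  have int: "integrable sphere_measure f" if "f \<in> sphere_polys s" for f :: "real ^ 'n \<Rightarrow> real"
    using that sphere_polys_subset by (intro sphere_integrable sphere_functions_continuous) blast
  show ?thesis
    using subspace_sphere_polys[of s] int
    by (auto simp: mean_zero_polys_eq subspace_def zero_fun_def plus_fun_def scaleR_fun_def)
qed

lemma mean_zero_polys_orthogonal:
  fixes U :: "real ^ 'n \<Rightarrow> real ^ 'n"
  assumes U: "orthogonal_transformation U" and f: "f \<in> mean_zero_polys s"
  shows "f \<circ> U \<in> mean_zero_polys s"
proof -
  have "continuous_on (sphere 0 1) f"
    using f sphere_polys_subset by (intro sphere_functions_continuous) (auto simp: mean_zero_polys_eq)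
  from sphere_integral_orthogonal[OF U this] show ?thesis
    using f sphere_polys_orthogonal[OF U] by (simp add: mean_zero_polys_eq o_def)
qed

lemma mean_zero_polys_subset: "mean_zero_polys s \<subseteq> sphere_polys s"
  by (auto simp: mean_zero_polys_eq)

lemma mean_zero_polys_mono: "s \<le> t \<Longrightarrow> mean_zero_polys s \<subseteq> mean_zero_polys t"
  using polys_mono[of s t] by (auto simp: mean_zero_polys_def)

lemma finite_spanning_sphere_polys:
  "finite ((\<lambda>\<alpha>. restrict_sphere (monomial \<alpha>)) ` {\<alpha>. (\<Sum>i\<in>UNIV. \<alpha> i) \<le> s})"
  by (intro finite_imageI finite_multiindices_le)

lemma mean_zero_basis_extension:
  assumes "orthonormal B" "B \<subseteq> mean_zero_polys s"
  obtains B' where "B \<subseteq> B'" "orthonormal B'" "span B' = mean_zero_polys s"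
proof (rule orthonormal_basis_extension[OF assms subspace_mean_zero_polys])
  show "mean_zero_polys s \<subseteq> sphere_functions"
    by (rule order.trans[OF mean_zero_polys_subset sphere_polys_subset])
  show "mean_zero_polys s \<subseteq> span ((\<lambda>\<alpha>. restrict_sphere (monomial \<alpha>)) ` {\<alpha>. (\<Sum>i\<in>UNIV. \<alpha> i) \<le> s})"
    by (rule order.trans[OF mean_zero_polys_subset eq_refl[OF sphere_polys_eq_span]])
qed (rule finite_spanning_sphere_polys, rule that)

lemma sphere_polys_basis:
  obtains B where "orthonormal B" "span B = sphere_polys s"
proof (rule orthonormal_basis_extension[OF orthonormal_empty empty_subsetI subspace_sphere_polys sphere_polys_subset])
  show "sphere_polys s \<subseteq> span ((\<lambda>\<alpha>. restrict_sphere (monomial \<alpha>)) ` {\<alpha>. (\<Sum>i\<in>UNIV. \<alpha> i) \<le> s})"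
    by (rule eq_refl[OF sphere_polys_eq_span])
qed (rule finite_spanning_sphere_polys, rule that)

lemma sphere_inner_restrict: "sphere_inner (restrict_sphere f) (restrict_sphere g) = sphere_inner f g"
  unfolding sphere_inner_def by (rule Bochner_Integration.integral_cong) (simp_all add: restrict_sphere_def)

text \<open>
  The orthogonal projection of \<open>f\<close> onto the polynomials of degree at most \<open>s\<close>.
\<close>

lemma polys_projection:
  assumes f: "f \<in> polys_upto t"
  obtains Q where "Q \<in> polys_upto s" "\<And>S. S \<in> polys_upto s \<Longrightarrow> sphere_inner (\<lambda>x. f x - Q x) S = 0"
proof -
  obtain B :: "(real ^ 'a \<Rightarrow> real) set" where B: "orthonormal B" "span B = sphere_polys s" by (rule sphere_polys_basis)
  define F where "F = restrict_sphere f"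
  define p where "p = (\<Sum>b\<in>B. sphere_inner F b *\<^sub>R b)"
  have F: "F \<in> sphere_functions"
    using f sphere_polys_subset[of t] by (auto simp: F_def sphere_polys_def)
  have "p \<in> span B" unfolding p_def by (intro span_sum span_scale span_base)
  then obtain Q where Q: "Q \<in> polys_upto s" "p = restrict_sphere Q" using B(2) by (auto simp: sphere_polys_def)
  have p: "p \<in> sphere_functions" using \<open>p \<in> span B\<close> orthonormal_span_subset[OF B(1)] by blast
  have b0: "sphere_inner (F - p) b = 0" if "b \<in> B" for b
  proof -
    have "b \<in> sphere_functions" using B(1) that by (auto simp: orthonormal_def)
    moreover have "sphere_inner p b = sphere_inner F b"
      unfolding p_def by (rule sphere_inner_orthonormal_sum[OF B(1) that])
    ultimately show ?thesis by (simp add: sphere_inner_minus[OF F p])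
  qed
  have Fp: "F - p = restrict_sphere (\<lambda>x. f x - Q x)"
    by (auto simp: F_def Q restrict_sphere_def fun_eq_iff)
  have FpS: "F - p \<in> sphere_functions" by (intro subspace_diff[OF subspace_sphere_functions] F p)
  have "sphere_inner (\<lambda>x. f x - Q x) S = 0" if "S \<in> polys_upto s" for S
  proof -
    define G where "G = restrict_sphere S"
    have G: "G \<in> span B" using that B(2) by (auto simp: G_def sphere_polys_def)
    have fin: "finite B" and sub: "B \<subseteq> sphere_functions" using B(1) by (auto simp: orthonormal_def)
    have "sphere_inner G (F - p) = sphere_inner (\<Sum>b\<in>B. sphere_inner G b *\<^sub>R b) (F - p)"
      using orthonormal_expansion[OF B(1) G] by (rule arg_cong)
    also have "\<dots> = (\<Sum>b\<in>B. sphere_inner (sphere_inner G b *\<^sub>R b) (F - p))"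
      using sub by (intro sphere_inner_sum fin FpS subspace_scale[OF subspace_sphere_functions]) auto
    also have "\<dots> = 0"
      by (intro sum.neutral ballI, unfold sphere_inner_scale, subst sphere_inner_commute) (simp add: b0)
    finally show ?thesis
      by (simp only: Fp G_def sphere_inner_restrict sphere_inner_commute[of S])
  qed
  with Q(1) show ?thesis by (rule that)
qed

section \<open>The Poincare inequality\<close>

lemma polys_upto_0:
  fixes f :: "real ^ 'n \<Rightarrow> real"
  assumes "f \<in> polys_upto 0"
  shows "\<exists>c. f = (\<lambda>x. c)"
proof -
  have "f \<in> span {\<lambda>x. 1}"
    using assms unfolding polys_upto_def
  proof (rule subsetD[OF span_mono, rotated], intro subsetI, elim CollectE exE conjE)
    fix g :: "real ^ 'n \<Rightarrow> real" and \<alpha> :: "'n \<Rightarrow> nat"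
    assume g: "g = (\<lambda>x. \<Prod>i\<in>UNIV. (x $ i) ^ \<alpha> i)" and "(\<Sum>i\<in>UNIV. \<alpha> i) \<le> 0"
    then have "\<alpha> i = 0" for i by simp
    then show "g \<in> {\<lambda>x. 1}" by (simp add: g)
  qed
  then obtain c where "f = c *\<^sub>R (\<lambda>x. 1)" unfolding span_singleton by blast
  then have "f = (\<lambda>x. c)" by (simp add: scaleR_fun_def)
  then show ?thesis ..
qed

text \<open>
  Induction on the degree. Split \<open>f\<close> into its projection \<open>Q\<close> to the polynomials of smaller degree and a rest
  \<open>R\<close> orthogonal to them. As \<open>casimir\<close> is symmetric and does not raise degrees, the energy splits in the same
  way. By \<open>casimir_leading\<close> the energy of \<open>R\<close> is \<open>s (s + n - 2)\<close> times the square of its norm, for \<open>s\<close> the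
  degree and \<open>n = CARD('n)\<close>, because the lower order term is orthogonal to \<open>R\<close>. This factor is at least
  \<open>n - 1\<close>.
\<close>

lemma poincare_inequality:
  fixes f :: "real ^ 'n \<Rightarrow> real"
  assumes "f \<in> polys_upto s" "(LINT x|sphere_measure. f x) = 0"
  shows "(real CARD('n) - 1) * sphere_inner f f \<le> sphere_inner f (casimir f)"
  using assms
proof (induction s arbitrary: f)
  case 0
  obtain c where c: "f = (\<lambda>x. c)" using polys_upto_0[OF 0(1)] by blast
  have "c = 0" using 0(2) by (simp only: c sphere_integral_const)
  then have "f = (\<lambda>x. 0)" using c by simp
  then show ?case by (simp add: sphere_inner_def)
next
  case (Suc s)
  note f = Suc.prems(1)
  obtain Q where Q: "Q \<in> polys_upto s" "\<And>S. S \<in> polys_upto s \<Longrightarrow> sphere_inner (\<lambda>x. f x - Q x) S = 0"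
    using polys_projection[OF f] by blast
  define R where "R = (\<lambda>x. f x - Q x)"
  have Q': "Q \<in> polys_upto (Suc s)" using Q(1) polys_mono[of s "Suc s"] by auto
  have R: "R \<in> polys_upto (Suc s)" unfolding R_def by (intro polys_diff f Q')
  have RS: "sphere_inner R S = 0" if "S \<in> polys_upto s" for S using Q(2)[OF that] by (simp add: R_def)
  have fQR: "f = (\<lambda>x. Q x + R x)" by (simp add: R_def)
  have c: "continuous_on (sphere 0 1) Q" "continuous_on (sphere 0 1) R" "continuous_on (sphere 0 1) f"
    by (rule polys_continuous[OF Q'] polys_continuous[OF R] polys_continuous[OF f])+
  have "(LINT x|sphere_measure. R x) = 0" using RS[OF polys_const[of 1]] by (simp add: sphere_inner_def)
  moreover have "(LINT x|sphere_measure. f x) = (LINT x|sphere_measure. Q x) + (LINT x|sphere_measure. R x)"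
    unfolding fQR by (intro Bochner_Integration.integral_add sphere_integrable c)
  ultimately have Q0: "(LINT x|sphere_measure. Q x) = 0" using Suc.prems(2) by simp
  obtain r where r: "r \<in> polys_below (Suc s)" "\<And>x. norm x = 1 \<Longrightarrow>
      casimir R x = real (Suc s) * (real (Suc s) + real CARD('n) - 2) * R x + r x"
    using casimir_leading[OF R] by blast
  have r': "r \<in> polys_upto s" using r(1) by simp
  have QR: "sphere_inner Q R = 0" using RS[OF Q(1)] by (simp add: sphere_inner_commute)
  have split: "sphere_inner g f = sphere_inner g Q + sphere_inner g R" if "continuous_on (sphere 0 1) g" for g
    using sphere_inner_add_right[OF that c(1,2)] by (simp only: fQR[symmetric])
  have ff: "sphere_inner f f = sphere_inner Q Q + sphere_inner R R"
    using split[OF c(3)] split[OF c(1)] split[OF c(2)] QR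
      sphere_inner_commute[of f Q] sphere_inner_commute[of f R] sphere_inner_commute[of R Q] by linarith
  have cas: "sphere_inner g (casimir f) = sphere_inner g (casimir Q) + sphere_inner g (casimir R)" if "g \<in> polys_upto (Suc s)" for g
    using split[OF polys_continuous[OF casimir_polys[OF that]]]
    by (simp only: casimir_symmetric[OF that Q'] casimir_symmetric[OF that R] casimir_symmetric[OF that f])
  have "sphere_inner f (casimir f) = sphere_inner (casimir f) f" by (rule casimir_symmetric[OF f f])
  also have "\<dots> = sphere_inner (casimir f) Q + sphere_inner (casimir f) R"
    by (rule split[OF polys_continuous[OF casimir_polys[OF f]]])
  also have "\<dots> = sphere_inner Q (casimir f) + sphere_inner R (casimir f)"
    by (simp only: sphere_inner_commute[of "casimir f"])
  also have "\<dots> = sphere_inner Q (casimir Q) + sphere_inner Q (casimir R) + (sphere_inner R (casimir Q) + sphere_inner R (casimir R))"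
    by (simp only: cas[OF Q'] cas[OF R])
  also have "sphere_inner R (casimir Q) = 0" by (rule RS[OF casimir_polys[OF Q(1)]])
  also have "sphere_inner Q (casimir R) = 0"
    using RS[OF casimir_polys[OF Q(1)]] by (simp add: casimir_symmetric[OF Q' R] sphere_inner_commute)
  also have "sphere_inner R (casimir R) = sphere_inner R (\<lambda>x. real (Suc s) * (real (Suc s) + real CARD('n) - 2) * R x + r x)"
    unfolding sphere_inner_def by (rule Bochner_Integration.integral_cong) (simp_all only: space_sphere_measure mem_sphere_0 r(2))
  also have "\<dots> = real (Suc s) * (real (Suc s) + real CARD('n) - 2) * sphere_inner R R + sphere_inner R r"
    by (subst sphere_inner_add_right) (auto intro!: continuous_intros c polys_continuous[OF r'] simp: sphere_inner_cmul_right)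
  also have "sphere_inner R r = 0" by (rule RS[OF r'])
  finally have fA: "sphere_inner f (casimir f) = sphere_inner Q (casimir Q) +
      real (Suc s) * (real (Suc s) + real CARD('n) - 2) * sphere_inner R R" by simp
  have n1: "real CARD('n) - 1 \<ge> 0" by (simp add: Suc_leI)
  have "real CARD('n) - 1 \<le> real (Suc s) * (real (Suc s) + real CARD('n) - 2)"
  proof -
    have "0 \<le> real s * (real s + real CARD('n))"
      by simp
    then show ?thesis by (simp add: algebra_simps)
  qed
  then have "(real CARD('n) - 1) * sphere_inner R R \<le> real (Suc s) * (real (Suc s) + real CARD('n) - 2) * sphere_inner R R"
    by (intro mult_right_mono sphere_inner_self_nonneg)
  then show ?case using Suc.IH[OF Q(1) Q0] unfolding ff fA by (simp add: algebra_simps)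
qed

section \<open>The gradient controls the norm\<close>

lemma harmonic_dim_nonneg: "harmonic_dim l d \<ge> 0"
  by (simp add: harmonic_dim_def)

text \<open>
  The derivative of \<open>y \<mapsto> y / |y|\<close> at a unit vector \<open>x\<close> is the orthogonal projection along \<open>x\<close>. So the
  spherical gradient is the Euclidean gradient without its radial part.
\<close>

lemma spherical_gradient_restrict:
  fixes f :: "real ^ 'n \<Rightarrow> real"
  assumes f: "f \<in> polys_upto s" and x: "norm x = 1"
  shows "spherical_gradient (restrict_sphere f) x = (\<chi> i. partial_deriv i f x - euler f x * x $ i)"
    (is "_ = ?g")
proof -
  have "((\<lambda>y. f (y /\<^sub>R norm y)) has_derivative (\<lambda>h. \<Sum>i\<in>UNIV. partial_deriv i f x * (h - (x \<bullet> h) *\<^sub>R x) $ i)) (at x)"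
  proof -
    have proj: "((\<lambda>y. y /\<^sub>R norm y) has_derivative (\<lambda>h. h - (x \<bullet> h) *\<^sub>R x)) (at x)"
    proof -
      have x0: "x \<noteq> 0" using x by auto
      have "((\<lambda>y. inverse (norm y)) has_derivative (\<lambda>h. - (x \<bullet> h))) (at x)"
        using x0 x by (auto intro!: derivative_eq_intros has_derivative_norm[OF x0] simp: sgn_div_norm inner_commute)
      from has_derivative_scaleR[OF this has_derivative_ident]
      show ?thesis using x by (simp add: algebra_simps)
    qed
    have "x /\<^sub>R norm x = x" using x by simp
    have "(f has_derivative (\<lambda>h. \<Sum>i\<in>UNIV. partial_deriv i f x * h $ i)) (at (x /\<^sub>R norm x))"
      unfolding \<open>x /\<^sub>R norm x = x\<close> by (rule polys_has_derivative[OF f])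
    from has_derivative_compose[OF proj this] show ?thesis .
  qed
  moreover have "(\<Sum>i\<in>UNIV. partial_deriv i f x * (h - (x \<bullet> h) *\<^sub>R x) $ i) = h \<bullet> ?g" for h
  proof -
    have "(\<Sum>i\<in>UNIV. partial_deriv i f x * (h - (x \<bullet> h) *\<^sub>R x) $ i) =
        (\<Sum>i\<in>UNIV. h $ i * partial_deriv i f x) - (x \<bullet> h) * euler f x"
      by (simp add: euler_def sum_subtractf sum_distrib_left algebra_simps)
    also have "\<dots> = h \<bullet> ?g"
      by (simp add: inner_vec_def sum_subtractf sum_distrib_left sum_distrib_right algebra_simps)
    finally show ?thesis .
  qed
  ultimately have df: "((\<lambda>y. f (y /\<^sub>R norm y)) has_derivative (\<lambda>h. h \<bullet> ?g)) (at x)" by simp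
  have "((\<lambda>y. restrict_sphere f (y /\<^sub>R norm y)) has_derivative (\<lambda>h. h \<bullet> ?g)) (at x)"
  proof (rule has_derivative_transform_within_open[OF df])
    show "open (- {0 :: real ^ 'n})" by (rule open_Compl) simp
    show "x \<in> - {0}" using x by auto
  qed (simp add: restrict_sphere_def)
  then have der: "GDERIV (\<lambda>y. restrict_sphere f (y /\<^sub>R norm y)) x :> ?g"
    by (simp only: gderiv_def)
  have uniq: "g = ?g" if "GDERIV (\<lambda>y. restrict_sphere f (y /\<^sub>R norm y)) x :> g" for g
  proof -
    have "(\<lambda>h. h \<bullet> g) = (\<lambda>h. h \<bullet> ?g)"
      by (rule has_derivative_unique[OF that[unfolded gderiv_def] der[unfolded gderiv_def]])
    then have "h \<bullet> g = h \<bullet> ?g" for h by (rule fun_cong)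
    then show ?thesis using vector_eq_ldot[of g ?g] by simp
  qed
  show ?thesis unfolding spherical_gradient_def
  proof (rule the_equality)
    show "GDERIV (\<lambda>y. restrict_sphere f (y /\<^sub>R norm y)) x :> ?g" by (rule der)
  qed (rule uniq)
qed

definition tangential_gradient :: "(real ^ 'n \<Rightarrow> real) \<Rightarrow> real ^ 'n \<Rightarrow> real ^ 'n"
  where "tangential_gradient f x = (\<chi> i. partial_deriv i f x - euler f x * x $ i)"

lemma tangential_gradient_component:
  "f \<in> polys_upto s \<Longrightarrow> (\<lambda>x. tangential_gradient f x $ i) \<in> polys_upto (Suc s)"
proof -
  assume f: "f \<in> polys_upto s"
  have "partial_deriv i f \<in> polys_upto (Suc s)"
    by (rule subsetD[OF polys_mono subsetD[OF polys_below_subset polys_partial_deriv[OF f]]]) simp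
  moreover have "(\<lambda>x. x $ i * euler f x) \<in> polys_upto (Suc s)"
    by (intro polys_coord_mult euler_polys f)
  ultimately have "(\<lambda>x. partial_deriv i f x - x $ i * euler f x) \<in> polys_upto (Suc s)" by (rule polys_diff)
  then show ?thesis by (simp add: tangential_gradient_def mult.commute)
qed

lemma continuous_tangential_gradient:
  assumes "f \<in> polys_upto s"
  shows "continuous_on S (tangential_gradient f)"
proof -
  have "continuous_on S (\<lambda>x. \<chi> i. tangential_gradient f x $ i)"
    by (intro continuous_on_vec_lambda polys_continuous[OF tangential_gradient_component[OF assms]])
  then show ?thesis by simp
qed

text \<open>
  Lagrange's identity for the vectors \<open>x\<close> and \<open>\<nabla>f x\<close>: the sum over all pairs of indices counts every
  square twice.
\<close>

lemma norm_tangential_gradient: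
  fixes f :: "real ^ 'n \<Rightarrow> real"
  assumes x: "norm x = 1"
  shows "(norm (tangential_gradient f x))\<^sup>2 = (\<Sum>i\<in>UNIV. \<Sum>j\<in>UNIV. (rot_deriv i j f x)\<^sup>2) / 2"
proof -
  define a where "a i = partial_deriv i f x" for i
  define e where "e = euler f x"
  have e: "(\<Sum>i\<in>UNIV. x $ i * a i) = e" by (simp add: e_def a_def euler_def)
  have x2: "(\<Sum>i\<in>UNIV. x $ i * x $ i) = 1"
    using x by (simp add: norm_eq_1 inner_vec_def)
  have "(norm (tangential_gradient f x))\<^sup>2 = (\<Sum>i\<in>UNIV. (a i - e * x $ i) * (a i - e * x $ i))"
    by (simp add: tangential_gradient_def power2_norm_eq_inner inner_vec_def a_def e_def)
  also have "\<dots> = (\<Sum>i\<in>UNIV. a i * a i) - 2 * e * (\<Sum>i\<in>UNIV. x $ i * a i) + e * e * (\<Sum>i\<in>UNIV. x $ i * x $ i)"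
    by (simp add: algebra_simps sum.distrib sum_subtractf sum_distrib_left)
  also have "\<dots> = (\<Sum>i\<in>UNIV. a i * a i) - e * e" by (simp add: e x2)
  finally have 1: "(norm (tangential_gradient f x))\<^sup>2 = (\<Sum>i\<in>UNIV. a i * a i) - e * e" .
  have "(\<Sum>i\<in>UNIV. \<Sum>j\<in>UNIV. (rot_deriv i j f x)\<^sup>2) =
      (\<Sum>i\<in>UNIV. \<Sum>j\<in>UNIV. (x $ i * x $ i) * (a j * a j)) + (\<Sum>i\<in>UNIV. \<Sum>j\<in>UNIV. (a i * a i) * (x $ j * x $ j))
        - 2 * (\<Sum>i\<in>UNIV. \<Sum>j\<in>UNIV. (x $ i * a i) * (x $ j * a j))"
    by (simp add: rot_deriv_def a_def power2_eq_square algebra_simps sum.distrib sum_subtractf sum_distrib_left)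
  also have "\<dots> = 2 * (\<Sum>i\<in>UNIV. a i * a i) - 2 * (e * e)"
    unfolding sum_product[symmetric] by (simp add: e x2)
  finally show ?thesis using 1 by simp
qed

lemma dirichlet_energy:
  fixes f :: "real ^ 'n \<Rightarrow> real"
  assumes f: "f \<in> polys_upto s"
  shows "(LINT x|sphere_measure. (norm (tangential_gradient f x))\<^sup>2) = sphere_inner f (casimir f)"
proof -
  have c: "continuous_on (sphere 0 1) (\<lambda>x. rot_deriv i j f x * rot_deriv i j f x)" for i j
    by (intro continuous_intros polys_continuous[OF rot_deriv_polys[OF f]])
  have "(LINT x|sphere_measure. (norm (tangential_gradient f x))\<^sup>2) =
      (LINT x|sphere_measure. (\<Sum>i\<in>UNIV. \<Sum>j\<in>UNIV. rot_deriv i j f x * rot_deriv i j f x) / 2)"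
    by (rule Bochner_Integration.integral_cong[OF refl]) (simp add: norm_tangential_gradient flip: power2_eq_square)
  also have "\<dots> = (LINT x|sphere_measure. (\<Sum>i\<in>UNIV. \<Sum>j\<in>UNIV. rot_deriv i j f x * rot_deriv i j f x)) / 2"
    by (rule integral_divide_zero)
  also have "(LINT x|sphere_measure. (\<Sum>i\<in>UNIV. \<Sum>j\<in>UNIV. rot_deriv i j f x * rot_deriv i j f x)) =
      (\<Sum>i\<in>UNIV. LINT x|sphere_measure. (\<Sum>j\<in>UNIV. rot_deriv i j f x * rot_deriv i j f x))"
    by (intro Bochner_Integration.integral_sum sphere_integrable continuous_on_sum c)
  also have "\<dots> = (\<Sum>i\<in>UNIV. \<Sum>j\<in>UNIV. sphere_inner (rot_deriv i j f) (rot_deriv i j f))"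
    unfolding sphere_inner_def
    by (intro sum.cong refl Bochner_Integration.integral_sum sphere_integrable c)
  finally show ?thesis by (simp add: sphere_inner_casimir[OF f f])
qed

text \<open>
  Let \<open>K\<close> be the reproducing kernel of the polynomials of degree at most \<open>s + 1\<close>, so that \<open>f x\<close> is the
  integral of \<open>f y * K y x\<close> over \<open>y\<close>. By the addition theorem the diagonal of \<open>K\<close> is the dimension of the
  space, and by the Cauchy-Schwarz inequality \<open>K\<close> is nowhere larger than on its diagonal.
\<close>

lemma nikolskii_scalar:
  fixes f :: "real ^ 'n \<Rightarrow> real"
  assumes f: "f \<in> polys_upto (Suc s)" and x: "norm x = 1"
  shows "\<bar>f x\<bar> \<le> harmonic_dim (Suc s) CARD('n) * (LINT y|sphere_measure. \<bar>f y\<bar>)"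
proof -
  obtain B :: "(real ^ 'n \<Rightarrow> real) set" where B: "orthonormal B" "span B = sphere_polys (Suc s)"
    by (rule sphere_polys_basis)
  define m where "m = real (card B)"
  have m: "m \<le> harmonic_dim (Suc s) CARD('n)" "m \<ge> 0"
    using dim_sphere_polys_le[of s, where 'n = 'n] orthonormal_dim[OF B(1)] B(2) by (simp_all add: m_def)
  have fin: "finite B" and sub: "B \<subseteq> sphere_functions" using B(1) by (auto simp: orthonormal_def)
  have add: "(\<Sum>b\<in>B. (b y)\<^sup>2) = m" if "norm y = 1" for y
    unfolding m_def by (rule addition_theorem[OF B(1) _ that]) (simp add: B(2) sphere_polys_orthogonal)
  define F where "F = restrict_sphere f"
  have F: "F \<in> span B" using f B(2) by (auto simp: F_def sphere_polys_def)
  have cf: "continuous_on (sphere 0 1) f" by (rule polys_continuous[OF f])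
  define K where "K y = (\<Sum>b\<in>B. b y * b x)" for y
  have cb: "continuous_on (sphere 0 1) b" if "b \<in> B" for b
    using sub that by (intro sphere_functions_continuous) auto
  have cK: "continuous_on (sphere 0 1) K"
    unfolding K_def[abs_def] by (intro continuous_intros cb)
  have K: "\<bar>K y\<bar> \<le> m" if "norm y = 1" for y
  proof -
    have "(K y)\<^sup>2 \<le> (\<Sum>b\<in>B. (b y)\<^sup>2) * (\<Sum>b\<in>B. (b x)\<^sup>2)"
      unfolding K_def by (rule Cauchy_Schwarz_ineq_sum)
    also have "\<dots> = m\<^sup>2" unfolding add[OF that] add[OF x] by (rule power2_eq_square[symmetric])
    finally show ?thesis using m(2) by (simp add: abs_le_square_iff[symmetric])
  qed
  have "f x = F x" using x by (simp add: F_def restrict_sphere_def)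
  also have "\<dots> = (\<Sum>b\<in>B. sphere_inner F b * b x)" by (rule orthonormal_expansion_apply[OF B(1) F])
  also have "\<dots> = (\<Sum>b\<in>B. LINT y|sphere_measure. f y * b y * b x)"
  proof (rule sum.cong[OF refl])
    fix b
    have "sphere_inner F b = (LINT y|sphere_measure. f y * b y)"
      unfolding sphere_inner_def F_def
      by (rule Bochner_Integration.integral_cong) (simp_all add: restrict_sphere_def)
    then show "sphere_inner F b * b x = (LINT y|sphere_measure. f y * b y * b x)" by simp
  qed
  also have "\<dots> = (LINT y|sphere_measure. (\<Sum>b\<in>B. f y * b y * b x))"
    by (intro Bochner_Integration.integral_sum[symmetric] sphere_integrable continuous_intros cf cb)
  also have "\<dots> = (LINT y|sphere_measure. f y * K y)"
    by (simp add: K_def sum_distrib_left mult.assoc)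
  finally have "\<bar>f x\<bar> = \<bar>LINT y|sphere_measure. f y * K y\<bar>" by simp
  also have "\<dots> \<le> (LINT y|sphere_measure. \<bar>f y * K y\<bar>)" by (rule integral_abs_bound)
  also have "\<dots> \<le> (LINT y|sphere_measure. m * \<bar>f y\<bar>)"
  proof (rule integral_mono)
    show "integrable sphere_measure (\<lambda>y. \<bar>f y * K y\<bar>)" "integrable sphere_measure (\<lambda>y. m * \<bar>f y\<bar>)"
      by (intro sphere_integrable continuous_intros cf cK)+
    fix y :: "real ^ 'n" assume "y \<in> space sphere_measure"
    then have "\<bar>K y\<bar> \<le> m" by (intro K) simp
    then show "\<bar>f y * K y\<bar> \<le> m * \<bar>f y\<bar>" using mult_right_mono[of "\<bar>K y\<bar>" m "\<bar>f y\<bar>"] by (simp add: abs_mult mult.commute)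
  qed
  also have "\<dots> = m * (LINT y|sphere_measure. \<bar>f y\<bar>)" by simp
  also have "\<dots> \<le> harmonic_dim (Suc s) CARD('n) * (LINT y|sphere_measure. \<bar>f y\<bar>)"
    by (intro mult_right_mono m) simp
  finally show ?thesis .
qed

text \<open>
  The scalar inequality for the component of \<open>G\<close> in the direction of \<open>G x\<close>.
\<close>

lemma nikolskii_vector:
  fixes G :: "real ^ 'n \<Rightarrow> real ^ 'm"
  assumes G: "\<And>i. (\<lambda>x. G x $ i) \<in> polys_upto (Suc s)" and x: "norm x = 1"
  shows "norm (G x) \<le> harmonic_dim (Suc s) CARD('n) * (LINT y|sphere_measure. norm (G y))"
proof (cases "G x = 0")
  case True
  then show ?thesis by (simp add: harmonic_dim_nonneg)
next
  case False
  define w where "w = G x"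
  have cG: "continuous_on (sphere 0 1) G"
  proof -
    have "continuous_on (sphere 0 1) (\<lambda>x. \<chi> i. G x $ i)"
      by (intro continuous_on_vec_lambda polys_continuous[OF G])
    then show ?thesis by simp
  qed
  have h: "(\<lambda>y. w \<bullet> G y) \<in> polys_upto (Suc s)"
    unfolding inner_vec_def by (simp, intro polys_sum polys_cmul G)
  have "norm w * norm w = \<bar>w \<bullet> G x\<bar>"
    by (simp add: w_def power2_norm_eq_inner[symmetric] power2_eq_square)
  also have "\<dots> \<le> harmonic_dim (Suc s) CARD('n) * (LINT y|sphere_measure. \<bar>w \<bullet> G y\<bar>)"
    by (rule nikolskii_scalar[OF h x])
  also have "\<dots> \<le> harmonic_dim (Suc s) CARD('n) * (LINT y|sphere_measure. norm w * norm (G y))"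
    by (intro mult_left_mono integral_mono harmonic_dim_nonneg sphere_integrable continuous_intros cG)
      (rule Cauchy_Schwarz_ineq2)
  also have "\<dots> = norm w * (harmonic_dim (Suc s) CARD('n) * (LINT y|sphere_measure. norm (G y)))"
    by simp
  finally show ?thesis using False by (simp add: w_def)
qed

lemma norm_le_gradient:
  fixes f :: "real ^ 'n \<Rightarrow> real"
  assumes f: "f \<in> polys_upto s" and 0: "(LINT x|sphere_measure. f x) = 0"
  shows "(real CARD('n) - 1) * sphere_inner f f \<le>
    harmonic_dim (Suc s) CARD('n) * (LINT x|sphere_measure. norm (tangential_gradient f x))\<^sup>2"
proof -
  define m where "m = harmonic_dim (Suc s) CARD('n)"
  define q where "q = (LINT x|sphere_measure. norm (tangential_gradient f x))"
  have c: "continuous_on (sphere 0 1) (tangential_gradient f)" by (rule continuous_tangential_gradient[OF f])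
  have "(real CARD('n) - 1) * sphere_inner f f \<le> (LINT x|sphere_measure. (norm (tangential_gradient f x))\<^sup>2)"
    using poincare_inequality[OF f 0] by (simp only: dirichlet_energy[OF f])
  also have "\<dots> \<le> (LINT x|sphere_measure. (m * q) * norm (tangential_gradient f x))"
  proof (rule integral_mono)
    fix x :: "real ^ 'n" assume "x \<in> space sphere_measure"
    then have "norm (tangential_gradient f x) \<le> m * q"
      unfolding m_def q_def by (intro nikolskii_vector tangential_gradient_component[OF f]) simp
    then show "(norm (tangential_gradient f x))\<^sup>2 \<le> (m * q) * norm (tangential_gradient f x)"
      by (simp add: power2_eq_square mult_right_mono)
  qed (intro sphere_integrable continuous_intros c)+
  also have "\<dots> = m * q\<^sup>2" by (simp add: q_def power2_eq_square)
  finally show ?thesis by (simp add: m_def q_def)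
qed

section \<open>Point sums and spherical designs\<close>

definition gradient_norm :: "(real ^ 'n \<Rightarrow> real) \<Rightarrow> real"
  where "gradient_norm f = (LINT x|sphere_measure. norm (spherical_gradient f x))"

lemma gradient_norm_restrict:
  assumes "f \<in> polys_upto s"
  shows "gradient_norm (restrict_sphere f) = (LINT x|sphere_measure. norm (tangential_gradient f x))"
  unfolding gradient_norm_def
  by (rule Bochner_Integration.integral_cong)
    (simp_all add: spherical_gradient_restrict[OF assms] tangential_gradient_def)

lemma tangential_gradient_add:
  assumes "f \<in> polys_upto s" "g \<in> polys_upto s"
  shows "tangential_gradient (\<lambda>x. f x + g x) x = tangential_gradient f x + tangential_gradient g x"
  by (simp add: tangential_gradient_def vec_eq_iff euler_def partial_deriv_add[OF assms] algebra_simps sum.distrib)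

lemma tangential_gradient_cmul:
  assumes "f \<in> polys_upto s"
  shows "tangential_gradient (\<lambda>x. c * f x) x = c *\<^sub>R tangential_gradient f x"
  by (simp add: tangential_gradient_def vec_eq_iff euler_def partial_deriv_cmul[OF assms] algebra_simps sum_distrib_left)

lemma gradient_norm_add_le:
  assumes f: "f \<in> sphere_polys s" and g: "g \<in> sphere_polys s"
  shows "gradient_norm (f + g) \<le> gradient_norm f + gradient_norm g"
proof -
  obtain p q where p: "p \<in> polys_upto s" "f = restrict_sphere p" and q: "q \<in> polys_upto s" "g = restrict_sphere q"
    using f g by (auto simp: sphere_polys_def)
  note c = continuous_tangential_gradient[OF p(1)] continuous_tangential_gradient[OF q(1)]
  have pq: "(\<lambda>x. p x + q x) \<in> polys_upto s" by (rule polys_add[OF p(1) q(1)])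
  have "f + g = restrict_sphere (\<lambda>x. p x + q x)"
    by (auto simp: p(2) q(2) restrict_sphere_def fun_eq_iff)
  then have "gradient_norm (f + g) = (LINT x|sphere_measure. norm (tangential_gradient p x + tangential_gradient q x))"
    by (simp only: gradient_norm_restrict[OF pq] tangential_gradient_add[OF p(1) q(1)])
  also have "\<dots> \<le> (LINT x|sphere_measure. norm (tangential_gradient p x) + norm (tangential_gradient q x))"
    by (intro integral_mono sphere_integrable continuous_intros c norm_triangle_ineq)
  also have "\<dots> = (LINT x|sphere_measure. norm (tangential_gradient p x)) + (LINT x|sphere_measure. norm (tangential_gradient q x))"
    by (intro Bochner_Integration.integral_add sphere_integrable continuous_intros c)
  finally show ?thesis
    by (simp only: p(2) q(2) gradient_norm_restrict[OF p(1)] gradient_norm_restrict[OF q(1)])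
qed

lemma gradient_norm_scale:
  assumes f: "f \<in> sphere_polys s"
  shows "gradient_norm (a *\<^sub>R f) = \<bar>a\<bar> * gradient_norm f"
proof -
  obtain p where p: "p \<in> polys_upto s" "f = restrict_sphere p"
    using f by (auto simp: sphere_polys_def)
  have "a *\<^sub>R f = restrict_sphere (\<lambda>x. a * p x)"
    by (auto simp: p(2) restrict_sphere_def fun_eq_iff scaleR_fun_def)
  then have "gradient_norm (a *\<^sub>R f) = (LINT x|sphere_measure. norm (a *\<^sub>R tangential_gradient p x))"
    by (simp only: gradient_norm_restrict[OF polys_cmul[OF p(1)]] tangential_gradient_cmul[OF p(1)])
  then show ?thesis by (simp add: p(2) gradient_norm_restrict[OF p(1)])
qed

lemma gradient_norm_nonneg: "gradient_norm f \<ge> 0"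
  by (simp add: gradient_norm_def)

lemma gradient_norm_sum_le:
  assumes "finite B" "B \<subseteq> sphere_polys s"
  shows "gradient_norm (\<Sum>b\<in>B. c b *\<^sub>R b) \<le> (\<Sum>b\<in>B. \<bar>c b\<bar> * gradient_norm b)"
  using assms
proof (induction rule: finite_induct)
  case empty
  have "gradient_norm (0 *\<^sub>R (0 :: real ^ 'a \<Rightarrow> real)) = \<bar>0\<bar> * gradient_norm (0 :: real ^ 'a \<Rightarrow> real)"
    by (rule gradient_norm_scale[OF subspace_0[OF subspace_sphere_polys, of s]])
  then show ?case by (simp only: sum.empty scaleR_zero_left abs_zero mult_zero_left order_refl)
next
  case (insert b B)
  have b: "b \<in> sphere_polys s" using insert.prems by simp
  have "(\<Sum>b\<in>B. c b *\<^sub>R b) \<in> sphere_polys s"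
    using insert.prems by (intro subspace_sum[OF subspace_sphere_polys] subspace_scale[OF subspace_sphere_polys]) auto
  from gradient_norm_add_le[OF subspace_scale[OF subspace_sphere_polys b, of "c b"] this]
  have "gradient_norm (\<Sum>b\<in>insert b B. c b *\<^sub>R b) \<le> \<bar>c b\<bar> * gradient_norm b + gradient_norm (\<Sum>b\<in>B. c b *\<^sub>R b)"
    by (simp only: sum.insert[OF insert.hyps] gradient_norm_scale[OF b])
  also have "\<dots> \<le> \<bar>c b\<bar> * gradient_norm b + (\<Sum>b\<in>B. \<bar>c b\<bar> * gradient_norm b)"
    using insert.IH insert.prems by simp
  also have "\<dots> = (\<Sum>b\<in>insert b B. \<bar>c b\<bar> * gradient_norm b)"
    by (rule sum.insert[OF insert.hyps, symmetric])
  finally show ?case .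
qed

lemma gradient_norm_lower:
  fixes f :: "real ^ 'n \<Rightarrow> real"
  assumes "f \<in> mean_zero_polys t"
  shows "(real CARD('n) - 1) * sphere_inner f f \<le> harmonic_dim (Suc t) CARD('n) * (gradient_norm f)\<^sup>2"
proof -
  obtain p where p: "p \<in> polys_upto t" "f = restrict_sphere p" "(LINT x|sphere_measure. p x) = 0"
    using assms by (auto simp: mean_zero_polys_def)
  show ?thesis
    unfolding p(2) sphere_inner_restrict gradient_norm_restrict[OF p(1)]
    by (rule norm_le_gradient[OF p(1,3)])
qed

lemma sum_mset_abs_le:
  fixes f :: "'a \<Rightarrow> real"
  shows "(\<And>y. y \<in># Y \<Longrightarrow> \<bar>f y\<bar> \<le> c) \<Longrightarrow> \<bar>\<Sum>y\<in>#Y. f y\<bar> \<le> real (size Y) * c"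
proof (induction Y)
  case (add y Y)
  have "\<bar>f y\<bar> \<le> c" "\<bar>\<Sum>y\<in>#Y. f y\<bar> \<le> real (size Y) * c" using add by auto
  then show ?case by (simp add: algebra_simps)
qed simp

lemma sum_mset_sum_swap:
  fixes g :: "'b \<Rightarrow> 'a \<Rightarrow> real"
  shows "(\<Sum>y\<in>#Y. \<Sum>b\<in>B. g b y) = (\<Sum>b\<in>B. \<Sum>y\<in>#Y. g b y)"
  by (induction Y) (simp_all add: sum.distrib)

text \<open>
  Expand \<open>Q\<close> in an orthonormal basis \<open>B2\<close> of the larger space that extends a basis \<open>B1\<close> of the smaller one.
  The part in the smaller space sums to zero over \<open>Y\<close>. The rest is bounded at each point by the
  Cauchy-Schwarz inequality, where the squares of the functions in \<open>B2 - B1\<close> add up to the difference of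
  the dimensions by the addition theorem for both spaces.
\<close>

lemma point_sum_le:
  fixes Y :: "(real ^ 'n) multiset"
  assumes t: "t1 \<le> t" and Y: "set_mset Y \<subseteq> sphere 0 1"
    and orth: "\<And>S. S \<in> mean_zero_polys t1 \<Longrightarrow> (\<Sum>y\<in>#Y. S y) = 0"
    and Q: "Q \<in> mean_zero_polys t"
  shows "\<bar>\<Sum>y\<in>#Y. Q y\<bar> \<le> real (size Y) *
    (sqrt (real (dim (mean_zero_polys t :: (real ^ 'n \<Rightarrow> real) set)) - real (dim (mean_zero_polys t1 :: (real ^ 'n \<Rightarrow> real) set)))
      * sqrt (sphere_inner Q Q))"
proof -
  obtain B1 :: "(real ^ 'n \<Rightarrow> real) set" where B1: "orthonormal B1" "span B1 = mean_zero_polys t1"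
    by (rule mean_zero_basis_extension[OF orthonormal_empty empty_subsetI])
  have "B1 \<subseteq> mean_zero_polys t"
    using span_superset[of B1] B1(2) mean_zero_polys_mono[OF t] by blast
  then obtain B2 where B2: "B1 \<subseteq> B2" "orthonormal B2" "span B2 = mean_zero_polys t"
    by (rule mean_zero_basis_extension[OF B1(1)])
  have fin: "finite B2" "finite B1" using B1(1) B2(2) by (simp_all add: orthonormal_def)
  define S where "S = (\<Sum>b\<in>B1. sphere_inner Q b *\<^sub>R b)"
  define W where "W y = (\<Sum>b\<in>B2 - B1. sphere_inner Q b * b y)" for y
  have S: "S \<in> mean_zero_polys t1"
    unfolding S_def B1(2)[symmetric] by (intro span_sum span_scale span_base)
  have Qy: "Q y = S y + W y" for y
  proof -
    have "Q y = (\<Sum>b\<in>B2. sphere_inner Q b * b y)"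
      by (rule orthonormal_expansion_apply[OF B2(2)]) (simp add: B2(3) Q)
    also have "\<dots> = W y + (\<Sum>b\<in>B1. sphere_inner Q b * b y)"
      unfolding W_def by (rule sum.subset_diff[OF B2(1) fin(1)])
    finally show ?thesis by (simp add: S_def sum_fun_apply scaleR_fun_def)
  qed
  have W: "\<bar>W y\<bar> \<le> sqrt (real (dim (mean_zero_polys t :: (real ^ 'n \<Rightarrow> real) set)) - real (dim (mean_zero_polys t1 :: (real ^ 'n \<Rightarrow> real) set)))
      * sqrt (sphere_inner Q Q)" if "norm y = 1" for y
  proof -
    have "(\<Sum>b\<in>B1. (b y)\<^sup>2) = real (card B1)"
      by (rule addition_theorem[OF B1(1) _ that]) (simp add: B1(2) mean_zero_polys_orthogonal)
    moreover have "(\<Sum>b\<in>B2. (b y)\<^sup>2) = real (card B2)"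
      by (rule addition_theorem[OF B2(2) _ that]) (simp add: B2(3) mean_zero_polys_orthogonal)
    moreover have "(\<Sum>b\<in>B2. (b y)\<^sup>2) = (\<Sum>b\<in>B2 - B1. (b y)\<^sup>2) + (\<Sum>b\<in>B1. (b y)\<^sup>2)"
      by (rule sum.subset_diff[OF B2(1) fin(1)])
    ultimately have by2: "(\<Sum>b\<in>B2 - B1. (b y)\<^sup>2) =
        real (dim (mean_zero_polys t :: (real ^ 'n \<Rightarrow> real) set)) - real (dim (mean_zero_polys t1 :: (real ^ 'n \<Rightarrow> real) set))"
      using orthonormal_dim[OF B1(1)] orthonormal_dim[OF B2(2)] by (simp add: B1(2) B2(3))
    have "(\<Sum>b\<in>B2 - B1. (sphere_inner Q b)\<^sup>2) \<le> (\<Sum>b\<in>B2. (sphere_inner Q b)\<^sup>2)"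
      by (intro sum_mono2 fin) auto
    also have "\<dots> = sphere_inner Q Q" by (rule parseval[OF B2(2), symmetric]) (simp add: B2(3) Q)
    finally have "(W y)\<^sup>2 \<le> sphere_inner Q Q * (\<Sum>b\<in>B2 - B1. (b y)\<^sup>2)"
      unfolding W_def by (intro order.trans[OF Cauchy_Schwarz_ineq_sum] mult_right_mono sum_nonneg) auto
    then have "\<bar>W y\<bar> \<le> sqrt (sphere_inner Q Q * (\<Sum>b\<in>B2 - B1. (b y)\<^sup>2))"
      using real_le_rsqrt by (simp add: abs_le_iff real_le_rsqrt)
    then show ?thesis by (simp only: by2 real_sqrt_mult mult.commute)
  qed
  have "(\<Sum>y\<in>#Y. Q y) = (\<Sum>y\<in>#Y. S y) + (\<Sum>y\<in>#Y. W y)"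
    unfolding Qy by (rule sum_mset.distrib)
  also have "(\<Sum>y\<in>#Y. S y) = 0" by (rule orth[OF S])
  finally have QW: "(\<Sum>y\<in>#Y. Q y) = (\<Sum>y\<in>#Y. W y)" by simp
  have "norm y = 1" if "y \<in># Y" for y using Y that by auto
  then show ?thesis unfolding QW by (intro sum_mset_abs_le W)
qed

lemma sum_mset_eq_on_sphere:
  assumes "set_mset Z \<subseteq> sphere 0 1"
  shows "(\<Sum>z\<in>#Z. restrict_sphere P z) = (\<Sum>z\<in>#Z. P z)"
  using assms by (intro arg_cong[where f = sum_mset] image_mset_cong) (auto simp: restrict_sphere_def)

text \<open>
  Subtracting its mean from a polynomial makes it mean zero.
\<close>

lemma spherical_design_iff:
  "spherical_design s Z \<longleftrightarrow> Z \<noteq> {#} \<and> set_mset Z \<subseteq> sphere 0 1 \<and> (\<forall>f\<in>mean_zero_polys s. (\<Sum>z\<in>#Z. f z) = 0)"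
proof (cases "Z \<noteq> {#} \<and> set_mset Z \<subseteq> sphere 0 1")
  case True
  have size: "real (size Z) > 0" using True by (simp add: nonempty_has_size)
  show ?thesis
  proof (intro iffI)
    assume des: "spherical_design s Z"
    have "(\<Sum>z\<in>#Z. f z) = 0" if "f \<in> mean_zero_polys s" for f
    proof -
      obtain P where P: "P \<in> polys_upto s" "f = restrict_sphere P" "(LINT x|sphere_measure. P x) = 0"
        using \<open>f \<in> mean_zero_polys s\<close> by (auto simp: mean_zero_polys_def)
      then have "0 = 1 / real (size Z) * (\<Sum>z\<in>#Z. P z)" using des by (simp add: spherical_design_def)
      then have "(\<Sum>z\<in>#Z. P z) = 0" using True by simp
      then show ?thesis using True by (simp add: P(2) sum_mset_eq_on_sphere)
    qed
    then show "Z \<noteq> {#} \<and> set_mset Z \<subseteq> sphere 0 1 \<and> (\<forall>f\<in>mean_zero_polys s. (\<Sum>z\<in>#Z. f z) = 0)"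
      using True by blast
  next
    assume "Z \<noteq> {#} \<and> set_mset Z \<subseteq> sphere 0 1 \<and> (\<forall>f\<in>mean_zero_polys s. (\<Sum>z\<in>#Z. f z) = 0)"
    then have zero: "\<And>f. f \<in> mean_zero_polys s \<Longrightarrow> (\<Sum>z\<in>#Z. f z) = 0" by blast
    have "(LINT x|sphere_measure. P x) = 1 / real (size Z) * (\<Sum>z\<in>#Z. P z)" if P: "P \<in> polys_upto s" for P
    proof -
      define c where "c = (LINT x|sphere_measure. P x)"
      have "(LINT x|sphere_measure. P x - c) = c - (LINT x|(sphere_measure :: (real ^ 'a) measure). c)"
        unfolding c_def by (intro Bochner_Integration.integral_diff sphere_integrable polys_continuous[OF P] continuous_intros)
      also have "\<dots> = 0" by (simp only: sphere_integral_const)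
      finally have "restrict_sphere (\<lambda>x. P x - c) \<in> mean_zero_polys s"
        unfolding mean_zero_polys_def using polys_diff[OF P polys_const] by blast
      from zero[OF this] have "(\<Sum>z\<in>#Z. P z - c) = 0" using True by (simp add: sum_mset_eq_on_sphere)
      moreover have "(\<Sum>z\<in>#Z. P z - c) = (\<Sum>z\<in>#Z. P z) - real (size Z) * c"
        by (induction Z) (simp_all add: algebra_simps)
      ultimately show ?thesis using True by (simp add: c_def[symmetric] field_simps)
    qed
    then show "spherical_design s Z" using True by (simp add: spherical_design_def)
  qed
qed (auto simp: spherical_design_def)


section \<open>Extending a point set to a design\<close>

text \<open>
  A sequence of coefficients \<open>c\<close> stands for \<open>P c \<in> V\<close>, and \<open>u c\<close> is its radial retraction to the unit ball of
  \<open>gradient_norm\<close>. The field \<open>h\<close> has the coordinates of the functional \<open>T (u c)\<close> as its components, so the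
  inner product of \<open>c\<close> and \<open>h c\<close> is \<open>T (u c) (P c)\<close>. If \<open>gradient_norm (P c) \<ge> 1\<close>, then \<open>P c\<close> is a positive
  multiple of \<open>u c\<close>, which has \<open>gradient_norm\<close> one, and the product is positive by assumption. At a zero of
  \<open>h\<close>, the functional vanishes on \<open>V\<close>, which is the design property.
\<close>

lemma design_extension:
  fixes Y :: "(real ^ 'n) multiset" and F :: "(real ^ 'n \<Rightarrow> real) \<Rightarrow> nat \<Rightarrow> real ^ 'n"
  assumes N: "N > 0" and n2: "CARD('n) \<ge> 2" and Y: "set_mset Y \<subseteq> sphere 0 1"
    and F: "F \<in> mean_zero_polys t \<rightarrow> ({1..N} \<rightarrow>\<^sub>E sphere 0 1)"
    and cont: "continuous_on (mean_zero_polys t) F"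
    and pos: "\<And>Q. Q \<in> mean_zero_polys t \<Longrightarrow> gradient_norm Q = 1 \<Longrightarrow>
      (\<Sum>j = 1..N. Q (F Q j)) + (\<Sum>y\<in>#Y. Q y) > 0"
  shows "\<exists>X. size X = N \<and> set_mset X \<subseteq> sphere 0 1 \<and> spherical_design t (X + Y)"
proof -
  obtain B :: "(real ^ 'n \<Rightarrow> real) set" where B: "orthonormal B" "span B = mean_zero_polys t"
    by (rule mean_zero_basis_extension[OF orthonormal_empty empty_subsetI])
  have fin: "finite B" and Bf: "B \<subseteq> sphere_functions" using B(1) by (auto simp: orthonormal_def)
  have Bp: "B \<subseteq> sphere_polys t" using span_superset[of B] B(2) mean_zero_polys_subset by blast
  define n where "n = card B"
  obtain ix where ix: "bij_betw ix B {..<n}"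
    using ex_bij_betw_finite_nat[OF fin] unfolding n_def atLeast0LessThan by blast
  define e where "e = inv_into B ix"
  have e: "e i \<in> B" "ix (e i) = i" if "i < n" for i
    using that ix bij_betw_inv_into_right[OF ix, of i] bij_betwE[OF bij_betw_inv_into[OF ix]] by (auto simp: e_def)
  have eix: "e (ix b) = b" "ix b < n" if "b \<in> B" for b
    using bij_betw_inv_into_left[OF ix that] bij_betwE[OF ix] that by (auto simp: e_def)
  have cb: "continuous_on (sphere 0 1) b" if "b \<in> B" for b
    using Bf that by (intro sphere_functions_continuous) auto
  define P where "P c = (\<Sum>b\<in>B. c (ix b) *\<^sub>R b)" for c :: "nat \<Rightarrow> real"
  define u where "u c = (1 / max 1 (gradient_norm (P c))) *\<^sub>R P c" for c
  define T where "T v f = (\<Sum>j = 1..N. f (F v j)) + (\<Sum>y\<in>#Y. f y)" for v f :: "real ^ 'n \<Rightarrow> real"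
  define h where "h c i = T (u c) (e i)" for c i
  have P: "P c \<in> mean_zero_polys t" for c
    unfolding P_def B(2)[symmetric] by (intro span_sum span_scale span_base)
  have P': "P c \<in> sphere_polys t" for c using P mean_zero_polys_subset by blast
  have u: "u c \<in> mean_zero_polys t" for c
    unfolding u_def by (intro subspace_scale[OF subspace_mean_zero_polys] P)
  have T_scale: "T v (a *\<^sub>R f) = a * T v f" for v a f
    by (simp add: T_def scaleR_fun_def sum_distrib_left distrib_left sum_mset_distrib_left)
  have T_sum: "T v (\<Sum>b\<in>B. a b *\<^sub>R b) = (\<Sum>b\<in>B. a b * T v b)" for v a
  proof -
    have "(\<Sum>j = 1..N. (\<Sum>b\<in>B. a b *\<^sub>R b) (F v j)) = (\<Sum>b\<in>B. a b * (\<Sum>j = 1..N. b (F v j)))"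
      by (simp only: sum_fun_apply scaleR_fun_def sum_distrib_left real_scaleR_def) (rule sum.swap)
    moreover have "(\<Sum>y\<in>#Y. (\<Sum>b\<in>B. a b *\<^sub>R b) y) = (\<Sum>b\<in>B. a b * (\<Sum>y\<in>#Y. b y))"
      by (simp only: sum_fun_apply scaleR_fun_def sum_mset_distrib_left real_scaleR_def) (rule sum_mset_sum_swap)
    ultimately show ?thesis by (simp only: T_def sum.distrib distrib_left)
  qed
  define m where "m = harmonic_dim (Suc t) CARD('n)"
  have m: "m \<ge> 0" by (simp add: m_def harmonic_dim_nonneg)
  \<comment> \<open>Large enough for the boundary of the cube to lie outside of the unit ball of \<open>gradient_norm\<close>: there \<open>R\<^sup>2 \<le> m * (gradient_norm (P c))\<^sup>2\<close>, while \<open>m < R\<^sup>2\<close>.\<close>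
  define R where "R = 1 + m"
  have R: "R > 0" using m by (simp add: R_def)
  have big: "gradient_norm (P c) \<ge> 1" if i: "i < n" and c: "\<bar>c i\<bar> = R" for c i
  proof (rule ccontr)
    assume "\<not> gradient_norm (P c) \<ge> 1"
    then have "(gradient_norm (P c))\<^sup>2 \<le> 1" using gradient_norm_nonneg[of "P c"] by (simp add: power_le_one)
    then have "m * (gradient_norm (P c))\<^sup>2 \<le> m" using m by (simp add: mult_left_le)
    moreover have "sphere_inner (P c) (P c) \<le> (real CARD('n) - 1) * sphere_inner (P c) (P c)"
      using n2 sphere_inner_self_nonneg[of "P c"] mult_right_mono[of 1 "real CARD('n) - 1" "sphere_inner (P c) (P c)"]
      by simp
    moreover have "R\<^sup>2 \<le> sphere_inner (P c) (P c)"
    proof -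
      have "sphere_inner (P c) (e i) = c i"
        unfolding P_def sphere_inner_orthonormal_sum[OF B(1) e(1)[OF i]] by (simp add: e(2)[OF i])
      then have "R\<^sup>2 = (sphere_inner (P c) (e i))\<^sup>2" using c by (metis power2_abs)
      also have "\<dots> \<le> (\<Sum>b\<in>B. (sphere_inner (P c) b)\<^sup>2)"
        by (rule member_le_sum[OF e(1)[OF i]]) (auto simp: fin)
      also have "\<dots> = sphere_inner (P c) (P c)"
        by (rule parseval[OF B(1), symmetric]) (simp add: B(2) P)
      finally show ?thesis .
    qed
    ultimately have "R\<^sup>2 \<le> m" using gradient_norm_lower[OF P[of c]] unfolding m_def by linarith
    moreover have "m < R\<^sup>2" using m by (simp add: R_def power2_eq_square algebra_simps add_pos_nonneg)
    ultimately show False by simp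
  qed
  have coord: "continuous_on S (\<lambda>c :: nat \<Rightarrow> real. c i)" for S i
    by (rule continuous_on_subset[OF continuous_on_product_coordinates subset_UNIV])
  have cq: "continuous_on S (\<lambda>c. gradient_norm (P c))" for S
    unfolding continuous_on_def
  proof
    fix c0
    \<comment> \<open>A seminorm on a finite-dimensional space is Lipschitz in the coordinates.\<close>
    have diff: "\<bar>gradient_norm (P c) - gradient_norm (P c0)\<bar> \<le> (\<Sum>b\<in>B. \<bar>c (ix b) - c0 (ix b)\<bar> * gradient_norm b)" for c
    proof -
      define d where "d = (\<Sum>b\<in>B. (c (ix b) - c0 (ix b)) *\<^sub>R b)"
      have d: "d \<in> sphere_polys t"
        unfolding d_def using Bp by (intro subspace_sum[OF subspace_sphere_polys] subspace_scale[OF subspace_sphere_polys]) auto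
      have dP: "d = P c - P c0" by (simp add: d_def P_def scaleR_left_diff_distrib sum_subtractf)
      have "gradient_norm (P c0 + d) \<le> gradient_norm (P c0) + gradient_norm d"
        by (rule gradient_norm_add_le[OF P' d])
      moreover have "gradient_norm (P c + (- 1) *\<^sub>R d) \<le> gradient_norm (P c) + gradient_norm ((- 1) *\<^sub>R d)"
        by (rule gradient_norm_add_le[OF P' subspace_scale[OF subspace_sphere_polys d]])
      moreover have "P c0 + d = P c" "P c + (- 1) *\<^sub>R d = P c0" by (simp_all add: dP)
      moreover have "gradient_norm ((- 1) *\<^sub>R d) = gradient_norm d"
        using gradient_norm_scale[OF d, of "- 1"] by simp
      moreover have "gradient_norm d \<le> (\<Sum>b\<in>B. \<bar>c (ix b) - c0 (ix b)\<bar> * gradient_norm b)"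
        unfolding d_def by (rule gradient_norm_sum_le[OF fin Bp])
      ultimately show ?thesis by (simp add: abs_le_iff)
    qed
    have "continuous_on UNIV (\<lambda>c. \<Sum>b\<in>B. \<bar>c (ix b) - c0 (ix b)\<bar> * gradient_norm b)"
      by (intro continuous_intros coord)
    then have "((\<lambda>c. \<Sum>b\<in>B. \<bar>c (ix b) - c0 (ix b)\<bar> * gradient_norm b) \<longlongrightarrow>
        (\<Sum>b\<in>B. \<bar>c0 (ix b) - c0 (ix b)\<bar> * gradient_norm b)) (at c0)"
      unfolding continuous_on_def by blast
    then have "((\<lambda>c. \<Sum>b\<in>B. \<bar>c (ix b) - c0 (ix b)\<bar> * gradient_norm b) \<longlongrightarrow> 0) (at c0)" by simp
    then have "((\<lambda>c. gradient_norm (P c) - gradient_norm (P c0)) \<longlongrightarrow> 0) (at c0)"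
      by (rule Lim_null_comparison[rotated]) (simp add: diff)
    then have "((\<lambda>c. gradient_norm (P c)) \<longlongrightarrow> gradient_norm (P c0)) (at c0)"
      by (simp add: LIM_zero_iff)
    then show "((\<lambda>c. gradient_norm (P c)) \<longlongrightarrow> gradient_norm (P c0)) (at c0 within S)"
      by (rule tendsto_within_subset) simp
  qed
  have cu: "continuous_on S u" for S
  proof (rule continuous_on_coordinatewise_then_product)
    fix x
    have "continuous_on S (\<lambda>c. (1 / max 1 (gradient_norm (P c))) * (\<Sum>b\<in>B. c (ix b) * b x))"
      by (intro continuous_intros cq coord) (simp add: max_def)
    then show "continuous_on S (\<lambda>c. u c x)"
      by (simp only: u_def P_def sum_fun_apply scaleR_fun_def real_scaleR_def)
  qed
  have FS: "F v j \<in> sphere 0 1" if "v \<in> mean_zero_polys t" "j \<in> {1..N}" for v j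
    using F that by (auto simp: Pi_iff PiE_iff)
  have cF: "continuous_on S (\<lambda>c. F (u c))" for S
    by (rule continuous_on_compose2[OF cont cu]) (use u in blast)
  have ch: "continuous_on S (\<lambda>c. h c i)" if i: "i < n" for S i
  proof -
    have "continuous_on S (\<lambda>c. e i (F (u c) j))" if j: "j \<in> {1..N}" for j
      by (rule continuous_on_compose2[OF cb[OF e(1)[OF i]] continuous_on_product_then_coordinatewise[OF cF]])
        (use FS u j in blast)
    then show ?thesis unfolding h_def T_def by (intro continuous_intros)
  qed
  have out: "(\<Sum>i<n. c i * h c i) > 0" if i: "i < n" and ci: "\<bar>c i\<bar> = R" for c i
  proof -
    define q where "q = gradient_norm (P c)"
    have q: "q \<ge> 1" unfolding q_def by (rule big[where c = c and i = i, OF i ci])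
    then have uq: "u c = (1 / q) *\<^sub>R P c" by (simp add: u_def q_def max_absorb2)
    have "gradient_norm (u c) = \<bar>1 / q\<bar> * q"
      unfolding uq gradient_norm_scale[OF P'] by (simp add: q_def)
    then have "gradient_norm (u c) = 1" using q by simp
    from pos[OF u this] have Tu: "T (u c) (u c) > 0" by (simp add: T_def)
    have "(\<Sum>i<n. c i * h c i) = (\<Sum>b\<in>B. c (ix b) * h c (ix b))"
      by (rule sum.reindex_bij_betw[OF ix, symmetric])
    also have "\<dots> = (\<Sum>b\<in>B. c (ix b) * T (u c) b)"
      by (intro sum.cong refl) (simp add: h_def eix)
    also have "\<dots> = T (u c) (P c)" by (simp only: P_def T_sum)
    also have "P c = q *\<^sub>R u c" using q by (simp add: uq)
    also have "T (u c) (q *\<^sub>R u c) = q * T (u c) (u c)" by (rule T_scale)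
    finally show ?thesis using q Tu by simp
  qed
  obtain c where c: "\<And>i. i < n \<Longrightarrow> h c i = 0"
    by (rule outward_field_has_zero[OF R, of n h]) (use ch out in auto)
  define X where "X = image_mset (F (u c)) (mset_set {1..N})"
  have XS: "set_mset X \<subseteq> sphere 0 1" using FS[OF u] by (auto simp: X_def)
  have XY: "(\<Sum>z\<in>#X + Y. f z) = T (u c) f" for f
    by (simp add: X_def T_def sum_unfold_sum_mset image_mset.compositionality o_def)
  have "(\<Sum>z\<in>#X + Y. f z) = 0" if "f \<in> mean_zero_polys t" for f
  proof -
    have f: "f = (\<Sum>b\<in>B. sphere_inner f b *\<^sub>R b)"
      by (rule orthonormal_expansion[OF B(1)]) (simp add: B(2) that)
    have "T (u c) b = 0" if "b \<in> B" for b using c[of "ix b"] eix[OF that] by (simp add: h_def)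
    then have "(\<Sum>b\<in>B. sphere_inner f b * T (u c) b) = 0" by simp
    then have "T (u c) (\<Sum>b\<in>B. sphere_inner f b *\<^sub>R b) = 0" by (simp only: T_sum)
    then show ?thesis unfolding XY using f by simp
  qed
  moreover have "size X = N" by (simp add: X_def)
  moreover have "X + Y \<noteq> {#}" using N \<open>size X = N\<close> by auto
  ultimately show ?thesis using XS Y by (intro exI[of _ X]) (auto simp: spherical_design_iff)
qed

lemma mean_zero_polys_0: "mean_zero_polys 0 = {0}"
proof (intro equalityI subsetI)
  fix f :: "real ^ 'a \<Rightarrow> real" assume "f \<in> mean_zero_polys 0"
  then obtain P where P: "P \<in> polys_upto 0" "f = restrict_sphere P" "(LINT x|sphere_measure. P x) = 0"
    by (auto simp: mean_zero_polys_def)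
  obtain c where c: "P = (\<lambda>x. c)" using polys_upto_0[OF P(1)] by blast
  have "c = 0" using P(3) by (simp only: c sphere_integral_const)
  then show "f \<in> {0}" by (simp add: P(2) c restrict_sphere_def fun_eq_iff)
qed (simp add: subspace_0[OF subspace_mean_zero_polys])

lemma dim_mean_zero_polys_mono:
  assumes "s \<le> t"
  shows "dim (mean_zero_polys s :: (real ^ 'n \<Rightarrow> real) set) \<le> dim (mean_zero_polys t :: (real ^ 'n \<Rightarrow> real) set)"
proof -
  obtain B1 :: "(real ^ 'n \<Rightarrow> real) set" where B1: "orthonormal B1" "span B1 = mean_zero_polys s"
    by (rule mean_zero_basis_extension[OF orthonormal_empty empty_subsetI])
  have "B1 \<subseteq> mean_zero_polys t"
    using span_superset[of B1] B1(2) mean_zero_polys_mono[OF assms] by blast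
  then obtain B2 where B2: "B1 \<subseteq> B2" "orthonormal B2" "span B2 = mean_zero_polys t"
    by (rule mean_zero_basis_extension[OF B1(1)])
  have "card B1 \<le> card B2" using B2(1,2) by (intro card_mono) (auto simp: orthonormal_def)
  then show ?thesis using orthonormal_dim[OF B1(1)] orthonormal_dim[OF B2(2)] by (simp add: B1(2) B2(3))
qed

theorem theorem3:
  fixes d t M :: nat and C1 C2 C3 :: real and Y :: "(real ^ 'n) multiset"
  assumes "d \<ge> 1" and "t \<ge> 1" and "CARD('n) = d + 1"
    and "C1 > 0" and "C2 > 0"
    and "\<And>s N. s \<ge> 1 \<Longrightarrow> real N \<ge> C1 * real s ^ d \<Longrightarrow>
      \<exists>F :: (real ^ 'n \<Rightarrow> real) \<Rightarrow> nat \<Rightarrow> real ^ 'n.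
        F \<in> mean_zero_polys s \<rightarrow> ({1..N} \<rightarrow>\<^sub>E sphere 0 1) \<and>
        continuous_on (mean_zero_polys s) F \<and>
        (\<forall>P \<in> mean_zero_polys s.
          (LINT x|sphere_measure. norm (spherical_gradient P x)) = 1 \<longrightarrow>
          (\<Sum>i = 1..N. P (F P i)) > real N * C2 / real s)"
    and "C3 = sqrt ((real d + 1) / real d)"
    and "set_mset Y \<subseteq> sphere 0 1" and "size Y = M"
  shows "(\<forall>N. real N \<ge> max (C1 * real t ^ d)
        (inverse C2 * C3 * real M * real t *
          sqrt (harmonic_dim (t + 1) (d + 1) *
            real (dim (mean_zero_polys t :: (real ^ 'n \<Rightarrow> real) set)))) \<longrightarrow>
      (\<exists>X. size X = N \<and> set_mset X \<subseteq> sphere 0 1 \<and> spherical_design t (X + Y))) \<and>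
    (\<forall>t1 < t. spherical_design t1 Y \<longrightarrow>
      (\<forall>N. real N \<ge> max (C1 * real t ^ d)
          (inverse C2 * C3 * real M * real t *
            sqrt (real (dim (mean_zero_polys t :: (real ^ 'n \<Rightarrow> real) set)) -
              real (dim (mean_zero_polys t1 :: (real ^ 'n \<Rightarrow> real) set))) *
            sqrt (harmonic_dim (t + 1) (d + 1))) \<longrightarrow>
        (\<exists>X. size X = N \<and> set_mset X \<subseteq> sphere 0 1 \<and> spherical_design t (X + Y))))"
proof -
  let ?m = "harmonic_dim (t + 1) (d + 1)"
  let ?D = "\<lambda>s. real (dim (mean_zero_polys s :: (real ^ 'n \<Rightarrow> real) set))"
  have m0: "?m \<ge> 0" by (rule harmonic_dim_nonneg)
  have main: "\<exists>X. size X = N \<and> set_mset X \<subseteq> sphere 0 1 \<and> spherical_design t (X + Y)"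
    if t1: "t1 \<le> t" and orth: "\<And>S. S \<in> mean_zero_polys t1 \<Longrightarrow> (\<Sum>y\<in>#Y. S y) = 0"
      and N1: "real N \<ge> C1 * real t ^ d"
      and N2: "real N \<ge> inverse C2 * C3 * real M * real t * (sqrt (?D t - ?D t1) * sqrt ?m)" for N t1
  proof -
    obtain F where F: "F \<in> mean_zero_polys t \<rightarrow> ({1..N} \<rightarrow>\<^sub>E sphere (0 :: real ^ 'n) 1)"
      and cont: "continuous_on (mean_zero_polys t) F"
      and pos: "\<forall>P \<in> mean_zero_polys t. (LINT x|sphere_measure. norm (spherical_gradient P x)) = 1 \<longrightarrow>
          (\<Sum>i = 1..N. P (F P i)) > real N * C2 / real t"
      using assms(6)[OF assms(2) N1] by blast
    have "C1 * real t ^ d > 0" using assms by simp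
    then have "N > 0" using N1 by linarith
    moreover have "CARD('n) \<ge> 2" using assms(1,3) by simp
    moreover have "(\<Sum>j = 1..N. Q (F Q j)) + (\<Sum>y\<in>#Y. Q y) > 0"
      if Q: "Q \<in> mean_zero_polys t" and g: "gradient_norm Q = 1" for Q
    proof -
      have sq: "real d * sphere_inner Q Q \<le> ?m"
        using gradient_norm_lower[OF Q] g assms(3) by simp
      then have "sphere_inner Q Q \<le> ?m / real d" using assms(1) by (simp add: field_simps)
      \<comment> \<open>\<open>C3\<close> dominates the factor \<open>1 / sqrt d\<close> of the Poincare inequality.\<close>
      also have "\<dots> \<le> (real d + 1) / real d * ?m"
        using m0 assms(1) by (simp add: field_simps)
      finally have "sqrt (sphere_inner Q Q) \<le> C3 * sqrt ?m"
        unfolding assms(7) real_sqrt_mult[symmetric] by (rule real_sqrt_le_mono)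
      then have sup: "sqrt (sphere_inner Q Q) \<le> C3 * sqrt ?m" .
      have "\<bar>\<Sum>y\<in>#Y. Q y\<bar> \<le> real M * (sqrt (?D t - ?D t1) * sqrt (sphere_inner Q Q))"
        unfolding assms(9)[symmetric] by (rule point_sum_le[OF t1 assms(8) _ Q]) (rule orth)
      also have "\<dots> \<le> real M * (sqrt (?D t - ?D t1) * (C3 * sqrt ?m))"
        using dim_mean_zero_polys_mono[OF t1, where 'n = 'n] by (intro mult_left_mono sup) auto
      also have "\<dots> \<le> real N * C2 / real t"
        using N2 assms(2,5) by (simp add: field_simps)
      finally show ?thesis using pos Q g unfolding gradient_norm_def by fastforce
    qed
    ultimately show ?thesis by (intro design_extension[OF _ _ assms(8) F cont])
  qed
  show ?thesis
  proof (intro conjI allI impI)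
    fix N
    assume N: "real N \<ge> max (C1 * real t ^ d) (inverse C2 * C3 * real M * real t * sqrt (?m * ?D t))"
    \<comment> \<open>Part (i) is the degenerate case of degree 0.\<close>
    have "(\<Sum>y\<in>#Y. S y) = 0" if "S \<in> mean_zero_polys 0" for S
      using that by (simp add: mean_zero_polys_0)
    moreover have "?D 0 = 0"
      using dim_le_card[of "{0 :: real ^ 'n \<Rightarrow> real}" "{}"] by (simp add: mean_zero_polys_0)
    ultimately show "\<exists>X. size X = N \<and> set_mset X \<subseteq> sphere 0 1 \<and> spherical_design t (X + Y)"
      using N by (intro main[of 0]) (simp_all add: real_sqrt_mult mult_ac)
  next
    fix t1 N
    assume "t1 < t" "spherical_design t1 Y" and N: "real N \<ge> max (C1 * real t ^ d)
      (inverse C2 * C3 * real M * real t * sqrt (?D t - ?D t1) * sqrt ?m)"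
    then show "\<exists>X. size X = N \<and> set_mset X \<subseteq> sphere 0 1 \<and> spherical_design t (X + Y)"
      by (intro main[of t1]) (auto simp: spherical_design_iff mult.assoc)
  qed
qed

end
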